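(* There exist absolute constants $C,c>0$ and $n_0\in\mathbb{N}$ such that, for every $n\ge n_0$, $$\mathbb{P}\left(|\operatorname{Per}(M_n)|\ge e^{-Cn}\sqrt{n!}\right)\ge 1-n^{-c}.$$
   Context: $M_n=(\xi_{ij})_{1\le i,j\le n}$ is an $n\times n$ random matrix whose entries are independent Rademacher random variables, i.e. $\mathbb{P}(\xi_{ij}=1)=\mathbb{P}(\xi_{ij}=-1)=\tfrac12$. The permanent is $\operatorname{Per}(M_n)=\sum_{\sigma\in S_n}\prod_{i=1}^n\xi_{i,\sigma(i)}$, where $S_n$ is the symmetric group on $\{1,\dots,n\}$. *)

theory Defs
  imports "HOL-Probability.Probability" "HOL-Combinatorics.Permutations"
begin

text \<open>The \<open>n \<times> n\<close> matrices are the functions on \<open>nat \<times> nat\<close>; only the entries with both indices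
  in \<open>{1..n}\<close> matter.\<close>

definition permanent :: "nat \<Rightarrow> (nat \<times> nat \<Rightarrow> 'a::comm_semiring_1) \<Rightarrow> 'a" where
  "permanent n A = (\<Sum>\<sigma> | \<sigma> permutes {1..n}. \<Prod>i=1..n. A (i, \<sigma> i))"

definition rademacher_pmf :: "real pmf" where
  "rademacher_pmf = pmf_of_set {-1, 1}"

text \<open>The law of \<open>M\<^sub>n\<close>: a product measure, so that the entries are independent. Entries outside
  \<open>{1..n} \<times> {1..n}\<close> are set to the dummy value \<open>0\<close>.\<close>

definition rademacher_matrix_pmf :: "nat \<Rightarrow> (nat \<times> nat \<Rightarrow> real) pmf" where
  "rademacher_matrix_pmf n = Pi_pmf ({1..n} \<times> {1..n}) 0 (\<lambda>_. rademacher_pmf)"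

lemma pmf_rademacher_pmf:
  "pmf rademacher_pmf 1 = 1 / 2" "pmf rademacher_pmf (-1) = 1 / 2"
  by (simp_all add: rademacher_pmf_def)

lemma rademacher_matrix_entry:
  assumes "i \<in> {1..n}" "j \<in> {1..n}"
  shows "map_pmf (\<lambda>A. A (i, j)) (rademacher_matrix_pmf n) = rademacher_pmf"
  using assms by (simp add: rademacher_matrix_pmf_def Pi_pmf_component)

lemma indep_vars_rademacher_matrix:
  "prob_space.indep_vars (measure_pmf (rademacher_matrix_pmf n)) (\<lambda>_. borel)
     (\<lambda>ij A. A ij) ({1..n} \<times> {1..n})"
proof -
  have "prob_space.indep_vars (measure_pmf (rademacher_matrix_pmf n)) (\<lambda>_. count_space UNIV)
      (\<lambda>ij A. A ij) ({1..n} \<times> {1..n})"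
    unfolding rademacher_matrix_pmf_def by (rule indep_vars_Pi_pmf) simp
  then show ?thesis
    by (rule prob_space.indep_vars_compose2[OF measure_pmf.prob_space_axioms,
          where Y = "\<lambda>_ x. x"]) simp
qed

end

theory Submission
  imports Defs "HOL-Real_Asymp.Real_Asymp"
begin

text \<open>The matrix is revealed row by row. When \<open>m\<close> rows are left, the state is the function \<open>f\<close> that sends
a set \<open>T\<close> of \<open>m\<close> columns to the permanent of the revealed rows on the columns outside \<open>T\<close>. A new row
\<open>\<xi>\<close> turns \<open>f\<close> into \<open>step U \<xi> f\<close>, by Laplace expansion, and the permanent is the value of the last
state at \<open>{}\<close>. Size and spread of \<open>f\<close> are won separately, with two different potentials.

Size. On average a row multiplies the sum of squares of \<open>f\<close> by \<open>m\<close>. For a set \<open>T\<close> of \<open>m\<close> columns, fix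
the signs outside \<open>T\<close>: then the values at the \<open>m\<close> sets \<open>T - {i}\<close> are independent, and each has absolute
value at least \<open>\<bar>f T\<bar>\<close> for one of the two signs of \<open>\<xi> i\<close> (\<open>good_bits\<close>). So, except with probability
exponentially small in \<open>m\<close>, the new sum of squares is at least its mean divided by \<open>8 n\<close> (\<open>ssq_drop\<close>).
Losing a factor \<open>n\<close> in each of \<open>n\<close> rows would be too much, but such a loss is rare: the new state is a
signed sum of vectors none of which carries more than the fraction \<open>1 / m\<close> of the total, and a small
ball inequality for sums in a Euclidean space gives a power bound for the lower tail
(\<open>ssq_small_ball\<close>). Hence a negative moment of the ratio is bounded, the losses multiply to
\<open>exp (O (n))\<close>, and when about \<open>sqrt n\<close> rows are left some set \<open>T\<close> is heavy, that is,
\<open>\<theta> \<le> \<bar>f T\<bar>\<close> for \<open>\<theta> = exp (- C n) * sqrt (n!)\<close> (\<open>magnitude_phase\<close>).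

Spread. A single heavy set does not prevent the last rows from cancelling. From now on only the
number \<open>N\<close> of heavy sets counts, through \<open>Y\<close> defined by \<open>Y ^ m = N * m!\<close>. By an entropy inequality of Han's
type (\<open>family_entropy\<close>) the logarithm of the degree of \<open>T - {i}\<close>, its number of heavy extensions, is on average
at most \<open>ln Y\<close>. Together with the independence above this shows that a row lowers \<open>ln Y\<close> by at most
\<open>(4/5) / (m - 1)\<close>, except with tiny probability (\<open>heavies_drop\<close>). As \<open>4/5 < 1\<close>, the number \<open>Y\<close>, which
is at least about \<open>sqrt n / e\<close> at first, is still a power of \<open>n\<close> when \<open>n powr (1/100)\<close> rows are left.

From there on one of two things happens. Either some family of heavy sets has only large
degrees; then the Littlewood-Offord inequality, applied level by level, shows that the permanent is
below \<open>\<theta>\<close> with probability at most a negative power of \<open>n\<close> (\<open>light_le_core\<close>). Or every family of heavy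
sets has a degree that is small; then the shadow of the heavy sets is so large (\<open>card_le_shadow\<close>) that with
probability at least \<open>1/3\<close> the number \<open>Y\<close> grows by the factor \<open>n powr (1 / (50 * (m - 1)))\<close>. Since \<open>Y\<close>
never exceeds \<open>n\<close>, the second alternative cannot persist until \<open>n powr (1/1000)\<close> rows are left
(\<open>growth_phase\<close>).\<close>

section \<open>Averages over signs\<close>

text \<open>The signs vanish off \<open>V\<close>, so that a row of a matrix of signs is again such a vector. The mean over the
finitely many sign vectors is the expectation for independent uniform signs.\<close>

definition signs :: "'a set \<Rightarrow> ('a \<Rightarrow> real) set" where
  "signs V = PiE_dflt V 0 (\<lambda>_. {-1, 1})"

definition avg :: "'a set \<Rightarrow> (('a \<Rightarrow> real) \<Rightarrow> real) \<Rightarrow> real" where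
  "avg V g = (\<Sum>\<xi>\<in>signs V. g \<xi>) / 2 ^ card V"

abbreviation pr :: "'a set \<Rightarrow> (('a \<Rightarrow> real) \<Rightarrow> bool) \<Rightarrow> real" where
  "pr V P \<equiv> avg V (\<lambda>\<xi>. of_bool (P \<xi>))"

lemma finite_signs: "finite V \<Longrightarrow> finite (signs V)"
  unfolding signs_def by (intro finite_PiE_dflt) auto

lemma card_signs: "finite V \<Longrightarrow> card (signs V) = 2 ^ card V"
  unfolding signs_def by (subst card_PiE_dflt) (auto simp: numeral_2_eq_2)

lemma signs_sq: "\<xi> \<in> signs V \<Longrightarrow> x \<in> V \<Longrightarrow> \<xi> x * \<xi> x = 1"
  unfolding signs_def PiE_dflt_def by auto

lemma avg_cong: "(\<And>\<xi>. \<xi> \<in> signs V \<Longrightarrow> g \<xi> = h \<xi>) \<Longrightarrow> avg V g = avg V h"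
  unfolding avg_def by (simp cong: sum.cong)

lemma avg_mono: "(\<And>\<xi>. \<xi> \<in> signs V \<Longrightarrow> g \<xi> \<le> h \<xi>) \<Longrightarrow> avg V g \<le> avg V h"
  unfolding avg_def by (intro divide_right_mono sum_mono) auto

lemma avg_const: "finite V \<Longrightarrow> avg V (\<lambda>_. c) = c"
  unfolding avg_def by (simp add: card_signs)

lemma avg_add: "avg V (\<lambda>\<xi>. g \<xi> + h \<xi>) = avg V g + avg V h"
  unfolding avg_def by (simp add: sum.distrib add_divide_distrib)

lemma avg_diff: "avg V (\<lambda>\<xi>. g \<xi> - h \<xi>) = avg V g - avg V h"
  unfolding avg_def by (simp add: sum_subtractf diff_divide_distrib)

lemma avg_cmult: "avg V (\<lambda>\<xi>. c * g \<xi>) = c * avg V g"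
  unfolding avg_def by (simp add: sum_distrib_left)

lemma avg_cmult_right: "avg V (\<lambda>\<xi>. g \<xi> * c) = avg V g * c"
  unfolding avg_def by (simp add: sum_distrib_right)

lemma avg_divide: "avg V (\<lambda>\<xi>. g \<xi> / c) = avg V g / c"
  unfolding avg_def by (simp add: sum_divide_distrib mult.commute)

lemma avg_sum: "avg V (\<lambda>\<xi>. \<Sum>i\<in>I. g i \<xi>) = (\<Sum>i\<in>I. avg V (g i))"
  unfolding avg_def by (simp add: sum.swap[of _ _ I] sum_divide_distrib)

lemma avg_nonneg: "(\<And>\<xi>. \<xi> \<in> signs V \<Longrightarrow> 0 \<le> g \<xi>) \<Longrightarrow> 0 \<le> avg V g"
  unfolding avg_def by (intro divide_nonneg_nonneg sum_nonneg) auto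

lemma avg_le_const: 
  "finite V \<Longrightarrow> (\<And>\<xi>. \<xi> \<in> signs V \<Longrightarrow> g \<xi> \<le> c) \<Longrightarrow> avg V g \<le> c"
  using avg_mono[of V g "\<lambda>_. c"] by (simp add: avg_const)

lemma avg_ge_const: 
  "finite V \<Longrightarrow> (\<And>\<xi>. \<xi> \<in> signs V \<Longrightarrow> c \<le> g \<xi>) \<Longrightarrow> c \<le> avg V g"
  using avg_mono[of V "\<lambda>_. c" g] by (simp add: avg_const)

lemma pr_mono: "(\<And>\<xi>. \<xi> \<in> signs V \<Longrightarrow> P \<xi> \<Longrightarrow> Q \<xi>) \<Longrightarrow> pr V P \<le> pr V Q"
  by (intro avg_mono) auto

lemma pr_le_1: "finite V \<Longrightarrow> pr V P \<le> 1"
  by (intro avg_le_const) auto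

lemma pr_not:
  assumes "finite V"
  shows "pr V (\<lambda>\<xi>. \<not> P \<xi>) = 1 - pr V P"
proof -
  have "pr V (\<lambda>\<xi>. \<not> P \<xi>) = avg V (\<lambda>\<xi>. 1 - of_bool (P \<xi>))"
    by (intro avg_cong) auto
  then show ?thesis using assms by (simp only: avg_diff avg_const)
qed

lemma pr_markov:
  assumes "\<And>\<xi>. \<xi> \<in> signs V \<Longrightarrow> 0 \<le> X \<xi>" "a > 0"
  shows "pr V (\<lambda>\<xi>. X \<xi> \<ge> a) \<le> avg V X / a"
  unfolding avg_divide[symmetric]
  by (intro avg_mono) (use assms in \<open>auto simp: of_bool_def\<close>)

lemma avg_empty: "avg {} g = g (\<lambda>_. 0)"
proof -
  have "signs ({} :: 'a set) = {\<lambda>_. 0}"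
    unfolding signs_def PiE_dflt_def by auto
  then show ?thesis unfolding avg_def by simp
qed

lemma signs_insert:
  assumes "x \<notin> V"
  shows "signs (insert x V) = (\<lambda>(s, \<xi>). \<xi>(x := s)) ` ({1, -1} \<times> signs V)"
proof (intro equalityI subsetI)
  fix \<xi> assume e: "\<xi> \<in> signs (insert x V)"
  have "\<xi> = (\<xi>(x := 0))(x := \<xi> x)" "\<xi>(x := 0) \<in> signs V" "\<xi> x \<in> {1, -1}"
    using e assms unfolding signs_def PiE_dflt_def by auto
  then show "\<xi> \<in> (\<lambda>(s, \<xi>). \<xi>(x := s)) ` ({1, -1} \<times> signs V)"
    by (intro image_eqI[of _ _ "(\<xi> x, \<xi>(x := 0))"]) auto
next
  fix \<xi> assume "\<xi> \<in> (\<lambda>(s, \<xi>). \<xi>(x := s)) ` ({1, -1} \<times> signs V)"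
  then obtain s b where "\<xi> = b(x := s)" "s \<in> {1, -1}" "b \<in> signs V" by auto
  then show "\<xi> \<in> signs (insert x V)"
    unfolding signs_def PiE_dflt_def by (cases "s = 1") auto
qed

lemma avg_insert:
  assumes "finite V" "x \<notin> V"
  shows "avg (insert x V) g = avg V (\<lambda>\<xi>. (g (\<xi>(x := 1)) + g (\<xi>(x := -1))) / 2)"
proof -
  have inj: "inj_on (\<lambda>(s, \<xi>). \<xi>(x := s)) ({1, -1} \<times> signs V)"
  proof (rule inj_onI, clarify)
    fix s t :: real and a b
    assume *: "a \<in> signs V" "b \<in> signs V" "a(x := s) = b(x := t)"
    have "s = t" using fun_cong[OF *(3), of x] by simp
    moreover have "a = b"
    proof
      fix y show "a y = b y"
        using fun_cong[OF *(3), of y] *(1,2) assms by (cases "y = x") (auto simp: signs_def PiE_dflt_def)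
    qed
    ultimately show "s = t \<and> a = b" by simp
  qed
  have "(\<Sum>\<xi>\<in>signs (insert x V). g \<xi>) = (\<Sum>(s, \<xi>)\<in>{1, -1} \<times> signs V. g (\<xi>(x := s)))"
    unfolding signs_insert[OF assms(2)] using sum.reindex[OF inj, of g] by (simp add: case_prod_unfold o_def)
  also have "\<dots> = (\<Sum>\<xi>\<in>signs V. g (\<xi>(x := 1)) + g (\<xi>(x := -1)))"
    by (simp add: sum.cartesian_product[symmetric] sum.distrib)
  finally show ?thesis
    unfolding avg_def using assms by (simp add: sum_divide_distrib[symmetric])
qed

definition merge_on :: "'a set \<Rightarrow> ('a \<Rightarrow> real) \<Rightarrow> ('a \<Rightarrow> real) \<Rightarrow> 'a \<Rightarrow> real" where
  "merge_on A \<alpha> \<beta> = (\<lambda>x. if x \<in> A then \<alpha> x else \<beta> x)"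

lemma merge_on_simps [simp]:
  "x \<in> A \<Longrightarrow> merge_on A \<alpha> \<beta> x = \<alpha> x" "x \<notin> A \<Longrightarrow> merge_on A \<alpha> \<beta> x = \<beta> x"
  by (auto simp: merge_on_def)

lemma avg_Un:
  assumes "finite A" "finite B" "A \<inter> B = {}"
  shows "avg (A \<union> B) g = avg A (\<lambda>\<alpha>. avg B (\<lambda>\<beta>. g (merge_on A \<alpha> \<beta>)))"
  using assms(1,3)
proof (induction A arbitrary: g rule: finite_induct)
  case empty
  then show ?case by (simp add: avg_empty merge_on_def)
next
  case (insert a A)
  have m: "merge_on (insert a A) (\<alpha>(a := s)) \<beta> = (merge_on A \<alpha> \<beta>)(a := s)" for \<alpha> \<beta> s
    using insert by (auto simp: merge_on_def fun_eq_iff)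
  have "avg (insert a A \<union> B) g = avg (A \<union> B) (\<lambda>\<xi>. (g (\<xi>(a := 1)) + g (\<xi>(a := -1))) / 2)"
    using insert assms(2) by (simp add: avg_insert)
  also have "\<dots> = avg A (\<lambda>\<alpha>. avg B (\<lambda>\<beta>. (g ((merge_on A \<alpha> \<beta>)(a := 1)) + g ((merge_on A \<alpha> \<beta>)(a := -1))) / 2))"
    using insert by simp
  also have "\<dots> = avg (insert a A) (\<lambda>\<alpha>. avg B (\<lambda>\<beta>. g (merge_on (insert a A) \<alpha> \<beta>)))"
    using insert by (simp add: avg_insert m avg_add avg_divide)
  finally show ?case .
qed

lemma avg_split:
  assumes "finite V" "A \<subseteq> V"
  shows "avg V g = avg A (\<lambda>\<alpha>. avg (V - A) (\<lambda>\<beta>. g (merge_on A \<alpha> \<beta>)))"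
  using avg_Un[of A "V - A" g] assms by (auto simp: finite_subset Un_absorb1)

lemma avg_uminus: "avg V g = avg V (\<lambda>\<xi>. g (\<lambda>x. - \<xi> x))"
proof -
  have "bij_betw (\<lambda>\<xi> x. - \<xi> x) (signs V) (signs V)"
    by (rule bij_betwI[where g = "\<lambda>\<xi> x. - \<xi> x"]) (auto simp: signs_def PiE_dflt_def)
  then show ?thesis
    unfolding avg_def by (subst sum.reindex_bij_betw[symmetric]) auto
qed

lemma avg_prod:
  assumes "finite V"
  shows "avg V (\<lambda>\<xi>. \<Prod>x\<in>V. h x (\<xi> x)) = (\<Prod>x\<in>V. (h x 1 + h x (-1)) / 2)"
  using assms
proof (induction V rule: finite_induct)
  case empty
  then show ?case by (simp add: avg_empty)
next
  case (insert a A)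
  have e: "(\<Prod>x\<in>insert a A. h x ((\<xi>(a := s)) x)) = h a s * (\<Prod>x\<in>A. h x (\<xi> x))" for \<xi> s
    using insert by (subst prod.insert) (auto intro!: prod.cong)
  have "avg (insert a A) (\<lambda>\<xi>. \<Prod>x\<in>insert a A. h x (\<xi> x)) 
      = avg A (\<lambda>\<xi>. (h a 1 + h a (-1)) / 2 * (\<Prod>x\<in>A. h x (\<xi> x)))"
    using insert by (subst avg_insert) (simp_all add: e[of _ 1] e[of _ "-1"] field_simps del: fun_upd_apply)
  also have "\<dots> = (h a 1 + h a (-1)) / 2 * (\<Prod>x\<in>A. (h x 1 + h x (-1)) / 2)"
    unfolding avg_cmult insert by simp
  finally show ?case using insert by simp
qed

section \<open>Small balls for sums of signed vectors\<close>

definition sqn :: "'i set \<Rightarrow> ('i \<Rightarrow> real) \<Rightarrow> real" where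
  "sqn I w = (\<Sum>i\<in>I. (w i)\<^sup>2)"

definition wsum :: "'a set \<Rightarrow> ('a \<Rightarrow> 'i \<Rightarrow> real) \<Rightarrow> ('a \<Rightarrow> real) \<Rightarrow> 'i \<Rightarrow> real" where
  "wsum V v \<xi> = (\<lambda>i. \<Sum>x\<in>V. \<xi> x * v x i)"

text \<open>The small ball inequality is proved by induction for a union of \<open>k\<close> sets of diameter below
\<open>2 * r\<close>, where \<open>r\<close> is a lower bound for the lengths of the vectors; a ball of radius \<open>r\<close> is the case \<open>k = 1\<close>.\<close>

definition covers :: "'i set \<Rightarrow> real \<Rightarrow> nat \<Rightarrow> ('i \<Rightarrow> real) set \<Rightarrow> bool" where
  "covers I r k A \<longleftrightarrow> (\<exists>\<D>. finite \<D> \<and> card \<D> \<le> k \<and> A \<subseteq> \<Union>\<D> \<and>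
     (\<forall>D\<in>\<D>. \<forall>d\<in>D. \<forall>d'\<in>D. sqn I (\<lambda>i. d i - d' i) < 4 * r\<^sup>2))"

lemma sqn_nonneg: "0 \<le> sqn I w"
  unfolding sqn_def by (intro sum_nonneg) auto

lemma covers_0: "covers I r 0 A \<Longrightarrow> A = {}"
  unfolding covers_def by auto

lemma covers_Un:
  assumes "covers I r k A" "covers I r l B"
  shows "covers I r (k + l) (A \<union> B)"
proof -
  obtain \<D> where D: "finite \<D>" "card \<D> \<le> k" "A \<subseteq> \<Union>\<D>"
      "\<forall>D\<in>\<D>. \<forall>d\<in>D. \<forall>d'\<in>D. sqn I (\<lambda>i. d i - d' i) < 4 * r\<^sup>2"
    using assms(1) unfolding covers_def by blast
  obtain \<E> where E: "finite \<E>" "card \<E> \<le> l" "B \<subseteq> \<Union>\<E>"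
      "\<forall>D\<in>\<E>. \<forall>d\<in>D. \<forall>d'\<in>D. sqn I (\<lambda>i. d i - d' i) < 4 * r\<^sup>2"
    using assms(2) unfolding covers_def by blast
  show ?thesis unfolding covers_def
  proof (intro exI[of _ "\<D> \<union> \<E>"] conjI)
    show "card (\<D> \<union> \<E>) \<le> k + l" using card_Un_le[of \<D> \<E>] D(2) E(2) by linarith
    show "A \<union> B \<subseteq> \<Union> (\<D> \<union> \<E>)" using D(3) E(3) by blast
    show "\<forall>D\<in>\<D> \<union> \<E>. \<forall>d\<in>D. \<forall>d'\<in>D. sqn I (\<lambda>i. d i - d' i) < 4 * r\<^sup>2"
      using D(4) E(4) by blast
  qed (use D E in auto)
qed

lemma covers_translate:
  assumes "covers I r k A"
  shows "covers I r k ((\<lambda>d i. d i + a i) ` A)"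
proof -
  obtain \<D> where D: "finite \<D>" "card \<D> \<le> k" "A \<subseteq> \<Union>\<D>"
      "\<forall>D\<in>\<D>. \<forall>d\<in>D. \<forall>d'\<in>D. sqn I (\<lambda>i. d i - d' i) < 4 * r\<^sup>2"
    using assms unfolding covers_def by blast
  show ?thesis unfolding covers_def
  proof (intro exI[of _ "(`) (\<lambda>d i. d i + a i) ` \<D>"] conjI)
    show "card ((`) (\<lambda>d i. d i + a i) ` \<D>) \<le> k"
      using card_image_le[OF D(1)] D(2) by (rule order_trans)
    show "(\<lambda>d i. d i + a i) ` A \<subseteq> \<Union> ((`) (\<lambda>d i. d i + a i) ` \<D>)"
      using image_mono[OF D(3), of "\<lambda>d i. d i + a i"] by (simp only: image_Union)
  qed (use D in auto)
qed

text \<open>This is Kleitman's step. Take for \<open>D\<close> a member of the cover that contains a point of \<open>A\<close> extremal in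
direction \<open>a\<close>. The diameter of \<open>D\<close> is below \<open>2 * r\<close> and \<open>a\<close> is no shorter than \<open>r\<close>, so \<open>D\<close> shifted by
\<open>2 * a\<close> lies beyond \<open>A\<close>. In the sum of the counts for \<open>A + a\<close> and \<open>A - a\<close> the translate of \<open>D\<close> can therefore
change sides: \<open>k + 1\<close> classes become \<open>k\<close> and \<open>k + 2\<close>.\<close>

lemma covers_split:
  assumes "finite I" "finite A" "covers I r (Suc k) A" "r\<^sup>2 \<le> sqn I a" "r > 0"
  obtains D where "D \<subseteq> A" "covers I r 1 D" "covers I r k (A - D)"
    "\<And>d d'. d \<in> D \<Longrightarrow> d' \<in> A \<Longrightarrow> (\<lambda>i. d i + a i) \<noteq> (\<lambda>i. d' i - a i)"
proof (cases "A = {}")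
  case True
  show ?thesis
    by (rule that[of "{}"]) (auto simp: True covers_def intro!: exI[of _ "{}"])
next
  case False
  obtain \<D> where "finite \<D> \<and> card \<D> \<le> Suc k \<and> A \<subseteq> \<Union>\<D> \<and>
      (\<forall>D\<in>\<D>. \<forall>d\<in>D. \<forall>d'\<in>D. sqn I (\<lambda>i. d i - d' i) < 4 * r\<^sup>2)"
    using assms(3) unfolding covers_def ..
  then have D: "finite \<D>" "card \<D> \<le> Suc k" "A \<subseteq> \<Union>\<D>"
      "\<And>D d d'. D \<in> \<D> \<Longrightarrow> d \<in> D \<Longrightarrow> d' \<in> D \<Longrightarrow> sqn I (\<lambda>i. d i - d' i) < 4 * r\<^sup>2"
    by simp_all
  define ip where "ip d = (\<Sum>i\<in>I. d i * a i)" for d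
  have "Max (ip ` A) \<in> ip ` A" using assms(2) False by (intro Max_in) auto
  then obtain m where m: "m \<in> A" "ip m = Max (ip ` A)" by auto
  have max: "ip d \<le> ip m" if "d \<in> A" for d
    using m assms(2) that by simp
  obtain D0 where D0: "D0 \<in> \<D>" "m \<in> D0" using m D by auto
  show ?thesis
  proof (rule that[of "A \<inter> D0"])
    show "covers I r 1 (A \<inter> D0)"
      unfolding covers_def by (rule exI[of _ "{D0}"]) (use D D0 in auto)
    show "covers I r k (A - A \<inter> D0)"
      unfolding covers_def by (rule exI[of _ "\<D> - {D0}"]) (use D D0 in auto)
  next
    fix d d' assume dd: "d \<in> A \<inter> D0" "d' \<in> A"
    show "(\<lambda>i. d i + a i) \<noteq> (\<lambda>i. d' i - a i)"
    proof
      assume eq: "(\<lambda>i. d i + a i) = (\<lambda>i. d' i - a i)"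
      have "d' i = d i + 2 * a i" for i using fun_cong[OF eq, of i] by simp
      then have "ip d' = ip d + 2 * sqn I a"
        unfolding ip_def sqn_def 
        by (simp add: algebra_simps sum.distrib sum_distrib_left power2_eq_square)
      then have le: "2 * sqn I a \<le> (\<Sum>i\<in>I. (m i - d i) * a i)"
        using max[OF dd(2)] unfolding ip_def by (simp add: algebra_simps sum_subtractf)
      have pos: "sqn I a > 0" using assms(4) zero_less_power[OF assms(5), of 2] by linarith
      have "(2 * sqn I a)\<^sup>2 \<le> (\<Sum>i\<in>I. (m i - d i) * a i)\<^sup>2"
        using le pos by (intro power_mono) auto
      also have "\<dots> \<le> sqn I (\<lambda>i. m i - d i) * sqn I a"
        unfolding sqn_def by (rule Cauchy_Schwarz_ineq_sum)
      also have "\<dots> < 4 * r\<^sup>2 * sqn I a"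
        using D(4)[OF D0(1) D0(2), of d] dd pos by (intro mult_strict_right_mono) auto
      also have "\<dots> \<le> 4 * sqn I a * sqn I a"
        using assms(4) pos by (intro mult_right_mono) auto
      finally show False by (simp add: power2_eq_square)
    qed
  qed auto
qed

text \<open>The recursion on the number of classes is that of the probability that a random walk started at \<open>k\<close>
has not reached \<open>0\<close> after \<open>L\<close> steps. This function is an upper bound for that probability if \<open>C\<close> is large;
the exponent is not the sharp one, but any negative power of \<open>L\<close> serves.\<close>

definition walk_bound :: "real \<Rightarrow> nat \<Rightarrow> nat \<Rightarrow> real" where
  "walk_bound C L k = min 1 (C * sqrt (real k) * (real L + 1) powr (-1/4))"

lemma sqrt_neighbours:
  assumes "x \<ge> (1::real)"
  shows "sqrt (x + 1) + sqrt (x - 1) \<le> 2 * sqrt x * (1 - 1 / (8 * x\<^sup>2))"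
proof -
  have x: "x > 0" using assms by simp
  have x2: "1 \<le> x\<^sup>2" using assms by (simp add: one_le_power)
  then have q: "1 / (8 * x\<^sup>2) \<le> 1" and q2: "1 / (2 * x\<^sup>2) \<le> 1"
    using x by (auto simp: divide_le_eq)
  have "sqrt (x\<^sup>2 - 1) \<le> x * (1 - 1 / (2 * x\<^sup>2))"
  proof (rule real_le_lsqrt)
    show "0 \<le> x * (1 - 1 / (2 * x\<^sup>2))"
      using x q2 by simp
    have "(x * (1 - 1 / (2 * x\<^sup>2)))\<^sup>2 = x\<^sup>2 - 1 + 1 / (4 * x\<^sup>2)"
      using x by (simp add: field_simps power2_eq_square)
    then show "x\<^sup>2 - 1 \<le> (x * (1 - 1 / (2 * x\<^sup>2)))\<^sup>2" by simp
  qed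
  moreover have "sqrt (x + 1) * sqrt (x - 1) = sqrt (x\<^sup>2 - 1)"
    by (simp add: real_sqrt_mult[symmetric] algebra_simps power2_eq_square)
  ultimately have "(sqrt (x + 1) + sqrt (x - 1))\<^sup>2 \<le> 2 * x + 2 * (x * (1 - 1 / (2 * x\<^sup>2)))"
    using assms by (simp add: power2_sum)
  also have "\<dots> = 4 * x * (1 - 1 / (4 * x\<^sup>2))"
    using x by (simp add: field_simps power2_eq_square)
  also have "\<dots> \<le> 4 * x * (1 - 1 / (8 * x\<^sup>2))\<^sup>2"
  proof (intro mult_left_mono)
    have "(1 - 1 / (8 * x\<^sup>2))\<^sup>2 = 1 - 1 / (4 * x\<^sup>2) + (1 / (8 * x\<^sup>2))\<^sup>2"
      by (simp add: power2_diff)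
    then show "1 - 1 / (4 * x\<^sup>2) \<le> (1 - 1 / (8 * x\<^sup>2))\<^sup>2"
      by (metis le_add_same_cancel1 zero_le_power2)
  qed (use x in auto)
  also have "\<dots> = (2 * sqrt x * (1 - 1 / (8 * x\<^sup>2)))\<^sup>2"
    using x by (simp add: power_mult_distrib)
  finally show ?thesis
    by (rule power2_le_imp_le) (use q x in \<open>auto intro!: mult_nonneg_nonneg\<close>)
qed

text \<open>The bound is superharmonic also for a lazy walk, which moves with probability \<open>g\<close> only. Where it is
below \<open>1\<close>, \<open>k\<^sup>2\<close> is at most \<open>(L + 2) / C ^ 4\<close>, and there the concavity of the square root gains more than the
factor in \<open>L\<close> loses.\<close>

lemma walk_bound_step:
  assumes "p > 0" "p \<le> g" "g \<le> 1" "C > 0" "8 \<le> C ^ 4 * p"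
  shows "(1 - g) * walk_bound C L (Suc k) +
    g * ((walk_bound C L (Suc (Suc k)) + walk_bound C L k) / 2) \<le> walk_bound C (Suc L) (Suc k)"
proof -
  define x where "x = real (Suc k)"
  define s where "s = (real L + 1) powr (-1/4)"
  define t where "t = (real L + 2) powr (-1/4)"
  have x: "x \<ge> 1" and s: "s > 0" and t: "t > 0" unfolding x_def s_def t_def by auto
  have le1: "(1 - g) * walk_bound C L (Suc k) +
    g * ((walk_bound C L (Suc (Suc k)) + walk_bound C L k) / 2) \<le> (1 - g) * 1 + g * ((1 + 1) / 2)"
    unfolding walk_bound_def using assms 
    by (intro add_mono mult_left_mono divide_right_mono) auto
  show ?thesis
  proof (cases "C * sqrt x * t \<ge> 1")
    case True
    then show ?thesis using le1 unfolding walk_bound_def t_def x_def by (simp add: add_ac)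
  next
    case False
    have "C * sqrt x * t < 1" using False by simp
    then have "(C * sqrt x * t) ^ 4 < 1"
      using assms(4) x t by (intro power_less_one_iff[THEN iffD2]) (auto intro!: mult_nonneg_nonneg)
    moreover have "t ^ 4 = 1 / (real L + 2)"
      unfolding t_def by (subst powr_power) (auto simp: powr_minus_divide)
    moreover have "sqrt x ^ 4 = x\<^sup>2" using x by (simp add: power4_eq_xxxx power2_eq_square)
    ultimately have "C ^ 4 * x\<^sup>2 < real L + 2"
      by (simp add: power_mult_distrib divide_less_eq)
    then have "p * (C ^ 4 * x\<^sup>2) < p * (real L + 2)" using assms(1) by simp
    moreover have "8 * x\<^sup>2 \<le> (C ^ 4 * p) * x\<^sup>2" using assms(5) by (intro mult_right_mono) auto
    ultimately have "8 * x\<^sup>2 < p * (real L + 2)" by (simp add: mult_ac)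
    then have pl: "1 / (real L + 2) \<le> p / (8 * x\<^sup>2)"
      using x by (simp add: divide_simps mult.commute)
    have tq: "(1 - 1 / (real L + 2)) * s \<le> t"
    proof -
      have eq: "1 - 1 / (real L + 2) = (real L + 1) / (real L + 2)" by (simp add: field_simps)
      have "(real L + 1) / (real L + 2) \<le> ((real L + 1) / (real L + 2)) powr (1/4)"
        using powr_mono'[of "1/4" 1 "(real L + 1) / (real L + 2)"] by simp
      also have "\<dots> = t / s"
        unfolding s_def t_def by (simp add: powr_divide powr_minus field_simps)
      finally show ?thesis unfolding eq using s by (simp add: le_divide_eq)
    qed
    have "(1 - g) * walk_bound C L (Suc k) +
        g * ((walk_bound C L (Suc (Suc k)) + walk_bound C L k) / 2)
      \<le> (1 - g) * (C * sqrt x * s) + g * ((C * sqrt (x + 1) * s + C * sqrt (x - 1) * s) / 2)"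
      unfolding walk_bound_def x_def s_def using assms
      by (intro add_mono mult_left_mono divide_right_mono) (auto simp: add_ac)
    also have "\<dots> = C * s * ((1 - g) * sqrt x + g * ((sqrt (x + 1) + sqrt (x - 1)) / 2))"
      by (simp add: algebra_simps)
    also have "\<dots> \<le> C * s * ((1 - g) * sqrt x + g * ((2 * sqrt x * (1 - 1 / (8 * x\<^sup>2))) / 2))"
      using sqrt_neighbours[OF x] assms s
      by (intro mult_left_mono add_mono divide_right_mono) auto
    also have "\<dots> = C * s * sqrt x * (1 - g / (8 * x\<^sup>2))"
      using x by (simp add: divide_simps) (simp add: algebra_simps)
    also have "\<dots> \<le> C * s * sqrt x * (1 - 1 / (real L + 2))"
    proof (intro mult_left_mono)
      have "p / (8 * x\<^sup>2) \<le> g / (8 * x\<^sup>2)" using assms by (intro divide_right_mono) auto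
      then show "1 - g / (8 * x\<^sup>2) \<le> 1 - 1 / (real L + 2)" using pl by linarith
    qed (use assms s x in auto)
    also have "\<dots> = C * sqrt x * ((1 - 1 / (real L + 2)) * s)" by simp
    also have "\<dots> \<le> C * sqrt x * t"
      using tq assms x by (intro mult_left_mono) auto
    finally show ?thesis using False unfolding walk_bound_def x_def t_def by (simp add: add_ac)
  qed
qed

text \<open>Kleitman's argument for the Littlewood-Offord problem in a Euclidean space, for sums of independent symmetric
vectors (the block sums) of which each is long with probability at least \<open>p\<close>. A long block sum moves
the number of classes up or down by one, a short one leaves it unchanged.\<close>

lemma block_concentration:
  fixes B :: "nat \<Rightarrow> 'a set" and v :: "'a \<Rightarrow> 'i \<Rightarrow> real"
  assumes "finite I" "r > 0" "p > 0" "C \<ge> 1" "8 \<le> C ^ 4 * p"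
    and "\<And>l. l < L \<Longrightarrow> finite (B l)"
    and "\<And>l l'. l < L \<Longrightarrow> l' < L \<Longrightarrow> l \<noteq> l' \<Longrightarrow> B l \<inter> B l' = {}"
    and "\<And>l. l < L \<Longrightarrow> p \<le> pr (B l) (\<lambda>\<xi>. r\<^sup>2 \<le> sqn I (wsum (B l) v \<xi>))"
    and "finite A" "covers I r k A"
  shows "pr (\<Union>l<L. B l) (\<lambda>\<xi>. wsum (\<Union>l<L. B l) v \<xi> \<in> A) \<le> walk_bound C L k"
  using assms(6-)
proof (induction L arbitrary: k A)
  case 0
  show ?case
  proof (cases k)
    case 0
    then have "A = {}" using covers_0[of I r A] \<open>covers I r k A\<close> by simp
    then show ?thesis using \<open>k = 0\<close> by (simp add: avg_empty walk_bound_def)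
  next
    case (Suc k')
    have "1 * 1 \<le> C * sqrt (real k)" using assms(4) Suc by (intro mult_mono) auto
    then show ?thesis by (simp add: avg_empty walk_bound_def of_bool_def)
  qed
next
  case (Suc L)
  define V where "V = (\<Union>l<L. B l)"
  define X where "X \<alpha> = wsum (B L) v \<alpha>" for \<alpha>
  define G where "G S = pr V (\<lambda>\<beta>. wsum V v \<beta> \<in> S)" for S
  define g where "g = pr (B L) (\<lambda>\<xi>. r\<^sup>2 \<le> sqn I (X \<xi>))"
  have "B L \<inter> B l = {}" if "l < L" for l using Suc.prems(2)[of L l] that by simp
  then have "B L \<inter> V = {}" unfolding V_def by blast
  then have V: "finite V" "finite (B L)" "B L \<inter> V = {}" "(\<Union>l<Suc L. B l) = B L \<union> V"
    using Suc.prems(1) unfolding V_def by (auto simp: lessThan_Suc)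
  have g: "p \<le> g" "g \<le> 1" using Suc.prems(3)[of L] pr_le_1[OF V(2)] unfolding g_def X_def by auto
  have IH: "G S \<le> walk_bound C L k" if "finite S" "covers I r k S" for S k
    unfolding G_def V_def by (rule Suc.IH) (use Suc.prems that in auto)
  have Gmono: "S \<subseteq> S' \<Longrightarrow> G S \<le> G S'" for S S'
    unfolding G_def by (intro pr_mono) auto
  have Gadd: "G S + G S' = G (S \<union> S')" if "S \<inter> S' = {}" for S S'
    unfolding G_def avg_add[symmetric] by (intro avg_cong) (use that in auto)
  have Gsub: "G (S \<union> S') \<le> G S + G S'" for S S'
    unfolding G_def avg_add[symmetric] by (intro avg_mono) auto
  define P where "P a = (\<lambda>d i. d i + a i) ` A" for a
  have w: "wsum (B L \<union> V) v (merge_on (B L) \<alpha> \<beta>) = (\<lambda>i. X \<alpha> i + wsum V v \<beta> i)" for \<alpha> \<beta>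
  proof
    fix i
    have "(\<Sum>x\<in>V. merge_on (B L) \<alpha> \<beta> x * v x i) = (\<Sum>x\<in>V. \<beta> x * v x i)"
    proof (intro sum.cong refl)
      fix x assume "x \<in> V"
      then have "x \<notin> B L" using V(3) by blast
      then show "merge_on (B L) \<alpha> \<beta> x * v x i = \<beta> x * v x i" by simp
    qed
    then show "wsum (B L \<union> V) v (merge_on (B L) \<alpha> \<beta>) i = X \<alpha> i + wsum V v \<beta> i"
      unfolding wsum_def X_def using V by (subst sum.union_disjoint) auto
  qed
  have mem: "(\<lambda>i. a i + w i) \<in> A \<longleftrightarrow> w \<in> P (\<lambda>i. - a i)" for a w
  proof
    assume "(\<lambda>i. a i + w i) \<in> A"
    then show "w \<in> P (\<lambda>i. - a i)" unfolding P_def by (intro image_eqI[of _ _ "\<lambda>i. a i + w i"]) auto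
  qed (auto simp: P_def)
  have finP: "finite (P a)" and covP: "covers I r k (P a)" for a
    unfolding P_def using Suc.prems by (auto intro: covers_translate)
  have neg: "X (\<lambda>x. - \<alpha> x) = (\<lambda>i. - X \<alpha> i)" for \<alpha>
    unfolding X_def wsum_def by (simp add: sum_negf)
  have "pr (\<Union>l<Suc L. B l) (\<lambda>\<xi>. wsum (\<Union>l<Suc L. B l) v \<xi> \<in> A)
      = avg (B L) (\<lambda>\<alpha>. G (P (\<lambda>i. - X \<alpha> i)))"
    unfolding V(4) avg_Un[OF V(2,1,3)] w mem G_def ..
  also have "\<dots> = avg (B L) (\<lambda>\<alpha>. (G (P (\<lambda>i. - X \<alpha> i)) + G (P (X \<alpha>))) / 2)"
  proof -
    have "avg (B L) (\<lambda>\<alpha>. G (P (\<lambda>i. - X \<alpha> i))) = avg (B L) (\<lambda>\<alpha>. G (P (X \<alpha>)))"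
      by (subst avg_uminus) (simp add: neg)
    then show ?thesis by (simp add: avg_divide avg_add)
  qed
  finally have eq: "pr (\<Union>l<Suc L. B l) (\<lambda>\<xi>. wsum (\<Union>l<Suc L. B l) v \<xi> \<in> A) = \<dots>" .
  show ?case
  proof (cases k)
    case 0
    then have "A = {}" using \<open>covers I r k A\<close> covers_0[of I r A] by simp
    then show ?thesis using \<open>k = 0\<close> by (simp add: walk_bound_def avg_def)
  next
    case (Suc k')
    let ?u = "walk_bound C L k" 
    let ?w = "(walk_bound C L (Suc (Suc k')) + walk_bound C L k') / 2"
    have good: "G (P (\<lambda>i. - a i)) + G (P a) \<le> walk_bound C L (Suc (Suc k')) + walk_bound C L k'"
      if a: "r\<^sup>2 \<le> sqn I a" for a
    proof -
      obtain D where D: "D \<subseteq> A" "covers I r 1 D" "covers I r k' (A - D)"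
        "\<And>d d'. d \<in> D \<Longrightarrow> d' \<in> A \<Longrightarrow> (\<lambda>i. d i + a i) \<noteq> (\<lambda>i. d' i - a i)"
        using covers_split[OF assms(1) \<open>finite A\<close> _ a assms(2), of k'] \<open>covers I r k A\<close>[unfolded Suc]
        by blast
      let ?t = "\<lambda>d i. d i + a i"
      have fD: "finite D" by (rule finite_subset[OF D(1) \<open>finite A\<close>])
      have "(A - D) \<union> D = A" using D(1) by blast
      then have "P a = ?t ` (A - D) \<union> ?t ` D" unfolding P_def by (simp only: image_Un[symmetric])
      then have "G (P a) \<le> G (?t ` (A - D)) + G (?t ` D)" by (simp only: Gsub)
      moreover have "G (?t ` (A - D)) \<le> walk_bound C L k'"
        by (intro IH covers_translate D(3) finite_imageI finite_Diff \<open>finite A\<close>)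
      moreover have "P (\<lambda>i. - a i) \<inter> ?t ` D = {}"
      proof -
        have "(\<lambda>i. d' i + - a i) \<noteq> (\<lambda>i. d i + a i)" if "d \<in> D" "d' \<in> A" for d d'
          using D(4)[OF that] by (simp add: eq_commute)
        then show ?thesis unfolding P_def by blast
      qed
      then have "G (P (\<lambda>i. - a i)) + G (?t ` D) = G (P (\<lambda>i. - a i) \<union> ?t ` D)"
        by (rule Gadd)
      moreover have "G (P (\<lambda>i. - a i) \<union> ?t ` D) \<le> walk_bound C L (k + 1)"
        by (intro IH covers_Un covers_translate finite_UnI finP covP D(2) fD finite_imageI)
      ultimately show ?thesis using Suc by simp
    qed
    have "avg (B L) (\<lambda>\<alpha>. (G (P (\<lambda>i. - X \<alpha> i)) + G (P (X \<alpha>))) / 2)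
        \<le> avg (B L) (\<lambda>\<alpha>. ?u + of_bool (r\<^sup>2 \<le> sqn I (X \<alpha>)) * (?w - ?u))"
    proof (intro avg_mono)
      fix \<alpha>
      show "(G (P (\<lambda>i. - X \<alpha> i)) + G (P (X \<alpha>))) / 2 \<le> ?u + of_bool (r\<^sup>2 \<le> sqn I (X \<alpha>)) * (?w - ?u)"
        using good[of "X \<alpha>"] IH[OF finP covP, of "X \<alpha>"] IH[OF finP covP, of "\<lambda>i. - X \<alpha> i"]
        by (auto simp: of_bool_def)
    qed
    also have "\<dots> = ?u + g * (?w - ?u)"
      using V by (simp add: avg_add avg_const avg_cmult_right g_def)
    also have "\<dots> = (1 - g) * ?u + g * ?w" by (simp add: algebra_simps)
    also have "\<dots> \<le> walk_bound C (Suc L) k"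
      unfolding Suc using walk_bound_step[OF assms(3) g _ assms(5)] assms(4) by simp
    finally show ?thesis using eq by simp
  qed
qed

lemma small_ball:
  fixes B :: "nat \<Rightarrow> 'a set" and v :: "'a \<Rightarrow> 'i \<Rightarrow> real"
  assumes "finite I" "finite V" "r > 0" "p > 0" "C \<ge> 1" "8 \<le> C ^ 4 * p"
    and sub: "\<And>l. l < L \<Longrightarrow> B l \<subseteq> V"
    and disj: "\<And>l l'. l < L \<Longrightarrow> l' < L \<Longrightarrow> l \<noteq> l' \<Longrightarrow> B l \<inter> B l' = {}"
    and good: "\<And>l. l < L \<Longrightarrow> p \<le> pr (B l) (\<lambda>\<xi>. r\<^sup>2 \<le> sqn I (wsum (B l) v \<xi>))"
  shows "pr V (\<lambda>\<xi>. sqn I (wsum V v \<xi>) < r\<^sup>2) \<le> C * (real L + 1) powr (-1/4)"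
proof -
  define W where "W = (\<Union>l<L. B l)"
  have W: "W \<subseteq> V" "finite W" "finite (V - W)" "V - (V - W) = W"
    unfolding W_def using sub assms(2) finite_subset by blast+
  have w: "wsum V v (merge_on (V - W) \<alpha> \<beta>) = (\<lambda>i. wsum W v \<beta> i + wsum (V - W) v \<alpha> i)" for \<alpha> \<beta>
  proof
    fix i
    have "wsum V v (merge_on (V - W) \<alpha> \<beta>) i = (\<Sum>x\<in>V - W. merge_on (V - W) \<alpha> \<beta> x * v x i)
        + (\<Sum>x\<in>W. merge_on (V - W) \<alpha> \<beta> x * v x i)"
      unfolding wsum_def by (rule sum.subset_diff[OF W(1) assms(2)])
    also have "\<dots> = wsum W v \<beta> i + wsum (V - W) v \<alpha> i"
      unfolding wsum_def by simp
    finally show "wsum V v (merge_on (V - W) \<alpha> \<beta>) i = wsum W v \<beta> i + wsum (V - W) v \<alpha> i" .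
  qed
  have bd: "pr W (\<lambda>\<beta>. sqn I (\<lambda>i. wsum W v \<beta> i + c i) < r\<^sup>2) \<le> C * (real L + 1) powr (-1/4)" for c
  proof -
    define A where "A = {d \<in> wsum W v ` signs W. sqn I (\<lambda>i. d i + c i) < r\<^sup>2}"
    have "covers I r 1 A" unfolding covers_def
    proof (intro exI[of _ "{A}"] conjI ballI)
      fix D d d' assume "D \<in> {A}" "d \<in> D" "d' \<in> D"
      then have d: "sqn I (\<lambda>i. d i + c i) < r\<^sup>2" "sqn I (\<lambda>i. d' i + c i) < r\<^sup>2" unfolding A_def by auto
      have "sqn I (\<lambda>i. d i - d' i) \<le> (\<Sum>i\<in>I. 2 * (d i + c i)\<^sup>2 + 2 * (d' i + c i)\<^sup>2)"
        unfolding sqn_def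
      proof (intro sum_mono)
        fix i show "(d i - d' i)\<^sup>2 \<le> 2 * (d i + c i)\<^sup>2 + 2 * (d' i + c i)\<^sup>2"
          using zero_le_power2[of "(d i + c i) + (d' i + c i)"] by (simp add: power2_eq_square algebra_simps)
      qed
      also have "\<dots> = 2 * sqn I (\<lambda>i. d i + c i) + 2 * sqn I (\<lambda>i. d' i + c i)"
        unfolding sqn_def by (simp add: sum.distrib sum_distrib_left)
      finally show "sqn I (\<lambda>i. d i - d' i) < 4 * r\<^sup>2" using d by linarith
    qed auto
    moreover have "finite A" unfolding A_def using finite_signs[OF W(2)] by simp
    ultimately have "pr W (\<lambda>\<beta>. wsum W v \<beta> \<in> A) \<le> walk_bound C L 1"
      unfolding W_def using assms finite_subset
      by (intro block_concentration) (auto intro: finite_subset)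
    also have "\<dots> \<le> C * (real L + 1) powr (-1/4)" unfolding walk_bound_def by simp
    finally show ?thesis
      by (rule order_trans[rotated]) (auto simp: A_def intro!: pr_mono)
  qed
  have "pr V (\<lambda>\<xi>. sqn I (wsum V v \<xi>) < r\<^sup>2) 
      = avg (V - W) (\<lambda>\<alpha>. pr W (\<lambda>\<beta>. sqn I (\<lambda>i. wsum W v \<beta> i + wsum (V - W) v \<alpha> i) < r\<^sup>2))"
    by (subst avg_split[OF assms(2), of "V - W"]) (auto simp: W w)
  also have "\<dots> \<le> C * (real L + 1) powr (-1/4)"
    by (rule avg_le_const[OF W(3) bd])
  finally show ?thesis .
qed

text \<open>Each block is a single index with a large coefficient, so that \<open>p = 1\<close>.\<close>

lemma littlewood_offord:
  assumes "finite V" "\<theta> > 0" "h \<le> card {x \<in> V. \<theta> \<le> \<bar>a x\<bar>}"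
  shows "pr V (\<lambda>\<xi>. \<bar>\<Sum>x\<in>V. \<xi> x * a x\<bar> < \<theta>) \<le> 2 * (real h + 1) powr (-1/4)"
proof -
  let ?E = "{x \<in> V. \<theta> \<le> \<bar>a x\<bar>}"
  have fE: "finite ?E" using assms by simp
  obtain e where e: "bij_betw e {0..<card ?E} ?E" using ex_bij_betw_nat_finite[OF fE] by auto
  have eE: "e l \<in> ?E" if "l < h" for l using e that assms(3) unfolding bij_betw_def by auto
  have ei: "e l \<noteq> e l'" if "l < h" "l' < h" "l \<noteq> l'" for l l'
    using e that assms(3) unfolding bij_betw_def inj_on_def by auto
  have 1: "(\<bar>y\<bar> < \<theta>) = (sqn {()} (\<lambda>_. y) < \<theta>\<^sup>2)" for y
    using assms(2) abs_le_square_iff[of \<theta> y] unfolding sqn_def by auto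
  have "pr V (\<lambda>\<xi>. sqn {()} (wsum V (\<lambda>x _. a x) \<xi>) < \<theta>\<^sup>2) \<le> 2 * (real h + 1) powr (-1/4)"
  proof (rule small_ball[where p = 1 and B = "\<lambda>l. {e l}"])
    fix l assume l: "l < h"
    have "pr {e l} (\<lambda>\<xi>. \<theta>\<^sup>2 \<le> sqn {()} (wsum {e l} (\<lambda>x _. a x) \<xi>)) = pr {e l} (\<lambda>\<xi>. True)"
    proof (rule avg_cong)
      fix \<xi> assume "\<xi> \<in> signs {e l}"
      then have "\<xi> (e l) * \<xi> (e l) = 1" by (rule signs_sq) simp
      then have "(\<xi> (e l) * a (e l))\<^sup>2 = (a (e l))\<^sup>2" by (simp add: power_mult_distrib power2_eq_square)
      moreover have "\<theta>\<^sup>2 \<le> (a (e l))\<^sup>2" using eE[OF l] assms(2) by (simp add: abs_le_square_iff[symmetric])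
      ultimately show "of_bool (\<theta>\<^sup>2 \<le> sqn {()} (wsum {e l} (\<lambda>x _. a x) \<xi>)) = (of_bool True :: real)"
        by (simp add: sqn_def wsum_def)
    qed
    then show "1 \<le> pr {e l} (\<lambda>\<xi>. \<theta>\<^sup>2 \<le> sqn {()} (wsum {e l} (\<lambda>x _. a x) \<xi>))" by (simp add: avg_const)
  qed (use assms eE ei in auto)
  then show ?thesis unfolding 1 wsum_def .
qed

section \<open>Revealing the rows one at a time\<close>

text \<open>With \<open>m\<close> rows left, the states that matter are the values on the \<open>m\<close>-subsets of the set \<open>U\<close> of columns.\<close>

definition lev :: "'a set \<Rightarrow> nat \<Rightarrow> 'a set set" where
  "lev U m = {T. T \<subseteq> U \<and> card T = m}"

definition step :: "'a set \<Rightarrow> ('a \<Rightarrow> real) \<Rightarrow> ('a set \<Rightarrow> real) \<Rightarrow> 'a set \<Rightarrow> real" where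
  "step U \<xi> f T = (\<Sum>x\<in>U - T. \<xi> x * f (insert x T))"

text \<open>The probability that, from the state \<open>f\<close> with \<open>m\<close> rows left, the last state is below \<open>\<theta>\<close> in absolute value.\<close>

primrec light :: "'a set \<Rightarrow> real \<Rightarrow> nat \<Rightarrow> ('a set \<Rightarrow> real) \<Rightarrow> real" where
  "light U \<theta> 0 f = of_bool (\<bar>f {}\<bar> < \<theta>)"
| "light U \<theta> (Suc m) f = avg U (\<lambda>\<xi>. light U \<theta> m (step U \<xi> f))"

lemma light_le_1: "finite U \<Longrightarrow> light U \<theta> m f \<le> 1"
  by (induction m arbitrary: f) (auto intro: avg_le_const)

lemma finite_lev: "finite U \<Longrightarrow> finite (lev U m)"
  unfolding lev_def by simp

lemma lev_memb: "finite U \<Longrightarrow> T \<in> lev U m \<Longrightarrow> finite T \<and> T \<subseteq> U \<and> card T = m"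
  unfolding lev_def using finite_subset by auto

text \<open>Both sides sum over the pairs of a set and a set with one element more.\<close>

lemma sum_lev_pairs:
  assumes "finite U"
  shows "(\<Sum>T\<in>lev U (Suc m). \<Sum>i\<in>T. g T i) = (\<Sum>T'\<in>lev U m. \<Sum>x\<in>U - T'. g (insert x T') x)"
proof -
  have "(\<Sum>T\<in>lev U (Suc m). \<Sum>i\<in>T. g T i) = (\<Sum>(T, i)\<in>Sigma (lev U (Suc m)) (\<lambda>T. T). g T i)"
    using assms by (intro sum.Sigma) (auto simp: finite_lev dest: lev_memb)
  also have "\<dots> = (\<Sum>(T', x)\<in>Sigma (lev U m) (\<lambda>T'. U - T'). g (insert x T') x)"
  proof (rule sum.reindex_bij_witness[where i = "\<lambda>(T', x). (insert x T', x)" and j = "\<lambda>(T, i). (T - {i}, i)"])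
    fix a assume "a \<in> Sigma (lev U (Suc m)) (\<lambda>T. T)"
    then obtain T i where a: "a = (T, i)" "T \<in> lev U (Suc m)" "i \<in> T" by auto
    then have T: "finite T" "T \<subseteq> U" "card T = Suc m" using lev_memb[OF assms] by blast+
    then show "(case case a of (T, i) \<Rightarrow> (T - {i}, i) of (T', x) \<Rightarrow> (insert x T', x)) = a"
      "(case a of (T, i) \<Rightarrow> (T - {i}, i)) \<in> Sigma (lev U m) (\<lambda>T'. U - T')"
      "(case case a of (T, i) \<Rightarrow> (T - {i}, i) of (T', x) \<Rightarrow> g (insert x T') x) = (case a of (T, i) \<Rightarrow> g T i)"
      using a by (auto simp: lev_def insert_absorb)
  next
    fix b assume "b \<in> Sigma (lev U m) (\<lambda>T'. U - T')"
    then obtain T x where b: "b = (T, x)" "T \<in> lev U m" "x \<in> U" "x \<notin> T" by auto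
    then have T: "finite T" "T \<subseteq> U" "card T = m" using lev_memb[OF assms] by blast+
    then show "(case case b of (T', x) \<Rightarrow> (insert x T', x) of (T, i) \<Rightarrow> (T - {i}, i)) = b"
      "(case b of (T', x) \<Rightarrow> (insert x T', x)) \<in> Sigma (lev U (Suc m)) (\<lambda>T. T)"
      using b by (auto simp: lev_def)
  qed
  also have "\<dots> = (\<Sum>T'\<in>lev U m. \<Sum>x\<in>U - T'. g (insert x T') x)"
    using assms by (intro sum.Sigma[symmetric]) (auto simp: finite_lev)
  finally show ?thesis .
qed

text \<open>Once the signs outside \<open>T\<close> are fixed, the value at \<open>T - {i}\<close> is \<open>\<xi> i * f T + c\<close> where \<open>c\<close> is constant, since
\<open>T - {i}\<close> is contracted with columns from the complement of \<open>T\<close> and with \<open>i\<close> only. So the events for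
different \<open>i\<close> are independent, and each has probability at least \<open>1/2\<close> because \<open>f T + c\<close> and \<open>- f T + c\<close>
cannot both be shorter than \<open>f T\<close>.\<close>

lemma good_bits:
  assumes "finite U" "T \<subseteq> U" "\<And>i. i \<in> T \<Longrightarrow> 0 \<le> t i"
  shows "avg U (\<lambda>\<xi>. exp (- (\<Sum>i\<in>T. t i * of_bool (\<bar>f T\<bar> \<le> \<bar>step U \<xi> f (T - {i})\<bar>))))
    \<le> (\<Prod>i\<in>T. (1 + exp (- t i)) / 2)"
proof -
  have fT: "finite T" using assms finite_subset by blast
  have UT: "U - (U - T) = T" using assms by auto
  have st: "step U (merge_on (U - T) \<alpha> \<beta>) f (T - {i})
      = \<beta> i * f T + (\<Sum>x\<in>U - T. \<alpha> x * f (insert x (T - {i})))" if "i \<in> T" for \<alpha> \<beta> i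
  proof -
    have "U - (T - {i}) = insert i (U - T)" using assms that by auto
    then have "step U (merge_on (U - T) \<alpha> \<beta>) f (T - {i}) = merge_on (U - T) \<alpha> \<beta> i * f (insert i (T - {i})) +
        (\<Sum>x\<in>U - T. merge_on (U - T) \<alpha> \<beta> x * f (insert x (T - {i})))"
      unfolding step_def using assms that by simp
    also have "insert i (T - {i}) = T" using that by auto
    finally show ?thesis using that by simp
  qed
  show ?thesis
    unfolding avg_split[OF assms(1), of "U - T", simplified] UT
  proof (rule avg_le_const)
    fix \<alpha>
    define c where "c i = (\<Sum>x\<in>U - T. \<alpha> x * f (insert x (T - {i})))" for i
    define h where "h i s = exp (- (t i * of_bool (\<bar>f T\<bar> \<le> \<bar>s * f T + c i\<bar>)))" for i s
    have "avg T (\<lambda>\<beta>. exp (- (\<Sum>i\<in>T. t i * of_bool (\<bar>f T\<bar> \<le> \<bar>step U (merge_on (U - T) \<alpha> \<beta>) f (T - {i})\<bar>))))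
      = avg T (\<lambda>\<beta>. \<Prod>i\<in>T. h i (\<beta> i))"
      unfolding h_def c_def
      by (intro avg_cong, simp only: sum_negf[symmetric] exp_sum[OF fT], intro prod.cong refl)
        (simp only: st)
    also have "\<dots> = (\<Prod>i\<in>T. (h i 1 + h i (-1)) / 2)" by (rule avg_prod[OF fT])
    also have "\<dots> \<le> (\<Prod>i\<in>T. (1 + exp (- t i)) / 2)"
    proof (intro prod_mono conjI divide_right_mono)
      fix i assume i: "i \<in> T"
      have le: "h i s \<le> 1" for s unfolding h_def using assms(3)[OF i] by simp
      have eq: "h i s = exp (- t i)" if "\<bar>f T\<bar> \<le> \<bar>s * f T + c i\<bar>" for s
        unfolding h_def using that by simp
      have "\<bar>f T\<bar> \<le> \<bar>1 * f T + c i\<bar> \<or> \<bar>f T\<bar> \<le> \<bar>(-1) * f T + c i\<bar>" by linarith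
      then show "h i 1 + h i (-1) \<le> 1 + exp (- t i)"
        using eq[of 1] eq[of "-1"] le[of 1] le[of "-1"] by linarith
      show "0 \<le> (h i 1 + h i (-1)) / 2" unfolding h_def by (simp add: add_nonneg_nonneg)
    qed auto
    finally show "avg T (\<lambda>\<beta>. exp (- (\<Sum>i\<in>T. t i * of_bool (\<bar>f T\<bar> \<le> \<bar>step U (merge_on (U - T) \<alpha> \<beta>) f (T - {i})\<bar>))))
      \<le> (\<Prod>i\<in>T. (1 + exp (- t i)) / 2)" .
  qed (use assms in auto)
qed

section \<open>Growth of the sum of squares\<close>

definition ssq :: "'a set \<Rightarrow> nat \<Rightarrow> ('a set \<Rightarrow> real) \<Rightarrow> real" where
  "ssq U m f = (\<Sum>T\<in>lev U m. (f T)\<^sup>2)"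

lemma ssq_nonneg: "0 \<le> ssq U m f"
  unfolding ssq_def by (intro sum_nonneg) auto

text \<open>Chernoff's bound: with the exponential weight \<open>4\<close> the base is \<open>5/8 * 4 powr (1/4) < 9/10\<close>.\<close>

lemma few_good_unlikely:
  assumes "finite U" "T \<in> lev U m"
  shows "pr U (\<lambda>\<xi>. real (card {i \<in> T. \<bar>f T\<bar> \<le> \<bar>step U \<xi> f (T - {i})\<bar>}) < real m / 4) \<le> (9/10) ^ m"
proof -
  let ?c = "\<lambda>\<xi>. \<Sum>i\<in>T. ln 4 * of_bool (\<bar>f T\<bar> \<le> \<bar>step U \<xi> f (T - {i})\<bar>)"
  have T: "finite T" "T \<subseteq> U" "card T = m" using lev_memb[OF assms] by auto
  have c: "?c \<xi> = ln 4 * real (card {i \<in> T. \<bar>f T\<bar> \<le> \<bar>step U \<xi> f (T - {i})\<bar>})" for \<xi>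
    using T by (simp add: sum_distrib_left[symmetric] Int_def)
  have "pr U (\<lambda>\<xi>. real (card {i \<in> T. \<bar>f T\<bar> \<le> \<bar>step U \<xi> f (T - {i})\<bar>}) < real m / 4)
     \<le> pr U (\<lambda>\<xi>. exp (- ?c \<xi>) \<ge> exp (- (ln 4 * real m / 4)))"
    unfolding c by (intro pr_mono) auto
  also have "\<dots> \<le> avg U (\<lambda>\<xi>. exp (- ?c \<xi>)) / exp (- (ln 4 * real m / 4))"
    by (intro pr_markov) auto
  also have "\<dots> \<le> (\<Prod>i\<in>T. (1 + exp (- ln 4)) / 2) / exp (- (ln 4 * real m / 4))"
    using assms T by (intro divide_right_mono good_bits) auto
  also have "\<dots> = (5/8) ^ m * exp (ln 4 / 4) ^ m"
    using T by (simp add: exp_minus field_simps exp_of_nat_mult[symmetric])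
  also have "\<dots> = (5/8 * exp (ln 4 / 4)) ^ m" by (simp only: power_mult_distrib)
  also have "\<dots> \<le> (9/10) ^ m"
  proof (intro power_mono)
    have "exp (ln 4 / 4) ^ 4 = (4::real)"
      by (simp add: exp_of_nat_mult[symmetric])
    also have "\<dots> \<le> (36/25) ^ 4" by (simp add: power4_eq_xxxx)
    finally have "exp (ln 4 / 4) \<le> (36/25::real)"
      by (subst (asm) power_mono_iff) auto
    then show "5/8 * exp (ln 4 / 4) \<le> (9/10::real)" by simp
  qed auto
  finally show ?thesis .
qed

text \<open>By Markov's inequality most of the mass \<open>(f T)\<^sup>2\<close> sits on sets \<open>T\<close> with at least a quarter of the indices
good. Each set of size \<open>m\<close> is of the form \<open>T - {i}\<close> for at most \<open>card U\<close> pairs, which is the source of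
the factor \<open>card U\<close>.\<close>

lemma ssq_drop:
  assumes "finite U"
  shows "pr U (\<lambda>\<xi>. ssq U m (step U \<xi> f) * (8 * real (card U)) < real (Suc m) * ssq U (Suc m) f)
    \<le> 2 * (9/10) ^ Suc m"
proof -
  define S where "S = ssq U (Suc m) f"
  define n where "n \<xi> T = real (card {i \<in> T. \<bar>f T\<bar> \<le> \<bar>step U \<xi> f (T - {i})\<bar>})" for \<xi> T
  define X where "X \<xi> = (\<Sum>T\<in>lev U (Suc m). (f T)\<^sup>2 * of_bool (n \<xi> T < real (Suc m) / 4))" for \<xi>
  have S: "S \<ge> 0" unfolding S_def by (rule ssq_nonneg)
  have "avg U X \<le> (9/10) ^ Suc m * S"
  proof -
    have "avg U X = (\<Sum>T\<in>lev U (Suc m). (f T)\<^sup>2 * pr U (\<lambda>\<xi>. n \<xi> T < real (Suc m) / 4))"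
      unfolding X_def by (simp add: avg_sum avg_cmult)
    also have "\<dots> \<le> (\<Sum>T\<in>lev U (Suc m). (f T)\<^sup>2 * (9/10) ^ Suc m)"
      unfolding n_def by (intro sum_mono mult_left_mono few_good_unlikely) (use assms in auto)
    also have "\<dots> = (9/10) ^ Suc m * S"
      unfolding S_def ssq_def by (simp only: sum_distrib_right[symmetric] mult.commute)
    finally show ?thesis .
  qed
  have key: "S / 2 \<le> X \<xi>" if "ssq U m (step U \<xi> f) * (8 * real (card U)) < real (Suc m) * S" for \<xi>
  proof -
    have "(\<Sum>T\<in>lev U (Suc m). (f T)\<^sup>2 * n \<xi> T) \<le> (\<Sum>T\<in>lev U (Suc m). \<Sum>i\<in>T. (step U \<xi> f (T - {i}))\<^sup>2)"
    proof (intro sum_mono)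
      fix T assume "T \<in> lev U (Suc m)"
      then have fT: "finite T" using lev_memb assms by blast
      have "(f T)\<^sup>2 * n \<xi> T = (\<Sum>i\<in>T. (f T)\<^sup>2 * of_bool (\<bar>f T\<bar> \<le> \<bar>step U \<xi> f (T - {i})\<bar>))"
        unfolding n_def using fT by (simp add: sum_distrib_left[symmetric] Int_def)
      also have "\<dots> \<le> (\<Sum>i\<in>T. (step U \<xi> f (T - {i}))\<^sup>2)"
        by (intro sum_mono) (auto simp: of_bool_def abs_le_square_iff)
      finally show "(f T)\<^sup>2 * n \<xi> T \<le> (\<Sum>i\<in>T. (step U \<xi> f (T - {i}))\<^sup>2)" .
    qed
    also have "\<dots> = (\<Sum>T'\<in>lev U m. \<Sum>x\<in>U - T'. (step U \<xi> f (insert x T' - {x}))\<^sup>2)"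
      by (rule sum_lev_pairs[OF assms])
    also have "\<dots> = (\<Sum>T'\<in>lev U m. real (card (U - T')) * (step U \<xi> f T')\<^sup>2)"
      by (intro sum.cong) auto
    also have "\<dots> \<le> (\<Sum>T'\<in>lev U m. real (card U) * (step U \<xi> f T')\<^sup>2)"
      by (intro sum_mono mult_right_mono) (auto intro!: card_mono assms)
    also have "\<dots> = real (card U) * ssq U m (step U \<xi> f)"
      unfolding ssq_def by (simp add: sum_distrib_left)
    finally have "(\<Sum>T\<in>lev U (Suc m). (f T)\<^sup>2 * n \<xi> T) * 8 \<le> ssq U m (step U \<xi> f) * (8 * real (card U))"
      by (simp add: mult_ac)
    then have le: "(\<Sum>T\<in>lev U (Suc m). (f T)\<^sup>2 * n \<xi> T) * 8 < real (Suc m) * S"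
      using that by (rule le_less_trans)
    have "real (Suc m) / 4 * (S - X \<xi>) = (\<Sum>T\<in>lev U (Suc m). (f T)\<^sup>2 * (real (Suc m) / 4 * of_bool (\<not> n \<xi> T < real (Suc m) / 4)))"
      unfolding S_def ssq_def X_def sum_subtractf[symmetric] sum_distrib_left
      by (intro sum.cong) auto
    also have "\<dots> \<le> (\<Sum>T\<in>lev U (Suc m). (f T)\<^sup>2 * n \<xi> T)"
      by (intro sum_mono mult_left_mono) (auto simp: of_bool_def n_def)
    finally have ge: "real (Suc m) / 4 * (S - X \<xi>) \<le> (\<Sum>T\<in>lev U (Suc m). (f T)\<^sup>2 * n \<xi> T)" .
    have gen: "S \<le> 2 * x" if "M / 4 * (S - x) \<le> A" "A * 8 < M * S" "M > 0" for M x A :: real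
    proof -
      have "M * (2 * (S - x)) = 8 * (M / 4 * (S - x))" by simp
      then have "M * (2 * (S - x)) < M * S" using that(1,2) by linarith
      then have "2 * (S - x) < S" using that(3) by (simp only: mult_less_cancel_left_pos)
      then show ?thesis by simp
    qed
    from gen[OF ge le] show ?thesis by simp
  qed
  show ?thesis
  proof (cases "S = 0")
    case True
    have "pr U (\<lambda>\<xi>. ssq U m (step U \<xi> f) * (8 * real (card U)) < real (Suc m) * ssq U (Suc m) f) = avg U (\<lambda>_. 0)"
      using True by (intro avg_cong) (auto simp: S_def not_less ssq_nonneg)
    then show ?thesis by (simp add: avg_const assms)
  next
    case False
    have "pr U (\<lambda>\<xi>. ssq U m (step U \<xi> f) * (8 * real (card U)) < real (Suc m) * S) \<le> pr U (\<lambda>\<xi>. S / 2 \<le> X \<xi>)"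
      by (intro pr_mono key)
    also have "\<dots> \<le> avg U X / (S / 2)"
      using False S by (intro pr_markov) (auto simp: X_def intro!: sum_nonneg)
    also have "\<dots> \<le> (9/10) ^ Suc m * S / (S / 2)"
      using \<open>avg U X \<le> _\<close> S by (intro divide_right_mono) auto
    also have "\<dots> = 2 * (9/10) ^ Suc m" using False by simp
    finally show ?thesis unfolding S_def .
  qed
qed

lemma wsum_insert:
  assumes "finite V" "x \<notin> V"
  shows "wsum (insert x V) v (\<xi>(x := s)) = (\<lambda>i. s * v x i + wsum V v \<xi> i)"
proof
  fix i
  have "(\<Sum>y\<in>V. (\<xi>(x := s)) y * v y i) = (\<Sum>y\<in>V. \<xi> y * v y i)"
    using assms by (intro sum.cong) auto
  then show "wsum (insert x V) v (\<xi>(x := s)) i = s * v x i + wsum V v \<xi> i"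
    using assms unfolding wsum_def by simp
qed

text \<open>The constant \<open>3\<close> is the one for the fourth moment of a Gaussian variable; it is preserved when a vector is
added, by the inequality of Cauchy and Schwarz.\<close>

lemma sqn_wsum_moments:
  fixes v :: "'a \<Rightarrow> 'i \<Rightarrow> real"
  assumes "finite I" "finite V"
  shows "avg V (\<lambda>\<xi>. sqn I (wsum V v \<xi>)) = (\<Sum>x\<in>V. sqn I (v x))"
    and "avg V (\<lambda>\<xi>. (sqn I (wsum V v \<xi>))\<^sup>2) \<le> 3 * (\<Sum>x\<in>V. sqn I (v x))\<^sup>2"
proof -
  have "avg V (\<lambda>\<xi>. sqn I (wsum V v \<xi>)) = (\<Sum>x\<in>V. sqn I (v x)) \<and>
    avg V (\<lambda>\<xi>. (sqn I (wsum V v \<xi>))\<^sup>2) \<le> 3 * (\<Sum>x\<in>V. sqn I (v x))\<^sup>2"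
    using assms(2)
  proof (induction V rule: finite_induct)
    case empty
    then show ?case by (simp add: avg_empty wsum_def sqn_def)
  next
    case (insert x V)
    define q where "q \<xi> = sqn I (wsum V v \<xi>)" for \<xi>
    define d where "d \<xi> = (\<Sum>i\<in>I. wsum V v \<xi> i * v x i)" for \<xi>
    define w where "w = sqn I (v x)"
    define W where "W = (\<Sum>x\<in>V. sqn I (v x))"
    have w: "w \<ge> 0" unfolding w_def by (rule sqn_nonneg)
    have IH: "avg V q = W" "avg V (\<lambda>\<xi>. (q \<xi>)\<^sup>2) \<le> 3 * W\<^sup>2"
      using insert unfolding q_def W_def by auto
    have e: "sqn I (wsum (insert x V) v (\<xi>(x := s))) = q \<xi> + w + 2 * s * d \<xi>" if "s * s = 1" for \<xi> s
    proof -
      have "(s * v x i + wsum V v \<xi> i)\<^sup>2 = (wsum V v \<xi> i)\<^sup>2 + (v x i)\<^sup>2 + 2 * s * (wsum V v \<xi> i * v x i)" for i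
      proof -
        have "(s * v x i + wsum V v \<xi> i)\<^sup>2
            = (wsum V v \<xi> i)\<^sup>2 + (s * s) * (v x i)\<^sup>2 + 2 * s * (wsum V v \<xi> i * v x i)"
          by (simp add: power2_eq_square algebra_simps)
        then show ?thesis using that by simp
      qed
      then show ?thesis
        unfolding wsum_insert[OF insert(1,2)] sqn_def q_def w_def d_def
        by (simp add: sum.distrib sum_distrib_left)
    qed
    have cs: "(d \<xi>)\<^sup>2 \<le> q \<xi> * w" for \<xi>
      unfolding d_def q_def w_def sqn_def by (rule Cauchy_Schwarz_ineq_sum)
    have "avg (insert x V) (\<lambda>\<xi>. sqn I (wsum (insert x V) v \<xi>)) = avg V (\<lambda>\<xi>. q \<xi> + w)"
      unfolding avg_insert[OF insert(1,2)] by (intro avg_cong) (simp add: e)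
    also have "\<dots> = W + w" using insert IH by (simp add: avg_add avg_const)
    finally have 1: "avg (insert x V) (\<lambda>\<xi>. sqn I (wsum (insert x V) v \<xi>)) = W + w" .
    have "avg (insert x V) (\<lambda>\<xi>. (sqn I (wsum (insert x V) v \<xi>))\<^sup>2)
       = avg V (\<lambda>\<xi>. (q \<xi> + w)\<^sup>2 + 4 * (d \<xi>)\<^sup>2)"
      unfolding avg_insert[OF insert(1,2)]
      by (intro avg_cong) (simp add: e power2_eq_square algebra_simps)
    also have "\<dots> \<le> avg V (\<lambda>\<xi>. (q \<xi>)\<^sup>2 + (6 * w * q \<xi> + w\<^sup>2))"
    proof (intro avg_mono)
      fix \<xi> show "(q \<xi> + w)\<^sup>2 + 4 * (d \<xi>)\<^sup>2 \<le> (q \<xi>)\<^sup>2 + (6 * w * q \<xi> + w\<^sup>2)"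
        using cs[of \<xi>] by (simp add: power2_sum algebra_simps)
    qed
    also have "\<dots> = avg V (\<lambda>\<xi>. (q \<xi>)\<^sup>2) + 6 * w * W + w\<^sup>2"
      using insert IH(1) by (simp add: avg_add avg_cmult avg_const)
    also have "\<dots> \<le> 3 * W\<^sup>2 + 6 * w * W + 3 * w\<^sup>2" using IH(2) zero_le_power2[of w] by linarith
    also have "\<dots> = 3 * (W + w)\<^sup>2" by (simp add: power2_eq_square algebra_simps)
    finally show ?case using 1 insert unfolding W_def w_def by (simp add: add.commute)
  qed
  then show "avg V (\<lambda>\<xi>. sqn I (wsum V v \<xi>)) = (\<Sum>x\<in>V. sqn I (v x))"
    and "avg V (\<lambda>\<xi>. (sqn I (wsum V v \<xi>))\<^sup>2) \<le> 3 * (\<Sum>x\<in>V. sqn I (v x))\<^sup>2" by auto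
qed

lemma paley_zygmund:
  fixes v :: "'a \<Rightarrow> 'i \<Rightarrow> real"
  assumes "finite I" "finite V" "0 < t" "2 * t \<le> (\<Sum>x\<in>V. sqn I (v x))"
  shows "1 / 12 \<le> pr V (\<lambda>\<xi>. t \<le> sqn I (wsum V v \<xi>))"
proof -
  define W where "W = (\<Sum>x\<in>V. sqn I (v x))"
  define Z where "Z \<xi> = sqn I (wsum V v \<xi>)" for \<xi>
  have W: "W > 0" "2 * t \<le> W" using assms unfolding W_def by auto
  have pt: "Z \<xi> \<le> W / 2 + ((Z \<xi>)\<^sup>2 / (12 * W) + 3 * W * of_bool (t \<le> Z \<xi>))" for \<xi>
  proof (cases "t \<le> Z \<xi>")
    case True
    have "0 \<le> (Z \<xi> - 6 * W)\<^sup>2" by simp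
    then have "12 * W * Z \<xi> \<le> (Z \<xi>)\<^sup>2 + 36 * W\<^sup>2" by (simp add: power2_diff mult_ac)
    then have "Z \<xi> \<le> (Z \<xi>)\<^sup>2 / (12 * W) + 3 * W" using W by (simp add: field_simps power2_eq_square)
    then show ?thesis using True W by simp
  next
    case False
    then show ?thesis using W by (simp add: add_increasing2)
  qed
  have "W = avg V Z" unfolding W_def Z_def by (rule sqn_wsum_moments(1)[OF assms(1,2), symmetric])
  also have "\<dots> \<le> avg V (\<lambda>\<xi>. W / 2 + ((Z \<xi>)\<^sup>2 / (12 * W) + 3 * W * of_bool (t \<le> Z \<xi>)))"
    by (intro avg_mono pt)
  also have "\<dots> = W / 2 + (avg V (\<lambda>\<xi>. (Z \<xi>)\<^sup>2) / (12 * W) + 3 * W * pr V (\<lambda>\<xi>. t \<le> Z \<xi>))"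
    using assms by (simp only: avg_add avg_const avg_divide avg_cmult)
  also have "avg V (\<lambda>\<xi>. (Z \<xi>)\<^sup>2) / (12 * W) \<le> 3 * W\<^sup>2 / (12 * W)"
    unfolding W_def Z_def 
    by (intro divide_right_mono sqn_wsum_moments(2)[OF assms(1,2)]) (use W in \<open>simp add: W_def\<close>)
  also have "3 * W\<^sup>2 / (12 * W) = W / 4" using W by (simp add: power2_eq_square)
  finally have "W / 4 \<le> 3 * W * pr V (\<lambda>\<xi>. t \<le> Z \<xi>)" by simp
  then show ?thesis using W unfolding Z_def by (simp add: field_simps)
qed

lemma greedy_block:
  fixes w :: "'a \<Rightarrow> real"
  assumes "finite V" "\<And>x. x \<in> V \<Longrightarrow> 0 \<le> w x \<and> w x \<le> t" "0 \<le> t" "t \<le> sum w V"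
  shows "\<exists>B\<subseteq>V. t \<le> sum w B \<and> sum w B \<le> 2 * t"
  using assms
proof (induction V rule: finite_induct)
  case empty
  then show ?case by simp
next
  case (insert x V)
  show ?case
  proof (cases "t \<le> sum w V")
    case True
    then obtain B where "B \<subseteq> V" "t \<le> sum w B \<and> sum w B \<le> 2 * t"
      using insert.IH insert.prems by auto
    then show ?thesis by (intro exI[of _ B]) auto
  next
    case False
    then have "sum w (insert x V) \<le> 2 * t" using insert.hyps insert.prems(1)[of x] by simp
    then show ?thesis using insert.prems(3) by (intro exI[of _ "insert x V"]) simp
  qed
qed

text \<open>A minimal block of weight at least \<open>t\<close> overshoots by at most one vector, so it uses up at most \<open>2 * t\<close>.\<close>

lemma greedy_blocks:
  fixes w :: "'a \<Rightarrow> real"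
  assumes "finite V" "\<And>x. x \<in> V \<Longrightarrow> 0 \<le> w x \<and> w x \<le> t" "0 \<le> t" "2 * t * real L \<le> sum w V"
  shows "\<exists>B. (\<forall>l<L. B l \<subseteq> V \<and> t \<le> sum w (B l)) \<and> (\<forall>l<L. \<forall>l'<L. l \<noteq> l' \<longrightarrow> B l \<inter> B l' = {})"
  using assms
proof (induction L arbitrary: V)
  case 0
  then show ?case by simp
next
  case (Suc L)
  have "0 \<le> t * (real L * 2)" using Suc.prems by simp
  moreover have "t * 2 + t * (real L * 2) \<le> sum w V" using Suc.prems(4) by (simp add: algebra_simps)
  ultimately have "t \<le> sum w V" using Suc.prems(3) by linarith
  then have "\<exists>D\<subseteq>V. t \<le> sum w D \<and> sum w D \<le> 2 * t"
    by (intro greedy_block Suc.prems(1-3))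
  then obtain D where D: "D \<subseteq> V" "t \<le> sum w D" "sum w D \<le> 2 * t" by (elim exE conjE)
  have "sum w (V - D) = sum w V - sum w D" using Suc.prems D by (simp add: sum_diff)
  then have "2 * t * real L \<le> sum w (V - D)" using D Suc.prems by (simp add: algebra_simps)
  then have "\<exists>B. (\<forall>l<L. B l \<subseteq> V - D \<and> t \<le> sum w (B l)) \<and> (\<forall>l<L. \<forall>l'<L. l \<noteq> l' \<longrightarrow> B l \<inter> B l' = {})"
    by (intro Suc.IH) (use Suc.prems(1-3) in auto)
  then obtain B where "(\<forall>l<L. B l \<subseteq> V - D \<and> t \<le> sum w (B l)) \<and> (\<forall>l<L. \<forall>l'<L. l \<noteq> l' \<longrightarrow> B l \<inter> B l' = {})" ..
  then have B: "\<And>l. l < L \<Longrightarrow> B l \<subseteq> V - D \<and> t \<le> sum w (B l)"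
      "\<And>l l'. l < L \<Longrightarrow> l' < L \<Longrightarrow> l \<noteq> l' \<Longrightarrow> B l \<inter> B l' = {}" by simp_all
  show ?case
  proof (intro exI[of _ "B(L := D)"] conjI allI impI)
    fix l assume "l < Suc L"
    then show "(B(L := D)) l \<subseteq> V" "t \<le> sum w ((B(L := D)) l)" 
      using B(1)[of l] D by (auto simp: less_Suc_eq)
  next
    fix l l' assume l: "l < Suc L" "l' < Suc L" "l \<noteq> l'"
    show "(B(L := D)) l \<inter> (B(L := D)) l' = {}"
    proof (cases "l = L \<or> l' = L")
      case True
      then show ?thesis using l B(1)[of l] B(1)[of l'] by (auto simp: less_Suc_eq)
    next
      case False
      then show ?thesis using l B(2)[of l l'] by auto
    qed
  qed
qed

text \<open>As a vector indexed by the \<open>m\<close>-sets, the new state is the signed sum over \<open>x\<close> of the vectors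
\<open>T \<mapsto> f (insert x T)\<close>. Their squared lengths add up to \<open>Suc m\<close> times \<open>ssq U (Suc m) f\<close>, and each is at
most \<open>ssq U (Suc m) f\<close>. So they can be grouped into \<open>L\<close> blocks of comparable weight, each of which is
long with probability at least \<open>1/12\<close>.\<close>

lemma ssq_small_ball:
  fixes f :: "'a set \<Rightarrow> real"
  assumes U: "finite U" and S: "0 < ssq U (Suc m) f" and L: "1 \<le> L" "2 * L \<le> Suc m"
  shows "pr U (\<lambda>\<xi>. ssq U m (step U \<xi> f) < real (Suc m) * ssq U (Suc m) f / (4 * real L))
    \<le> 4 * (real L + 1) powr (-1/4)"
proof -
  define S where "S = ssq U (Suc m) f"
  define v where "v x T = (if x \<in> T then 0 else f (insert x T))" for x T
  define t where "t = real (Suc m) * S / (4 * real L)"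
  have S0: "S > 0" using S unfolding S_def .
  have t: "t > 0" unfolding t_def using S0 L by simp
  have fl: "finite (lev U m)" using finite_lev[OF U] .
  have ws: "sqn (lev U m) (wsum U v \<xi>) = ssq U m (step U \<xi> f)" for \<xi>
    unfolding sqn_def ssq_def
  proof (intro sum.cong refl arg_cong[where f = "\<lambda>x. x\<^sup>2"])
    fix T assume "T \<in> lev U m"
    then have T: "T \<subseteq> U" using lev_memb[OF U] by blast
    have "wsum U v \<xi> T = (\<Sum>x\<in>U - T. \<xi> x * v x T)"
      unfolding wsum_def using U by (intro sum.mono_neutral_right) (auto simp: v_def)
    also have "\<dots> = step U \<xi> f T" unfolding step_def by (intro sum.cong) (auto simp: v_def)
    finally show "wsum U v \<xi> T = step U \<xi> f T" .
  qed
  have tot: "(\<Sum>x\<in>U. sqn (lev U m) (v x)) = real (Suc m) * S"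
  proof -
    have "(\<Sum>x\<in>U. sqn (lev U m) (v x)) = (\<Sum>T\<in>lev U m. \<Sum>x\<in>U. (v x T)\<^sup>2)"
      unfolding sqn_def by (rule sum.swap)
    also have "\<dots> = (\<Sum>T\<in>lev U m. \<Sum>x\<in>U - T. (f (insert x T))\<^sup>2)"
    proof (rule sum.cong[OF refl])
      fix T
      have "(\<Sum>x\<in>U. (v x T)\<^sup>2) = (\<Sum>x\<in>U - T. (v x T)\<^sup>2)"
        by (rule sum.mono_neutral_right) (use U in \<open>auto simp: v_def\<close>)
      then show "(\<Sum>x\<in>U. (v x T)\<^sup>2) = (\<Sum>x\<in>U - T. (f (insert x T))\<^sup>2)" by (simp add: v_def)
    qed
    also have "\<dots> = (\<Sum>T\<in>lev U (Suc m). \<Sum>i\<in>T. (f T)\<^sup>2)"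
      by (rule sum_lev_pairs[OF U, symmetric])
    also have "\<dots> = (\<Sum>T\<in>lev U (Suc m). real (Suc m) * (f T)\<^sup>2)"
      by (intro sum.cong) (auto simp: lev_def)
    finally show ?thesis unfolding S_def ssq_def by (simp add: sum_distrib_left)
  qed
  have one: "sqn (lev U m) (v x) \<le> S" if x: "x \<in> U" for x
  proof -
    have "sqn (lev U m) (v x) = (\<Sum>T\<in>{T \<in> lev U m. x \<notin> T}. (f (insert x T))\<^sup>2)"
      unfolding sqn_def using fl by (intro sum.mono_neutral_cong_right) (auto simp: v_def)
    also have "\<dots> = (\<Sum>T\<in>insert x ` {T \<in> lev U m. x \<notin> T}. (f T)\<^sup>2)"
      by (subst sum.reindex) (auto simp: inj_on_def insert_ident)
    also have "\<dots> \<le> S" unfolding S_def ssq_def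
    proof (intro sum_mono2)
      show "insert x ` {T \<in> lev U m. x \<notin> T} \<subseteq> lev U (Suc m)"
      proof (rule image_subsetI)
        fix T assume "T \<in> {T \<in> lev U m. x \<notin> T}"
        then have "finite T" "T \<subseteq> U" "card T = m" "x \<notin> T" using lev_memb[OF U] by blast+
        then show "insert x T \<in> lev U (Suc m)" using x unfolding lev_def by simp
      qed
    qed (use finite_lev[OF U] in auto)
    finally show ?thesis .
  qed
  have "\<exists>B. (\<forall>l<L. B l \<subseteq> U \<and> 2 * t \<le> (\<Sum>x\<in>B l. sqn (lev U m) (v x))) \<and>
      (\<forall>l<L. \<forall>l'<L. l \<noteq> l' \<longrightarrow> B l \<inter> B l' = {})"
  proof (rule greedy_blocks[OF U])
    show "2 * (2 * t) * real L \<le> (\<Sum>x\<in>U. sqn (lev U m) (v x))"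
      unfolding tot t_def using L by simp
    fix x assume "x \<in> U"
    have "S * (2 * real L) \<le> S * real (Suc m)" using L S0 by (intro mult_left_mono) auto
    then have "S \<le> 2 * t" unfolding t_def using L by (simp add: field_simps)
    then show "0 \<le> sqn (lev U m) (v x) \<and> sqn (lev U m) (v x) \<le> 2 * t"
      using one[OF \<open>x \<in> U\<close>] sqn_nonneg[of "lev U m" "v x"] by linarith
  qed (use t in auto)
  then obtain B where "(\<forall>l<L. B l \<subseteq> U \<and> 2 * t \<le> (\<Sum>x\<in>B l. sqn (lev U m) (v x))) \<and>
      (\<forall>l<L. \<forall>l'<L. l \<noteq> l' \<longrightarrow> B l \<inter> B l' = {})" ..
  then have B: "\<And>l. l < L \<Longrightarrow> B l \<subseteq> U" "\<And>l. l < L \<Longrightarrow> 2 * t \<le> (\<Sum>x\<in>B l. sqn (lev U m) (v x))"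
      "\<And>l l'. l < L \<Longrightarrow> l' < L \<Longrightarrow> l \<noteq> l' \<Longrightarrow> B l \<inter> B l' = {}" by simp_all
  have sq: "(sqrt t)\<^sup>2 = t" using t by simp
  have "pr U (\<lambda>\<xi>. sqn (lev U m) (wsum U v \<xi>) < (sqrt t)\<^sup>2) \<le> 4 * (real L + 1) powr (-1/4)"
  proof (rule small_ball[OF fl U, where p = "1/12" and B = B])
    fix l assume l: "l < L"
    show "1/12 \<le> pr (B l) (\<lambda>\<xi>. (sqrt t)\<^sup>2 \<le> sqn (lev U m) (wsum (B l) v \<xi>))"
      unfolding sq by (intro paley_zygmund fl t B l finite_subset[OF B(1)[OF l] U])
  qed (use B t in auto)
  then show ?thesis unfolding ws sq unfolding t_def S_def .
qed

text \<open>Turns bounds for the tail at powers of two into a bound for a moment.\<close>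

lemma dyadic_powr_bound:
  fixes x :: real
  assumes "0 < x" "x \<le> 2 ^ J" "0 \<le> a"
  shows "x powr a \<le> 1 + (\<Sum>j<J. 2 powr (a * real (Suc j)) * of_bool (2 ^ j < x))"
  using assms(2)
proof (induction J)
  case 0
  then show ?case using assms powr_mono2[of a x 1] by simp
next
  case (Suc J)
  let ?s = "\<lambda>J. \<Sum>j<J. 2 powr (a * real (Suc j)) * of_bool (2 ^ j < x)"
  have s: "0 \<le> ?s J" by (intro sum_nonneg) auto
  show ?case
  proof (cases "x \<le> 2 ^ J")
    case True
    then show ?thesis using Suc.IH by (simp add: not_less)
  next
    case False
    have "x powr a \<le> (2 ^ Suc J) powr a" using assms Suc.prems by (intro powr_mono2) auto
    also have "(2 ^ Suc J) powr a = 2 powr (real (Suc J) * a)"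
      by (simp only: powr_realpow[symmetric] powr_powr zero_less_numeral)
    finally have "x powr a \<le> 2 powr (a * real (Suc J))" by (simp add: mult.commute)
    then show ?thesis using False s by (simp add: not_le)
  qed
qed

text \<open>The small ball bound applies for \<open>2 * L \<le> Suc m\<close>. Beyond, up to \<open>64 * (Suc m)\<^sup>2\<close>, the bound for the largest
admissible \<open>L\<close> still has the claimed form, as the exponent is only half of the one obtained there.\<close>

lemma ssq_ratio_tail:
  fixes f :: "'a set \<Rightarrow> real"
  assumes U: "finite U" and S: "0 < ssq U (Suc m) f" and m: "1 \<le> m"
    and n: "2 ^ j < 64 * (real (Suc m))\<^sup>2"
  shows "pr U (\<lambda>\<xi>. 2 ^ j * ssq U m (step U \<xi> f) < real (Suc m) * ssq U (Suc m) f)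
    \<le> 8 * 2 powr (- real j / 8)"
proof -
  define W where "W = real (Suc m) * ssq U (Suc m) f"
  have W: "W > 0" unfolding W_def using S by simp
  have tail: "pr U (\<lambda>\<xi>. 2 ^ j * ssq U m (step U \<xi> f) < W) \<le> 4 * (real L + 1) powr (-1/4)"
    if L: "1 \<le> L" "2 * L \<le> Suc m" "4 * real L \<le> 2 ^ j" for L
  proof -
    have "pr U (\<lambda>\<xi>. 2 ^ j * ssq U m (step U \<xi> f) < W) \<le> pr U (\<lambda>\<xi>. ssq U m (step U \<xi> f) < W / (4 * real L))"
    proof (rule pr_mono)
      fix \<xi> assume "2 ^ j * ssq U m (step U \<xi> f) < W"
      moreover have "4 * real L * ssq U m (step U \<xi> f) \<le> 2 ^ j * ssq U m (step U \<xi> f)"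
        using L ssq_nonneg by (intro mult_right_mono) auto
      ultimately have "ssq U m (step U \<xi> f) * (4 * real L) < W" by (simp add: mult_ac)
      then show "ssq U m (step U \<xi> f) < W / (4 * real L)" using L by (simp add: less_divide_eq)
    qed
    also have "\<dots> \<le> 4 * (real L + 1) powr (-1/4)"
      unfolding W_def by (rule ssq_small_ball[OF U S L(1,2)])
    finally show ?thesis .
  qed
  consider "j \<le> 2" | "2 < j" "2 ^ (j - 1) \<le> Suc m" | "2 < j" "Suc m < 2 ^ (j - 1)" by linarith
  then have "pr U (\<lambda>\<xi>. 2 ^ j * ssq U m (step U \<xi> f) < W) \<le> 8 * 2 powr (- real j / 8)"
  proof cases
    case 1
    have "2 powr (-1) \<le> 2 powr (- real j / 8)" using 1 by (intro powr_mono) auto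
    then have "1 \<le> 8 * 2 powr (- real j / 8)" by (simp add: powr_minus_divide)
    then show ?thesis using pr_le_1[OF U, of "\<lambda>\<xi>. 2 ^ j * ssq U m (step U \<xi> f) < W"] by linarith
  next
    case 2
    define L :: nat where "L = 2 ^ (j - 2)"
    have j: "j = Suc (Suc (j - 2))" using 2 by simp
    have "j - 1 = Suc (j - 2)" using 2 by simp
    then have "2 * L = 2 ^ (j - 1)" unfolding L_def by simp
    then have L: "1 \<le> L" "2 * L \<le> Suc m" using 2 unfolding L_def by auto
    have L4: "4 * real L = 2 ^ j" unfolding L_def by (subst (2) j) simp
    have "pr U (\<lambda>\<xi>. 2 ^ j * ssq U m (step U \<xi> f) < W) \<le> 4 * (real L + 1) powr (-1/4)"
      by (rule tail) (use L L4 in auto)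
    also have "\<dots> \<le> 4 * real L powr (-1/4)"
      using L by (intro mult_left_mono powr_mono2') auto
    also have "real L = 2 powr (real j - 2)"
      using L4 by (simp add: powr_diff powr_realpow)
    also have "(2 powr (real j - 2)) powr (-1/4) = 2 powr (1/2 - real j / 4)"
      unfolding powr_powr by (intro arg_cong[where f = "\<lambda>x. 2 powr x"]) (simp add: field_simps)
    also have "\<dots> \<le> 2 powr (1 - real j / 8)" by (intro powr_mono) auto
    also have "\<dots> = 2 * 2 powr (- real j / 8)" by (simp add: powr_diff powr_minus_divide)
    finally show ?thesis by simp
  next
    case 3
    define L where "L = Suc m div 2"
    have j: "j = Suc (j - 1)" using 3 by simp
    have L: "1 \<le> L" "2 * L \<le> Suc m" "Suc m \<le> 2 * (L + 1)" unfolding L_def using m by auto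
    have Lr: "real (2 * L) \<le> real (Suc m)" "real (Suc m) \<le> real (2 * (L + 1))"
      using L(2,3) by (simp_all only: of_nat_le_iff)
    have p2: "2 ^ j = 2 * (2::real) ^ (j - 1)" by (subst j) simp
    have "real (Suc m) < real (2 ^ (j - 1))" using 3(2) by (simp only: of_nat_less_iff)
    then have "2 * real (Suc m) < 2 ^ j" unfolding p2 by simp
    moreover have "4 * real L \<le> 2 * real (Suc m)" using Lr(1) by simp
    ultimately have "4 * real L \<le> 2 ^ j" by linarith
    then have "pr U (\<lambda>\<xi>. 2 ^ j * ssq U m (step U \<xi> f) < W) \<le> 4 * (real L + 1) powr (-1/4)"
      by (intro tail L)
    also have "\<dots> \<le> 4 * (2 powr (real j / 2 - 4)) powr (-1/4)"
    proof (intro mult_left_mono powr_mono2')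
      have "(2 powr (real j / 2))\<^sup>2 = 2 ^ j"
        by (simp add: powr_power powr_realpow)
      also have "\<dots> < (8 * real (Suc m))\<^sup>2" unfolding power_mult_distrib using n by simp
      finally have "2 powr (real j / 2) < 8 * real (Suc m)"
        by (rule power_less_imp_less_base) simp
      also have "\<dots> \<le> 16 * (real L + 1)" using Lr(2) by simp
      finally show "2 powr (real j / 2 - 4) \<le> real L + 1" by (simp add: powr_diff)
    qed auto
    also have "(2 powr (real j / 2 - 4)) powr (-1/4) = 2 powr (1 - real j / 8)"
      unfolding powr_powr by (intro arg_cong[where f = "\<lambda>x. 2 powr x"]) (simp add: field_simps)
    also have "\<dots> = 2 * 2 powr (- real j / 8)" by (simp add: powr_diff powr_minus_divide)
    finally show ?thesis by simp
  qed
  then show ?thesis unfolding W_def .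
qed

text \<open>The sum of the geometric series that bounds the moment of the ratio.\<close>

definition loss :: real where
  "loss = 1 + 16 / (1 - 2 powr (-1/16))"

lemma loss_ge_1: "1 \<le> loss"
proof -
  have "2 powr (-1/16) \<le> 2 powr (0::real)" by (intro powr_mono) auto
  then show ?thesis unfolding loss_def by simp
qed

text \<open>The tail decays with exponent \<open>1/8\<close>, so the moment of order \<open>1/16\<close> is finite. The restriction to ratios up
to \<open>8 * card U\<close>, which costs little by \<open>ssq_drop\<close>, keeps the range where the tail is controlled.\<close>

lemma ssq_ratio_moment:
  fixes f :: "'a set \<Rightarrow> real"
  assumes U: "finite U" and S: "0 < ssq U (Suc m) f" and m: "1 \<le> m"
    and n: "card U \<le> 4 * (Suc m)\<^sup>2"
  defines "W \<equiv> real (Suc m) * ssq U (Suc m) f"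
  shows "avg U (\<lambda>\<xi>. of_bool (W \<le> ssq U m (step U \<xi> f) * (8 * real (card U))) *
      (W / ssq U m (step U \<xi> f)) powr (1/16)) \<le> loss"
proof -
  define n where "n = real (card U)"
  define s where "s \<xi> = ssq U m (step U \<xi> f)" for \<xi>
  have W: "W > 0" unfolding W_def using S by simp
  have "U \<noteq> {}"
  proof
    assume "U = {}"
    then have "lev U (Suc m) = {}" unfolding lev_def by auto
    then show False using S unfolding ssq_def by simp
  qed
  then have n1: "n \<ge> 1" unfolding n_def using U by (simp add: Suc_leI card_gt_0_iff)
  define J where "J = (LEAST J. 8 * n \<le> 2 ^ J)"
  have "\<exists>J. 8 * n < 2 ^ J" by (rule real_arch_pow) simp
  then have "\<exists>J. 8 * n \<le> 2 ^ J" using less_imp_le by blast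
  then have J: "8 * n \<le> 2 ^ J" unfolding J_def by (rule LeastI_ex)
  have Jless: "2 ^ j < 8 * n" if "j < J" for j
    using not_less_Least[of j "\<lambda>J. 8 * n \<le> 2 ^ J"] that unfolding J_def by simp
  have jn: "2 ^ j < 64 * (real (Suc m))\<^sup>2" if "j < J" for j
  proof -
    have "n \<le> real (4 * (Suc m)\<^sup>2)" unfolding n_def using assms(4) by (simp only: of_nat_le_iff)
    then have "8 * n \<le> 32 * (real (Suc m))\<^sup>2" by simp
    then show ?thesis using Jless[OF that] n1 by linarith
  qed
  let ?t = "\<lambda>j. 2 powr (1/16 * real (Suc j))"
  \<comment> \<open>\<open>2 ^ J\<close> is the first power of two beyond the largest ratio \<open>8 * n\<close>.\<close>
  have "avg U (\<lambda>\<xi>. of_bool (W \<le> s \<xi> * (8 * n)) * (W / s \<xi>) powr (1/16))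
    \<le> avg U (\<lambda>\<xi>. 1 + (\<Sum>j<J. ?t j * of_bool (2 ^ j * s \<xi> < W)))"
  proof (rule avg_mono)
    fix \<xi>
    show "of_bool (W \<le> s \<xi> * (8 * n)) * (W / s \<xi>) powr (1/16) \<le> 1 + (\<Sum>j<J. ?t j * of_bool (2 ^ j * s \<xi> < W))"
    proof (cases "W \<le> s \<xi> * (8 * n)")
      case True
      have "s \<xi> \<noteq> 0" using True W by auto
      then have s0: "s \<xi> > 0" using ssq_nonneg[of U m "step U \<xi> f"] unfolding s_def by simp
      have "W / s \<xi> \<le> 8 * n" using True s0 by (simp add: divide_le_eq mult.commute)
      then have "(W / s \<xi>) powr (1/16) \<le> 1 + (\<Sum>j<J. ?t j * of_bool (2 ^ j < W / s \<xi>))"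
        using J W s0 by (intro dyadic_powr_bound) auto
      then show ?thesis using True s0 by (simp add: less_divide_eq)
    next
      case False
      have "0 \<le> (\<Sum>j<J. ?t j * of_bool (2 ^ j * s \<xi> < W))" by (intro sum_nonneg) auto
      then show ?thesis using False by simp
    qed
  qed
  also have "\<dots> = 1 + (\<Sum>j<J. ?t j * pr U (\<lambda>\<xi>. 2 ^ j * s \<xi> < W))"
    by (simp only: avg_add avg_const[OF U] avg_sum avg_cmult)
  also have "\<dots> \<le> 1 + (\<Sum>j<J. 16 * (2 powr (-1/16)) ^ j)"
  proof (intro add_left_mono sum_mono)
    fix j assume "j \<in> {..<J}"
    then have "pr U (\<lambda>\<xi>. 2 ^ j * s \<xi> < W) \<le> 8 * 2 powr (- real j / 8)"
      unfolding s_def W_def by (intro ssq_ratio_tail[OF U S m] jn) simp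
    then have "?t j * pr U (\<lambda>\<xi>. 2 ^ j * s \<xi> < W) \<le> ?t j * (8 * 2 powr (- real j / 8))"
      by (intro mult_left_mono) auto
    also have "\<dots> = 8 * 2 powr (1/16 * real (Suc j) + - real j / 8)"
      by (simp only: powr_add mult_ac)
    also have "\<dots> \<le> 8 * 2 powr (1 + (-1/16) * real j)"
      by (intro mult_left_mono powr_mono) (auto simp: field_simps)
    also have "\<dots> = 16 * (2 powr (-1/16)) ^ j"
      by (simp only: powr_add powr_powr[symmetric] powr_realpow powr_gt_zero) simp
    finally show "?t j * pr U (\<lambda>\<xi>. 2 ^ j * s \<xi> < W) \<le> 16 * (2 powr (-1/16)) ^ j" .
  qed
  also have "\<dots> \<le> loss"
  proof -
    let ?q = "2 powr (-1/16) :: real"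
    have q: "0 \<le> ?q" "?q < 1" using powr_less_mono[of "-1/16" 0 "2::real"] by auto
    have "(\<Sum>j<J. ?q ^ j) = (1 - ?q ^ J) / (1 - ?q)" using q by (simp add: sum_gp_strict)
    also have "\<dots> \<le> 1 / (1 - ?q)" using q by (intro divide_right_mono) auto
    finally show ?thesis unfolding loss_def sum_distrib_left[symmetric] by simp
  qed
  finally show ?thesis unfolding s_def n_def .
qed

text \<open>Induction on the number of rows down to level \<open>u\<close>, with the potential \<open>(b / ssq) powr (1/16)\<close>. At level
\<open>u\<close> it is at least \<open>1\<close> unless some set is heavy, since there are at most \<open>2 ^ card U\<close> sets. A row
multiplies its mean by at most \<open>loss / Suc m powr (1/16)\<close>.\<close>

lemma magnitude_phase:
  fixes f :: "'a set \<Rightarrow> real"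
  assumes U: "finite U" and u: "1 \<le> u" "card U \<le> 4 * u\<^sup>2" and \<theta>: "\<theta> > 0" and \<kappa>: "0 \<le> \<kappa>"
    and heavy: "\<And>f T. T \<in> lev U u \<Longrightarrow> \<theta> \<le> \<bar>f T\<bar> \<Longrightarrow> light U \<theta> u f \<le> \<kappa>"
    and S: "0 < ssq U (u + k) f"
  shows "light U \<theta> (u + k) f \<le> \<kappa> + real k * (2 * (9/10) ^ u) +
    (\<theta>\<^sup>2 * 2 ^ card U * loss ^ (16 * k) * fact u / fact (u + k) / ssq U (u + k) f) powr (1/16)"
  using S
proof (induction k arbitrary: f)
  case 0
  have S: "0 < ssq U u f" using 0 by simp
  show ?case
  proof (cases "\<exists>T\<in>lev U u. \<theta> \<le> \<bar>f T\<bar>")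
    case True
    then have "light U \<theta> u f \<le> \<kappa>" using heavy by blast
    then show ?thesis by (simp add: add_increasing2)
  next
    case False
    have "card (lev U u) \<le> card (Pow U)" using U by (intro card_mono) (auto simp: lev_def)
    then have "real (card (lev U u)) \<le> real (2 ^ card U)" using U by (simp only: card_Pow of_nat_le_iff)
    then have c: "real (card (lev U u)) \<le> 2 ^ card U" by simp
    have "ssq U u f \<le> (\<Sum>T\<in>lev U u. \<theta>\<^sup>2)"
      unfolding ssq_def
    proof (rule sum_mono)
      fix T assume "T \<in> lev U u"
      then have "\<bar>f T\<bar> \<le> \<bar>\<theta>\<bar>" using False \<theta> by fastforce
      then show "(f T)\<^sup>2 \<le> \<theta>\<^sup>2" by (simp only: abs_le_square_iff)
    qed
    also have "\<dots> \<le> \<theta>\<^sup>2 * 2 ^ card U" using c \<theta> by (simp add: mult.commute mult_left_mono)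
    finally have "1 \<le> \<theta>\<^sup>2 * 2 ^ card U / ssq U u f" using S by (simp add: le_divide_eq)
    then have "1 \<le> (\<theta>\<^sup>2 * 2 ^ card U / ssq U u f) powr (1/16)" by (simp add: ge_one_powr_ge_zero)
    then show ?thesis using light_le_1[OF U, of \<theta> u f] \<kappa> by simp
  qed
next
  case (Suc k)
  define m where "m = u + k"
  define S where "S = ssq U (Suc m) f"
  define W where "W = real (Suc m) * S"
  define s where "s \<xi> = ssq U m (step U \<xi> f)" for \<xi>
  define q :: real where "q = 2 * (9/10) ^ u"
  define b where "b = \<theta>\<^sup>2 * 2 ^ card U * loss ^ (16 * k) * fact u / fact m"
  let ?G = "\<lambda>\<xi>. W \<le> s \<xi> * (8 * real (card U))"
  have S: "S > 0" using Suc.prems unfolding S_def m_def by simp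
  have W: "W > 0" unfolding W_def using S by simp
  have b: "b \<ge> 0" unfolding b_def using loss_ge_1 by simp
  have q: "q \<ge> 0" unfolding q_def by simp
  have m1: "1 \<le> m" unfolding m_def using u by simp
  have "u\<^sup>2 \<le> (Suc m)\<^sup>2" unfolding m_def by (intro power_mono) auto
  then have cU: "card U \<le> 4 * (Suc m)\<^sup>2" using u(2) by linarith
  have "light U \<theta> (Suc m) f \<le> avg U (\<lambda>\<xi>. of_bool (\<not> ?G \<xi>) + ((\<kappa> + real k * q) +
      (b / W) powr (1/16) * (of_bool (?G \<xi>) * (W / s \<xi>) powr (1/16))))"
    unfolding light.simps
  proof (rule avg_mono)
    fix \<xi>
    show "light U \<theta> m (step U \<xi> f) \<le> of_bool (\<not> ?G \<xi>) + ((\<kappa> + real k * q) +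
      (b / W) powr (1/16) * (of_bool (?G \<xi>) * (W / s \<xi>) powr (1/16)))"
    proof (cases "?G \<xi>")
      case True
      have "s \<xi> \<noteq> 0" using True W by auto
      then have s0: "s \<xi> > 0" using ssq_nonneg[of U m "step U \<xi> f"] unfolding s_def by simp
      have "light U \<theta> m (step U \<xi> f) \<le> \<kappa> + real k * q + (b / s \<xi>) powr (1/16)"
        using Suc.IH[of "step U \<xi> f"] s0 unfolding m_def q_def b_def s_def by simp
      also have "b / s \<xi> = (b / W) * (W / s \<xi>)" using W by simp
      also have "\<dots> powr (1/16) = (b / W) powr (1/16) * (W / s \<xi>) powr (1/16)"
        by (rule powr_mult)
      finally show ?thesis using True by simp
    next
      case False
      have "0 \<le> \<kappa> + real k * q" using \<kappa> q by simp
      then show ?thesis using False light_le_1[OF U, of \<theta> m "step U \<xi> f"] by simp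
    qed
  qed
  also have "\<dots> = pr U (\<lambda>\<xi>. \<not> ?G \<xi>) + ((\<kappa> + real k * q) +
      (b / W) powr (1/16) * avg U (\<lambda>\<xi>. of_bool (?G \<xi>) * (W / s \<xi>) powr (1/16)))"
    by (simp only: avg_add avg_const[OF U] avg_cmult)
  also have "\<dots> \<le> q + ((\<kappa> + real k * q) + (b / W) powr (1/16) * loss)"
  proof (intro add_mono mult_left_mono order_refl)
    have "pr U (\<lambda>\<xi>. \<not> ?G \<xi>) \<le> 2 * (9/10) ^ Suc m"
      unfolding not_le s_def W_def S_def by (rule ssq_drop[OF U])
    also have "\<dots> \<le> q" unfolding q_def m_def by (intro mult_left_mono power_decreasing) auto
    finally show "pr U (\<lambda>\<xi>. \<not> ?G \<xi>) \<le> q" .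
    show "avg U (\<lambda>\<xi>. of_bool (?G \<xi>) * (W / s \<xi>) powr (1/16)) \<le> loss"
      unfolding W_def s_def S_def
      by (rule ssq_ratio_moment[OF U S[unfolded S_def] m1 cU])
  qed auto
  also have "(b / W) powr (1/16) * loss = (b / W * loss ^ 16) powr (1/16)"
  proof -
    have "(loss ^ 16) powr (1/16) = loss"
    proof -
      have "loss ^ 16 = loss powr (real 16)"
        using loss_ge_1 by (intro powr_realpow[symmetric]) simp
      then have "(loss ^ 16) powr (1/16) = loss powr (real 16 * (1/16))" by (simp only: powr_powr)
      then show ?thesis using loss_ge_1 by simp
    qed
    then show ?thesis using b W loss_ge_1 by (subst powr_mult) auto
  qed
  also have "b / W * loss ^ 16 = \<theta>\<^sup>2 * 2 ^ card U * loss ^ (16 * Suc k) * fact u / fact (Suc m) / S"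
    unfolding b_def W_def using S by (simp add: field_simps power_add)
  finally show ?case unfolding S_def m_def q_def by (simp add: algebra_simps)
qed

section \<open>An entropy inequality for set families\<close>

text \<open>Subadditivity of entropy: Gibbs' inequality for the uniform distribution on \<open>P\<close> against the product of its
marginals. The terms on the left are the logarithms of the sizes of a row and of a column of \<open>P\<close>.\<close>

lemma pair_entropy:
  assumes "finite P"
  shows "(\<Sum>p\<in>P. ln (real (card {x. (fst p, x) \<in> P})) + ln (real (card {a. (a, snd p) \<in> P})))
    \<le> real (card P) * ln (real (card P))"
proof (cases "P = {}")
  case False
  define A where "A = fst ` P"
  define X where "X = snd ` P"
  define r where "r a = real (card {x. (a, x) \<in> P})" for a
  define c where "c x = real (card {a. (a, x) \<in> P})" for x
  define N where "N = real (card P)"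
  have fin: "finite A" "finite X" "finite {x. (a, x) \<in> P}" "finite {b. (b, x) \<in> P}" for a x
  proof -
    show "finite A" "finite X" unfolding A_def X_def using assms by auto
    have "{x. (a, x) \<in> P} \<subseteq> snd ` P" "{b. (b, x) \<in> P} \<subseteq> fst ` P" by force+
    then show "finite {x. (a, x) \<in> P}" "finite {b. (b, x) \<in> P}"
      using assms by (meson finite_imageI finite_subset)+
  qed
  have N: "N > 0" unfolding N_def using False assms by (simp add: card_gt_0_iff)
  have pos: "r (fst p) \<ge> 1" "c (snd p) \<ge> 1" if "p \<in> P" for p
  proof -
    have "snd p \<in> {x. (fst p, x) \<in> P}" "fst p \<in> {a. (a, snd p) \<in> P}" using that by auto
    then have "card {x. (fst p, x) \<in> P} > 0" "card {a. (a, snd p) \<in> P} > 0"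
      unfolding card_gt_0_iff using fin(3)[of "fst p"] fin(4)[of "snd p"] by blast+
    then show "r (fst p) \<ge> 1" "c (snd p) \<ge> 1" unfolding r_def c_def by auto
  qed
  have r: "(\<Sum>a\<in>A. r a) = N"
  proof -
    have "P = Sigma A (\<lambda>a. {x. (a, x) \<in> P})" unfolding A_def by force
    then have "card P = card (Sigma A (\<lambda>a. {x. (a, x) \<in> P}))" by simp
    then show ?thesis unfolding N_def r_def using fin by simp
  qed
  have c: "(\<Sum>x\<in>X. c x) = N"
  proof -
    have "prod.swap ` P = Sigma X (\<lambda>x. {a. (a, x) \<in> P})" unfolding X_def by force
    then have "card (prod.swap ` P) = card (Sigma X (\<lambda>x. {a. (a, x) \<in> P}))" by simp
    moreover have "card (prod.swap ` P) = card P" by (rule card_image) simp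
    ultimately show ?thesis unfolding N_def c_def using fin by simp
  qed
  have "(\<Sum>p\<in>P. r (fst p) * c (snd p)) \<le> (\<Sum>p\<in>A \<times> X. r (fst p) * c (snd p))"
  proof (rule sum_mono2)
    show "P \<subseteq> A \<times> X" unfolding A_def X_def by (rule subset_fst_snd)
  qed (use fin in \<open>auto simp: r_def c_def\<close>)
  also have "\<dots> = (\<Sum>a\<in>A. r a) * (\<Sum>x\<in>X. c x)"
    by (simp add: sum_product sum.cartesian_product case_prod_unfold)
  finally have prod: "(\<Sum>p\<in>P. r (fst p) * c (snd p)) \<le> N * N" unfolding r c .
  have "(\<Sum>p\<in>P. ln (r (fst p)) + ln (c (snd p))) \<le> (\<Sum>p\<in>P. ln N + (r (fst p) * c (snd p) / N - 1))"
  proof (rule sum_mono)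
    fix p assume p: "p \<in> P"
    have "ln (r (fst p) * c (snd p) / N) \<le> r (fst p) * c (snd p) / N - 1"
      using pos[OF p] N by (intro ln_le_minus_one) auto
    moreover have "ln (r (fst p) * c (snd p) / N) = ln (r (fst p)) + ln (c (snd p)) - ln N"
      using pos[OF p] N by (simp add: ln_div ln_mult)
    ultimately show "ln (r (fst p)) + ln (c (snd p)) \<le> ln N + (r (fst p) * c (snd p) / N - 1)" by linarith
  qed
  also have "\<dots> = N * ln N + (\<Sum>p\<in>P. r (fst p) * c (snd p)) / N - N"
    by (simp add: sum.distrib sum_subtractf sum_divide_distrib N_def)
  also have "\<dots> \<le> N * ln N + N * N / N - N"
    using prod N by (intro diff_right_mono add_left_mono divide_right_mono) auto
  finally show ?thesis using N unfolding r_def c_def N_def by simp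
qed simp

text \<open>Han's inequality for the uniform distribution on a set of lists: the entropies of a coordinate given all
the others add up to at most the total entropy.\<close>

lemma list_entropy:
  assumes "finite \<Omega>" "\<And>xs. xs \<in> \<Omega> \<Longrightarrow> length xs = m"
  shows "(\<Sum>xs\<in>\<Omega>. \<Sum>i<m. ln (real (card {a. xs[i := a] \<in> \<Omega>}))) \<le> real (card \<Omega>) * ln (real (card \<Omega>))"
  using assms
proof (induction m arbitrary: \<Omega>)
  case 0
  then have "\<Omega> \<subseteq> {[]}" by auto
  then have "card \<Omega> = 0 \<or> card \<Omega> = 1" using subset_singletonD by fastforce
  then show ?case by auto
next
  case (Suc m)
  define P where "P = (\<lambda>xs. (hd xs, tl xs)) ` \<Omega>"
  define S where "S a = {x. a # x \<in> \<Omega>}" for a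
  have cons: "hd xs # tl xs = xs" if "xs \<in> \<Omega>" for xs
    using Suc.prems(2)[OF that] by (cases xs) auto
  have inP: "(a, x) \<in> P \<longleftrightarrow> a # x \<in> \<Omega>" for a x
  proof
    assume "(a, x) \<in> P"
    then show "a # x \<in> \<Omega>" unfolding P_def using cons by auto
  qed (force simp: P_def)
  have inj: "inj_on (\<lambda>xs. (hd xs, tl xs)) \<Omega>"
  proof (rule inj_onI)
    fix xs ys assume *: "xs \<in> \<Omega>" "ys \<in> \<Omega>" "(hd xs, tl xs) = (hd ys, tl ys)"
    have "hd xs # tl xs = hd ys # tl ys" using *(3) by simp
    then show "xs = ys" unfolding cons[OF *(1)] cons[OF *(2)] .
  qed
  have fP: "finite P" unfolding P_def using Suc.prems by simp
  have cP: "card P = card \<Omega>" unfolding P_def by (rule card_image[OF inj])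
  define A where "A = fst ` P"
  have fA: "finite A" unfolding A_def using fP by simp
  have PS: "P = Sigma A S" unfolding A_def S_def using inP by force
  have fS: "finite (S a)" for a
  proof -
    have "S a \<subseteq> tl ` \<Omega>" unfolding S_def by force
    then show ?thesis using Suc.prems(1) finite_subset by blast
  qed
  have sigma: "(\<Sum>a\<in>A. \<Sum>x\<in>S a. g a x) = (\<Sum>p\<in>P. g (fst p) (snd p))" for g :: "'a \<Rightarrow> 'a list \<Rightarrow> real"
    unfolding PS using fA fS by (subst sum.Sigma) (auto simp: case_prod_unfold)
  have "(\<Sum>xs\<in>\<Omega>. \<Sum>i<Suc m. ln (real (card {a. xs[i := a] \<in> \<Omega>})))
      = (\<Sum>p\<in>P. \<Sum>i<Suc m. ln (real (card {a. (fst p # snd p)[i := a] \<in> \<Omega>})))"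
    unfolding P_def sum.reindex[OF inj] o_def using cons by (intro sum.cong) simp_all
  also have "\<dots> = (\<Sum>p\<in>P. ln (real (card {a. (a, snd p) \<in> P})) + 
      (\<Sum>i<m. ln (real (card {a. (snd p)[i := a] \<in> S (fst p)}))))"
    unfolding sum.lessThan_Suc_shift by (simp add: inP S_def)
  also have "\<dots> = (\<Sum>p\<in>P. ln (real (card {a. (a, snd p) \<in> P}))) +
      (\<Sum>a\<in>A. \<Sum>x\<in>S a. \<Sum>i<m. ln (real (card {b. x[i := b] \<in> S a})))"
    unfolding sum.distrib sigma ..
  also have "\<dots> \<le> (\<Sum>p\<in>P. ln (real (card {a. (a, snd p) \<in> P}))) +
      (\<Sum>a\<in>A. real (card (S a)) * ln (real (card (S a))))"
  proof (intro add_left_mono sum_mono)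
    fix a
    have "length x = m" if "x \<in> S a" for x using Suc.prems(2)[of "a # x"] that unfolding S_def by simp
    then show "(\<Sum>x\<in>S a. \<Sum>i<m. ln (real (card {b. x[i := b] \<in> S a}))) \<le> real (card (S a)) * ln (real (card (S a)))"
      by (rule Suc.IH[OF fS])
  qed
  also have "(\<Sum>a\<in>A. real (card (S a)) * ln (real (card (S a)))) = (\<Sum>a\<in>A. \<Sum>x\<in>S a. ln (real (card (S a))))"
    by simp
  also have "\<dots> = (\<Sum>p\<in>P. ln (real (card (S (fst p)))))"
    unfolding sigma ..
  also have "S = (\<lambda>a. {x. (a, x) \<in> P})" unfolding S_def inP ..
  finally show ?case using pair_entropy[OF fP] unfolding cP sum.distrib by simp
qed

definition degree :: "'a set set \<Rightarrow> 'a set \<Rightarrow> nat" where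
  "degree H S = card {x. x \<notin> S \<and> insert x S \<in> H}"

text \<open>\<open>list_entropy\<close> for all orderings of the members of \<open>H\<close>. Given all elements of an ordering but one, the last one
is uniformly distributed over the \<open>degree\<close> many possibilities.\<close>

lemma family_entropy:
  assumes "finite H" "\<And>T. T \<in> H \<Longrightarrow> finite T \<and> card T = m"
  shows "(\<Sum>T\<in>H. \<Sum>i\<in>T. ln (real (degree H (T - {i})))) \<le> real (card H) * ln (real (card H) * fact m)"
proof -
  define \<Omega> where "\<Omega> = (\<Union>T\<in>H. permutations_of_set T)"
  have dis: "permutations_of_set S \<inter> permutations_of_set T = {}" if "S \<noteq> T" for S T :: "'a set"
    using that unfolding permutations_of_set_def by auto
  have f\<Omega>: "finite \<Omega>" unfolding \<Omega>_def using assms by auto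
  have c\<Omega>: "card \<Omega> = card H * fact m"
    unfolding \<Omega>_def using assms dis by (subst card_UN_disjoint) auto
  have in\<Omega>: "xs \<in> \<Omega> \<longleftrightarrow> distinct xs \<and> set xs \<in> H" for xs
    unfolding \<Omega>_def permutations_of_set_def by auto
  have len: "length xs = m" if "xs \<in> \<Omega>" for xs
    using that assms(2)[of "set xs"] distinct_card[of xs] unfolding in\<Omega> by simp
  have dg: "card {a. xs[i := a] \<in> \<Omega>} = degree H (set xs - {xs ! i})" if xs: "xs \<in> \<Omega>" and i: "i < m" for xs i
  proof -
    have d: "distinct xs" "i < length xs" using xs i len in\<Omega> by auto
    have s: "set (xs[i := a]) = insert a (set xs - {xs ! i})" for a by (rule set_update_distinct[OF d])
    have "distinct (xs[i := a]) \<longleftrightarrow> a \<notin> set xs - {xs ! i}" for a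
    proof
      assume "distinct (xs[i := a])"
      then have c: "card (insert a (set xs - {xs ! i})) = length xs"
        using distinct_card[of "xs[i := a]"] unfolding s by simp
      have l: "card (set xs - {xs ! i}) < length xs" using d by (simp add: distinct_card)
      show "a \<notin> set xs - {xs ! i}"
      proof
        assume "a \<in> set xs - {xs ! i}"
        then have "insert a (set xs - {xs ! i}) = set xs - {xs ! i}" by (rule insert_absorb)
        then show False using c l by (simp only: less_irrefl)
      qed
    qed (use d in \<open>auto intro: distinct_list_update\<close>)
    then show ?thesis unfolding degree_def in\<Omega> s by simp
  qed
  have "(\<Sum>xs\<in>\<Omega>. \<Sum>i<m. ln (real (card {a. xs[i := a] \<in> \<Omega>})))
     = (\<Sum>xs\<in>\<Omega>. \<Sum>t\<in>set xs. ln (real (degree H (set xs - {t}))))"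
  proof (rule sum.cong[OF refl])
    fix xs assume xs: "xs \<in> \<Omega>"
    have "(\<Sum>i<m. ln (real (card {a. xs[i := a] \<in> \<Omega>}))) = (\<Sum>i<m. ln (real (degree H (set xs - {xs ! i}))))"
      using dg[OF xs] by simp
    also have "\<dots> = (\<Sum>t\<in>set xs. ln (real (degree H (set xs - {t}))))"
      by (rule sum.reindex_bij_betw, rule bij_betw_nth) (use xs len in \<open>auto simp: in\<Omega>\<close>)
    finally show "(\<Sum>i<m. ln (real (card {a. xs[i := a] \<in> \<Omega>}))) = (\<Sum>t\<in>set xs. ln (real (degree H (set xs - {t}))))" .
  qed
  also have "\<dots> = (\<Sum>T\<in>H. \<Sum>xs\<in>permutations_of_set T. \<Sum>t\<in>set xs. ln (real (degree H (set xs - {t}))))"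
    unfolding \<Omega>_def by (rule sum.UNION_disjoint) (use assms dis in auto)
  also have "\<dots> = (\<Sum>T\<in>H. fact m * (\<Sum>t\<in>T. ln (real (degree H (T - {t})))))"
  proof (rule sum.cong[OF refl])
    fix T assume T: "T \<in> H"
    have "(\<Sum>xs\<in>permutations_of_set T. \<Sum>t\<in>set xs. ln (real (degree H (set xs - {t}))))
       = (\<Sum>xs\<in>permutations_of_set T. \<Sum>t\<in>T. ln (real (degree H (T - {t}))))"
      by (rule sum.cong[OF refl]) (simp add: permutations_of_set_def)
    then show "(\<Sum>xs\<in>permutations_of_set T. \<Sum>t\<in>set xs. ln (real (degree H (set xs - {t}))))
       = fact m * (\<Sum>t\<in>T. ln (real (degree H (T - {t}))))"
      using assms(2)[OF T] by simp
  qed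
  finally have "fact m * (\<Sum>T\<in>H. \<Sum>i\<in>T. ln (real (degree H (T - {i})))) \<le>
      fact m * (real (card H) * ln (real (card H) * fact m))"
    using list_entropy[OF f\<Omega> len] unfolding c\<Omega> by (simp add: sum_distrib_left mult_ac)
  then show ?thesis by (subst (asm) mult_le_cancel_left_pos) auto
qed

section \<open>Counting heavy sets\<close>

definition heavies :: "'a set \<Rightarrow> real \<Rightarrow> nat \<Rightarrow> ('a set \<Rightarrow> real) \<Rightarrow> 'a set set" where
  "heavies U \<theta> m f = {T \<in> lev U m. \<theta> \<le> \<bar>f T\<bar>}"

lemma finite_heavies: "finite U \<Longrightarrow> finite (heavies U \<theta> m f)"
  unfolding heavies_def by (simp add: finite_lev)

text \<open>A heavy set \<open>S\<close> of the new level is counted \<open>degree H S\<close> times on the left, each time with weight at most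
\<open>1 / degree H S\<close>.\<close>

lemma heavies_count:
  assumes "finite U" and H: "H = heavies U \<theta> (Suc k) f"
  shows "(\<Sum>T\<in>H. \<Sum>i\<in>T. of_bool (\<bar>f T\<bar> \<le> \<bar>step U \<xi> f (T - {i})\<bar>) / real (degree H (T - {i})))
    \<le> real (card (heavies U \<theta> k (step U \<xi> f)))"
proof -
  define h :: "'a set \<Rightarrow> real" where "h S = of_bool (\<theta> \<le> \<bar>step U \<xi> f S\<bar>)" for S
  have "(\<Sum>T\<in>H. \<Sum>i\<in>T. of_bool (\<bar>f T\<bar> \<le> \<bar>step U \<xi> f (T - {i})\<bar>) / real (degree H (T - {i})))
      \<le> (\<Sum>T\<in>H. \<Sum>i\<in>T. h (T - {i}) / real (degree H (T - {i})))"
    unfolding H heavies_def h_def by (intro sum_mono divide_right_mono) auto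
  also have "\<dots> = (\<Sum>T\<in>lev U (Suc k). \<Sum>i\<in>T. of_bool (T \<in> H) * (h (T - {i}) / real (degree H (T - {i}))))"
  proof (rule sum.mono_neutral_cong_left)
    show "finite (lev U (Suc k))" by (rule finite_lev[OF assms(1)])
    show "H \<subseteq> lev U (Suc k)" unfolding H heavies_def by auto
    show "\<forall>T\<in>lev U (Suc k) - H. (\<Sum>i\<in>T. of_bool (T \<in> H) * (h (T - {i}) / real (degree H (T - {i})))) = 0"
      by simp
  qed (simp only: of_bool_eq mult_1)
  also have "\<dots> = (\<Sum>S\<in>lev U k. \<Sum>x\<in>U - S. of_bool (insert x S \<in> H) *
      (h (insert x S - {x}) / real (degree H (insert x S - {x}))))"
    by (rule sum_lev_pairs[OF assms(1)])
  also have "\<dots> = (\<Sum>S\<in>lev U k. real (degree H S) * (h S / real (degree H S)))"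
  proof (rule sum.cong[OF refl])
    fix S assume "S \<in> lev U k"
    have "{x. x \<notin> S \<and> insert x S \<in> H} = {x \<in> U - S. insert x S \<in> H}"
      unfolding H heavies_def lev_def by auto
    then have d: "real (degree H S) = (\<Sum>x\<in>U - S. of_bool (insert x S \<in> H))"
      unfolding degree_def using assms(1) by (simp add: Int_def)
    have "(\<Sum>x\<in>U - S. of_bool (insert x S \<in> H) * (h (insert x S - {x}) / real (degree H (insert x S - {x}))))
        = (\<Sum>x\<in>U - S. of_bool (insert x S \<in> H) * (h S / real (degree H S)))"
      by (rule sum.cong[OF refl]) simp
    also have "\<dots> = real (degree H S) * (h S / real (degree H S))"
      unfolding sum_distrib_right[symmetric] d ..
    finally show "(\<Sum>x\<in>U - S. of_bool (insert x S \<in> H) * (h (insert x S - {x}) / real (degree H (insert x S - {x}))))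
        = real (degree H S) * (h S / real (degree H S))" .
  qed
  also have "\<dots> \<le> (\<Sum>S\<in>lev U k. h S)"
    by (intro sum_mono) (auto simp: h_def)
  also have "\<dots> = real (card (heavies U \<theta> k (step U \<xi> f)))"
    unfolding h_def heavies_def using assms(1) by (simp add: finite_lev Int_def)
  finally show ?thesis .
qed

lemma exp_neg_average_bound:
  fixes z :: real
  assumes "0 \<le> z"
  shows "(1 + exp (- z)) / 2 \<le> exp (- (z / 2 * (1 - z)))"
proof -
  have "exp (- z) \<le> 1 / (1 + z)"
    using exp_ge_add_one_self[of z] assms by (simp add: exp_minus field_simps)
  also have "\<dots> \<le> 1 - z + z\<^sup>2" using assms by (simp add: divide_le_eq field_simps power2_eq_square)
  finally have "(1 + exp (- z)) / 2 \<le> 1 + - (z / 2 * (1 - z))" by (simp add: field_simps power2_eq_square)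
  also have "\<dots> \<le> exp (- (z / 2 * (1 - z)))" by (rule exp_ge_add_one_self)
  finally show ?thesis .
qed

text \<open>The left side is the Laplace transform of \<open>exp y\<close> times a fair bit, at \<open>\<mu>\<close>. The right side is linear in \<open>y\<close> in
the exponent, so that in a product over several \<open>y\<close> only their sum matters. This needs an upper
bound \<open>l\<close> for \<open>y\<close>, and it costs a parameter \<open>\<mu>\<close> of order \<open>1 / l\<close>.\<close>

lemma exp_average_bound:
  fixes l y \<mu> :: real
  assumes "0 < \<mu>" "\<mu> * (1 + l) = 1/25" "y \<le> l"
  shows "(1 + exp (- (\<mu> * exp y))) / 2 \<le> exp (- (12/25 * \<mu> * (1 + y)))"
proof (cases "\<mu> * exp y \<le> 1/25")
  case True
  let ?z = "\<mu> * exp y"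
  have z: "0 \<le> ?z" using assms by simp
  have "?z * (24/25) \<le> ?z * (1 - ?z)" using True z by (intro mult_left_mono) auto
  moreover have "\<mu> * (1 + y) \<le> ?z" using assms exp_ge_add_one_self[of y] by (intro mult_left_mono) auto
  ultimately have "12/25 * \<mu> * (1 + y) \<le> ?z / 2 * (1 - ?z)" by simp
  then have "exp (- (?z / 2 * (1 - ?z))) \<le> exp (- (12/25 * \<mu> * (1 + y)))" by simp
  then show ?thesis using exp_neg_average_bound[OF z] by linarith
next
  case False
  have "(1 + exp (- (\<mu> * exp y))) / 2 \<le> (1 + exp (- (1/25))) / 2" using False by simp
  also have "\<dots> \<le> exp (- (12/25 * (1/25)))" using exp_neg_average_bound[of "1/25"] by simp
  also have "\<mu> * (1 + y) \<le> \<mu> * (1 + l)" using assms by (intro mult_left_mono) auto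
  then have "\<mu> * (1 + y) \<le> 1/25" using assms by simp
  then have "exp (- (12/25 * (1/25))) \<le> exp (- (12/25 * \<mu> * (1 + y)))" by simp
  finally show ?thesis by simp
qed

text \<open>At least half of the indices are good on average. If all \<open>d i\<close> were equal, this would be Chernoff's bound. In
general the mean of the sum is larger, by the inequality of the arithmetic and the geometric mean,
but a few indices may carry most of it; \<open>exp_average_bound\<close> shows that this does no harm.\<close>

lemma weighted_good_unlikely_small:
  fixes f :: "'a set \<Rightarrow> real" and d :: "'a \<Rightarrow> real"
  assumes U: "finite U" and T: "T \<in> lev U m" and m: "1 \<le> m"
    and d: "\<And>i. i \<in> T \<Longrightarrow> 1 \<le> d i \<and> d i \<le> n"
  defines "A \<equiv> (\<Sum>i\<in>T. ln (d i)) / real m"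
  shows "pr U (\<lambda>\<xi>. (\<Sum>i\<in>T. of_bool (\<bar>f T\<bar> \<le> \<bar>step U \<xi> f (T - {i})\<bar>) / d i) < real m * (10/21) * exp (- A))
    \<le> exp (- (real m / (7500 * (1 + ln n))))"
proof -
  have T': "finite T" "T \<subseteq> U" "card T = m" using lev_memb[OF U T] by auto
  obtain i0 where "i0 \<in> T" using T' m by fastforce
  then have n1: "1 \<le> n" using d[of i0] by linarith
  define l where "l = ln n"
  have l: "0 \<le> l" unfolding l_def using n1 by simp
  define \<mu> where "\<mu> = 1 / (25 * (1 + l))"
  have \<mu>: "0 < \<mu>" "\<mu> * (1 + l) = 1/25" unfolding \<mu>_def using l by auto
  define Z where "Z \<xi> = (\<Sum>i\<in>T. of_bool (\<bar>f T\<bar> \<le> \<bar>step U \<xi> f (T - {i})\<bar>) / d i)" for \<xi>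
  define t where "t i = \<mu> * exp A / d i" for i
  have tZ: "(\<Sum>i\<in>T. t i * of_bool (\<bar>f T\<bar> \<le> \<bar>step U \<xi> f (T - {i})\<bar>)) = \<mu> * exp A * Z \<xi>" for \<xi>
    unfolding Z_def t_def sum_distrib_left by (intro sum.cong) auto
  have "ln (d i) \<le> l" if "i \<in> T" for i using d[OF that] unfolding l_def by simp
  then have "(\<Sum>i\<in>T. ln (d i)) \<le> real (card T) * l" by (intro sum_bounded_above) auto
  then have A: "A \<le> l" unfolding A_def T'(3) using m by (simp add: field_simps)
  have tx: "t i = \<mu> * exp (A - ln (d i))" if "i \<in> T" for i
    unfolding t_def using d[OF that] by (simp add: exp_diff)
  have "pr U (\<lambda>\<xi>. Z \<xi> < real m * (10/21) * exp (- A)) \<le>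
      pr U (\<lambda>\<xi>. exp (- (\<mu> * exp A * Z \<xi>)) \<ge> exp (- (\<mu> * real m * (10/21))))"
  proof (rule pr_mono)
    fix \<xi> assume "Z \<xi> < real m * (10/21) * exp (- A)"
    then have "\<mu> * exp A * Z \<xi> \<le> \<mu> * exp A * (real m * (10/21) * exp (- A))"
      using \<mu> by (intro mult_left_mono) auto
    also have "\<dots> = \<mu> * real m * (10/21)" by (simp add: exp_minus)
    finally show "exp (- (\<mu> * exp A * Z \<xi>)) \<ge> exp (- (\<mu> * real m * (10/21)))" by simp
  qed
  also have "\<dots> \<le> avg U (\<lambda>\<xi>. exp (- (\<mu> * exp A * Z \<xi>))) / exp (- (\<mu> * real m * (10/21)))"
    by (intro pr_markov) auto
  also have "avg U (\<lambda>\<xi>. exp (- (\<mu> * exp A * Z \<xi>))) \<le> (\<Prod>i\<in>T. (1 + exp (- t i)) / 2)"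
    unfolding tZ[symmetric] using U T' \<mu> d by (intro good_bits) (auto simp: t_def dest!: d)
  also have "\<dots> \<le> (\<Prod>i\<in>T. exp (- (12/25 * \<mu> * (1 + (A - ln (d i))))))"
  proof (intro prod_mono conjI)
    fix i assume i: "i \<in> T"
    have "0 \<le> ln (d i)" using d[OF i] by simp
    then have "A - ln (d i) \<le> l" using A by linarith
    then show "(1 + exp (- t i)) / 2 \<le> exp (- (12/25 * \<mu> * (1 + (A - ln (d i)))))"
      unfolding tx[OF i] by (rule exp_average_bound[OF \<mu>])
  qed (simp add: add_nonneg_nonneg)
  also have "\<dots> = exp (\<Sum>i\<in>T. - (12/25 * \<mu> * (1 + (A - ln (d i)))))"
    using T' by (simp only: exp_sum)
  also have "(\<Sum>i\<in>T. - (12/25 * \<mu> * (1 + (A - ln (d i))))) = - (12/25 * \<mu> * real m)"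
  proof -
    have "(\<Sum>i\<in>T. 1 + (A - ln (d i))) = real m + (real m * A - (\<Sum>i\<in>T. ln (d i)))"
      using T' by (simp add: sum.distrib sum_subtractf)
    also have "\<dots> = real m" unfolding A_def using m by simp
    finally show ?thesis by (simp only: sum_negf sum_distrib_left[symmetric])
  qed
  also have "exp (- (12/25 * \<mu> * real m)) / exp (- (\<mu> * real m * (10/21))) = exp (- (2/525 * \<mu> * real m))"
    unfolding exp_diff[symmetric] by (simp add: algebra_simps)
  also have "\<dots> \<le> exp (- (real m / (7500 * (1 + ln n))))"
  proof -
    have "real m / (7500 * (1 + ln n)) = 1/300 * \<mu> * real m"
      unfolding \<mu>_def l_def by simp
    also have "\<dots> \<le> 2/525 * \<mu> * real m" using \<mu> by (intro mult_right_mono) auto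
    finally show ?thesis by simp
  qed
  finally show ?thesis unfolding Z_def by (simp add: divide_right_mono)
qed

text \<open>By \<open>heavies_count\<close> the number of new heavy sets is at least the sum over \<open>T\<close> of the quantity of
\<open>weighted_good_unlikely_small\<close>, and the geometric means of the degrees are controlled on average by
\<open>family_entropy\<close>. The mean in that inequality is of logarithms, so Jensen's inequality goes the right
way. The constant \<open>exp (-4/5)\<close> lies below the expected \<open>1/2\<close>; what matters is that it exceeds \<open>exp (-1)\<close>.\<close>

lemma heavies_drop:
  fixes f :: "'a set \<Rightarrow> real" and \<theta> :: real and k :: nat
  assumes U: "finite U"
  defines "H \<equiv> heavies U \<theta> (Suc k) f"
  defines "N \<equiv> real (card H)" and "m \<equiv> real (Suc k)"
  defines "\<Lambda> \<equiv> ln (N * fact (Suc k)) / m"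
  assumes ne: "H \<noteq> {}"
  shows "pr U (\<lambda>\<xi>. real (card (heavies U \<theta> k (step U \<xi> f))) < exp (-4/5) * m * N * exp (- \<Lambda>))
    \<le> 20 * exp (- (m / (7500 * (1 + ln (real (card U))))))"
proof -
  define n where "n = real (card U)"
  define q where "q = exp (- (m / (7500 * (1 + ln n))))"
  define d where "d S = real (degree H S)" for S
  define A where "A T = (\<Sum>i\<in>T. ln (d (T - {i}))) / m" for T
  define Z where "Z \<xi> T = (\<Sum>i\<in>T. of_bool (\<bar>f T\<bar> \<le> \<bar>step U \<xi> f (T - {i})\<bar>) / d (T - {i}))" for \<xi> T
  define X where "X \<xi> = (\<Sum>T\<in>H. exp (- A T) * of_bool (Z \<xi> T < m * (10/21) * exp (- A T)))" for \<xi>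
  define W where "W = (\<Sum>T\<in>H. exp (- A T))"
  have fH: "finite H" unfolding H_def by (rule finite_heavies[OF U])
  have N: "N > 0" unfolding N_def using fH ne by (simp add: card_gt_0_iff)
  have m: "m > 0" unfolding m_def by simp
  have HT: "T \<in> lev U (Suc k)" if "T \<in> H" for T using that unfolding H_def heavies_def by simp
  have HT': "finite T" "card T = Suc k" "T \<subseteq> U" if "T \<in> H" for T using lev_memb[OF U HT[OF that]] by auto
  have dd: "1 \<le> d (T - {i}) \<and> d (T - {i}) \<le> n" if "T \<in> H" "i \<in> T" for T i
  proof -
    have "{x. x \<notin> T - {i} \<and> insert x (T - {i}) \<in> H} \<subseteq> U"
      using HT' by auto
    then have "degree H (T - {i}) \<le> card U" "finite {x. x \<notin> T - {i} \<and> insert x (T - {i}) \<in> H}"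
      unfolding degree_def using U by (auto intro: card_mono finite_subset)
    moreover have "i \<in> {x. x \<notin> T - {i} \<and> insert x (T - {i}) \<in> H}" using that by (simp add: insert_absorb)
    ultimately have "1 \<le> degree H (T - {i})" "degree H (T - {i}) \<le> card U"
      unfolding degree_def by (auto simp: Suc_le_eq card_gt_0_iff)
    then show ?thesis unfolding d_def n_def by simp
  qed
  have W: "W \<ge> N * exp (- \<Lambda>)"
  proof -
    have "(\<Sum>T\<in>H. m * A T) = (\<Sum>T\<in>H. \<Sum>i\<in>T. ln (d (T - {i})))"
      unfolding A_def using m by simp
    also have "\<dots> \<le> real (card H) * ln (real (card H) * fact (Suc k))"
      unfolding d_def by (rule family_entropy[OF fH]) (use HT' in auto)
    also have "\<dots> = m * (N * \<Lambda>)" unfolding \<Lambda>_def N_def using m by simp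
    finally have "m * (\<Sum>T\<in>H. A T) \<le> m * (N * \<Lambda>)" by (simp only: sum_distrib_left)
    then have sA: "(\<Sum>T\<in>H. A T) \<le> N * \<Lambda>" using m by simp
    have "exp (- \<Lambda>) * N \<le> exp (- \<Lambda>) * (N + (N * \<Lambda> - (\<Sum>T\<in>H. A T)))"
      using sA by (intro mult_left_mono) auto
    also have "\<dots> = (\<Sum>T\<in>H. exp (- \<Lambda>) * (1 + (\<Lambda> - A T)))"
      unfolding sum_distrib_left[symmetric] by (simp add: sum.distrib sum_subtractf N_def)
    also have "\<dots> \<le> W" unfolding W_def
    proof (rule sum_mono)
      fix T
      have "exp (- \<Lambda>) * (1 + (\<Lambda> - A T)) \<le> exp (- \<Lambda>) * exp (\<Lambda> - A T)"
        by (intro mult_left_mono exp_ge_add_one_self) simp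
      then show "exp (- \<Lambda>) * (1 + (\<Lambda> - A T)) \<le> exp (- A T)" by (simp add: exp_add[symmetric])
    qed
    finally show ?thesis by (simp add: mult.commute)
  qed
  have W0: "W > 0" using W mult_pos_pos[OF N exp_gt_zero[of "- \<Lambda>"]] by linarith
  have EX: "avg U X \<le> q * W"
  proof -
    have "avg U X = (\<Sum>T\<in>H. exp (- A T) * pr U (\<lambda>\<xi>. Z \<xi> T < m * (10/21) * exp (- A T)))"
      unfolding X_def by (simp only: avg_sum avg_cmult)
    also have "\<dots> \<le> (\<Sum>T\<in>H. exp (- A T) * q)"
    proof (intro sum_mono mult_left_mono)
      fix T assume T: "T \<in> H"
      show "pr U (\<lambda>\<xi>. Z \<xi> T < m * (10/21) * exp (- A T)) \<le> q"
        unfolding Z_def q_def A_def m_def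
        by (rule weighted_good_unlikely_small[OF U HT[OF T]]) (use dd[OF T] in auto)
    qed auto
    also have "\<dots> = q * W" unfolding W_def sum_distrib_right[symmetric] by (rule mult.commute)
    finally show ?thesis .
  qed
  have key: "W / 20 \<le> X \<xi>" if "real (card (heavies U \<theta> k (step U \<xi> f))) < exp (-4/5) * m * N * exp (- \<Lambda>)" for \<xi>
  proof (rule ccontr)
    assume "\<not> W / 20 \<le> X \<xi>"
    then have "19/20 * W \<le> W - X \<xi>" by linarith
    also have "W - X \<xi> = (\<Sum>T\<in>H. exp (- A T) * of_bool (\<not> Z \<xi> T < m * (10/21) * exp (- A T)))"
      unfolding W_def X_def sum_subtractf[symmetric] by (intro sum.cong) auto
    finally have "m * (10/21) * (19/20 * W) \<le> m * (10/21) * (\<Sum>T\<in>H. exp (- A T) * of_bool (\<not> Z \<xi> T < m * (10/21) * exp (- A T)))"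
      using m by (intro mult_left_mono) auto
    also have "\<dots> = (\<Sum>T\<in>H. m * (10/21) * exp (- A T) * of_bool (\<not> Z \<xi> T < m * (10/21) * exp (- A T)))"
      unfolding sum_distrib_left by (intro sum.cong) auto
    also have "\<dots> \<le> (\<Sum>T\<in>H. Z \<xi> T)"
    proof (rule sum_mono)
      fix T
      have "0 \<le> Z \<xi> T" unfolding Z_def d_def by (intro sum_nonneg) auto
      then show "m * (10/21) * exp (- A T) * of_bool (\<not> Z \<xi> T < m * (10/21) * exp (- A T)) \<le> Z \<xi> T" by auto
    qed
    also have "\<dots> \<le> real (card (heavies U \<theta> k (step U \<xi> f)))"
      unfolding Z_def d_def by (rule heavies_count[OF U]) (simp add: H_def)
    also have "\<dots> < exp (-4/5) * m * N * exp (- \<Lambda>)" by (rule that)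
    also have "\<dots> = exp (-4/5) * m * (N * exp (- \<Lambda>))" by simp
    also have "\<dots> \<le> exp (-4/5) * m * W" using W m by (intro mult_left_mono) auto
    finally have ex: "19/42 < exp (-4/5 :: real)" using W0 m by simp
    \<comment> \<open>\<open>19/42\<close> is \<open>10/21\<close> times the fraction \<open>19/20\<close> of the weight that is not lost.\<close>
    have "(61/50) ^ 4 \<le> exp (1/5 :: real) ^ 4"
      using exp_lower_Taylor_quadratic[of "1/5"] by (intro power_mono) (auto simp: power2_eq_square)
    moreover have "exp (1/5 :: real) ^ 4 = exp (4/5)" by (subst exp_of_nat_mult[symmetric]) simp
    ultimately have "42/19 \<le> exp (4/5 :: real)" by (simp add: power4_eq_xxxx)
    then have "42/19 * (19/42) < exp (4/5) * exp (-4/5 :: real)"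
      using ex by (intro mult_le_less_imp_less) auto
    then show False by (simp add: exp_add[symmetric])
  qed
  have "pr U (\<lambda>\<xi>. real (card (heavies U \<theta> k (step U \<xi> f))) < exp (-4/5) * m * N * exp (- \<Lambda>))
      \<le> pr U (\<lambda>\<xi>. W / 20 \<le> X \<xi>)"
    by (rule pr_mono) (rule key)
  also have "\<dots> \<le> avg U X / (W / 20)"
    using W0 by (intro pr_markov) (auto simp: X_def intro!: sum_nonneg)
  also have "\<dots> \<le> q * W / (W / 20)" using EX W0 by (intro divide_right_mono) auto
  also have "\<dots> = 20 * q" using W0 by simp
  finally show ?thesis unfolding q_def n_def .
qed

section \<open>Families with large degrees\<close>

definition exts :: "'a set set \<Rightarrow> 'a set \<Rightarrow> 'a set" where
  "exts H Z = {x. x \<notin> Z \<and> (\<exists>T\<in>H. insert x Z \<subseteq> T)}"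

text \<open>The expectation of \<open>g\<close> at a random \<open>l\<close>-set that is built from \<open>{}\<close> by adding uniformly random extensions.
With this measure on the levels a random extension of a random set is again distributed
according to the measure one level higher.\<close>

primrec up_chain :: "'a set set \<Rightarrow> nat \<Rightarrow> ('a set \<Rightarrow> real) \<Rightarrow> real" where
  "up_chain H 0 g = g {}"
| "up_chain H (Suc l) g = up_chain H l (\<lambda>Z. (\<Sum>x\<in>exts H Z. g (insert x Z)) / real (card (exts H Z)))"

lemma up_chain_mono:
  assumes "H \<noteq> {}" "\<And>Z T. T \<in> H \<Longrightarrow> Z \<subseteq> T \<Longrightarrow> finite Z \<Longrightarrow> card Z = l \<Longrightarrow> g Z \<le> g' Z"
  shows "up_chain H l g \<le> up_chain H l g'"
  using assms(2)
proof (induction l arbitrary: g g')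
  case 0
  then show ?case using assms(1) by fastforce
next
  case (Suc l)
  show ?case unfolding up_chain.simps
  proof (rule Suc.IH, rule divide_right_mono, rule sum_mono)
    fix Z T x assume Z: "finite Z" "card Z = l" "x \<in> exts H Z"
    then obtain T' where "T' \<in> H" "insert x Z \<subseteq> T'" "x \<notin> Z" unfolding exts_def by auto
    then show "g (insert x Z) \<le> g' (insert x Z)"
      using Z by (intro Suc.prems[of T']) auto
  qed simp
qed

lemma up_chain_cong:
  assumes "H \<noteq> {}" "\<And>Z T. T \<in> H \<Longrightarrow> Z \<subseteq> T \<Longrightarrow> finite Z \<Longrightarrow> card Z = l \<Longrightarrow> g Z = g' Z"
  shows "up_chain H l g = up_chain H l g'"
  by (intro antisym up_chain_mono assms(1)) (simp_all add: assms(2))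

lemma up_chain_affine:
  assumes "H \<noteq> {}" "\<And>Z T. T \<in> H \<Longrightarrow> Z \<subseteq> T \<Longrightarrow> finite Z \<Longrightarrow> card Z < l \<Longrightarrow> 0 < card (exts H Z)"
  shows "up_chain H l (\<lambda>Z. c * g Z + d) = c * up_chain H l g + d"
  using assms(2)
proof (induction l arbitrary: g)
  case (Suc l)
  have "up_chain H (Suc l) (\<lambda>Z. c * g Z + d)
    = up_chain H l (\<lambda>Z. c * ((\<Sum>x\<in>exts H Z. g (insert x Z)) / real (card (exts H Z))) + d)"
    unfolding up_chain.simps
  proof (rule up_chain_cong[OF assms(1)])
    fix Z T assume "T \<in> H" "Z \<subseteq> T" "finite Z" "card Z = l"
    then have p: "0 < card (exts H Z)" by (intro Suc.prems) auto
    have "(\<Sum>x\<in>exts H Z. c * g (insert x Z) + d) = c * (\<Sum>x\<in>exts H Z. g (insert x Z)) + real (card (exts H Z)) * d"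
      by (simp add: sum.distrib sum_distrib_left)
    then show "(\<Sum>x\<in>exts H Z. c * g (insert x Z) + d) / real (card (exts H Z))
        = c * ((\<Sum>x\<in>exts H Z. g (insert x Z)) / real (card (exts H Z))) + d"
      using p by (simp add: add_divide_distrib)
  qed
  also have "\<dots> = c * up_chain H (Suc l) g + d"
    unfolding up_chain.simps by (rule Suc.IH) (auto intro: Suc.prems)
  finally show ?case .
qed simp

lemma avg_up_chain: "avg U (\<lambda>\<xi>. up_chain H l (g \<xi>)) = up_chain H l (\<lambda>Z. avg U (\<lambda>\<xi>. g \<xi> Z))"
  by (induction l arbitrary: g) (simp_all add: avg_sum avg_divide)

text \<open>Follow the fraction of light sets, in the sense of \<open>up_chain\<close>, from the members of \<open>H\<close>, which are all
heavy, down to \<open>{}\<close>. A set with many extensions is light in the new state only if almost all of its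
extensions were light before, or else with the small probability of the Littlewood-Offord inequality.
Almost all means all up to the fraction \<open>1 / (2 * m)\<close>, so that the factor lost in \<open>m\<close> steps is at most \<open>2\<close>.\<close>

lemma light_le_core:
  assumes U: "finite U" and \<theta>: "\<theta> > 0" and H: "H \<subseteq> heavies U \<theta> m f" "H \<noteq> {}" and m: "1 \<le> m"
    and deg: "\<And>T i. T \<in> H \<Longrightarrow> i \<in> T \<Longrightarrow> D \<le> degree H (T - {i})"
    and D: "1 \<le> D" "2 * m * h \<le> D"
  shows "light U \<theta> m f \<le> 4 * real m * (real h + 1) powr (-1/4)"
proof -
  define e where "e = 2 * (real h + 1) powr (-1/4)"
  define \<rho> where "\<rho> = 1 / (2 * real m)"
  define c where "c = 1 / (1 - \<rho>)"
  have e: "e \<ge> 0" unfolding e_def by simp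
  have \<rho>: "0 < \<rho>" "\<rho> \<le> 1/2" unfolding \<rho>_def using m by (auto simp: field_simps)
  have c1: "c \<ge> 1" unfolding c_def using \<rho> by (simp add: field_simps)
  have HT: "finite T" "T \<subseteq> U" "card T = m" "\<theta> \<le> \<bar>f T\<bar>" if "T \<in> H" for T
    using H(1) lev_memb[OF U, of T m] that unfolding heavies_def by auto
  have fext: "finite (exts H Z)" "exts H Z \<subseteq> U" for Z
  proof -
    show "exts H Z \<subseteq> U" unfolding exts_def using HT(2) by auto
    then show "finite (exts H Z)" using U finite_subset by blast
  qed
  have ext: "D \<le> card (exts H Z)" if T: "T \<in> H" "Z \<subseteq> T" "finite Z" "card Z < m" for Z T
  proof -
    have "Z \<noteq> T" using T HT(3)[OF T(1)] by auto
    then obtain i where i: "i \<in> T" "i \<notin> Z" using T(2) by blast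
    have "{x. x \<notin> T - {i} \<and> insert x (T - {i}) \<in> H} \<subseteq> exts H Z"
    proof
      fix x assume "x \<in> {x. x \<notin> T - {i} \<and> insert x (T - {i}) \<in> H}"
      then have x: "x \<notin> T - {i}" "insert x (T - {i}) \<in> H" by auto
      have "Z \<subseteq> T - {i}" using T(2) i by blast
      then have "x \<notin> Z" "insert x Z \<subseteq> insert x (T - {i})" using x by auto
      then show "x \<in> exts H Z" unfolding exts_def using x(2) by blast
    qed
    then have "degree H (T - {i}) \<le> card (exts H Z)"
      unfolding degree_def by (intro card_mono fext)
    then show ?thesis using deg[OF T(1) i(1)] by linarith
  qed
  \<comment> \<open>Bernoulli's inequality gives \<open>(1 - 1 / (2 * m)) ^ m \<ge> 1/2\<close>.\<close>
  have cpow: "c ^ l \<le> 2" if "l \<le> m" for l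
  proof -
    have "c ^ l \<le> c ^ m" using c1 that by (intro power_increasing) auto
    also have "c ^ m = 1 / (1 - \<rho>) ^ m" unfolding c_def by (simp add: power_divide)
    also have "\<dots> \<le> 1 / (1/2)"
    proof (intro divide_left_mono)
      have "1 + real m * (- \<rho>) \<le> (1 + - \<rho>) ^ m" using \<rho> by (intro Bernoulli_inequality) auto
      then show "1/2 \<le> (1 - \<rho>) ^ m" unfolding \<rho>_def using m by simp
      show "0 < (1 - \<rho>) ^ m * (1/2)" using \<rho> by simp
    qed auto
    finally show ?thesis by simp
  qed
  define lt where "lt f Z = (of_bool (\<bar>f Z\<bar> < \<theta>) :: real)" for f :: "'a set \<Rightarrow> real" and Z
  have one: "pr U (\<lambda>\<xi>. \<bar>step U \<xi> g Z\<bar> < \<theta>) \<le>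
      c * ((\<Sum>x\<in>exts H Z. lt g (insert x Z)) / real (card (exts H Z))) + e"
    if T: "T \<in> H" "Z \<subseteq> T" "finite Z" "card Z < m" for T Z g
  proof -
    let ?E = "exts H Z"
    define s where "s = (\<Sum>x\<in>?E. lt g (insert x Z)) / real (card ?E)"
    have cE: "D \<le> card ?E" "0 < card ?E" using ext[OF T] D by linarith+
    show ?thesis
    proof (cases "1 - \<rho> \<le> s")
      case True
      then have "1 \<le> c * s" unfolding c_def using \<rho> by (simp add: field_simps)
      then show ?thesis using e pr_le_1[OF U, of "\<lambda>\<xi>. \<bar>step U \<xi> g Z\<bar> < \<theta>"] unfolding s_def by linarith
    next
      case False
      define a where "a x = (if x \<in> Z then 0 else g (insert x Z))" for x
      have ZU: "Z \<subseteq> U" using T HT(2) by blast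
      have st: "step U \<xi> g Z = (\<Sum>x\<in>U. \<xi> x * a x)" for \<xi>
        unfolding step_def a_def using U by (intro sum.mono_neutral_cong_left) auto
      have "real (card ?E) * (1 - s) = (\<Sum>x\<in>?E. 1 - lt g (insert x Z))"
        unfolding s_def using cE by (simp add: sum_subtractf right_diff_distrib)
      also have "\<dots> = (\<Sum>x\<in>?E. of_bool (\<theta> \<le> \<bar>a x\<bar>))"
        by (rule sum.cong[OF refl]) (auto simp: lt_def a_def exts_def)
      also have "\<dots> = real (card {x \<in> ?E. \<theta> \<le> \<bar>a x\<bar>})"
        using fext by (simp add: Int_def)
      also have "\<dots> \<le> real (card {x \<in> U. \<theta> \<le> \<bar>a x\<bar>})"
        using U fext(2)[of Z] by (intro of_nat_mono card_mono) auto
      finally have 1: "real (card ?E) * (1 - s) \<le> real (card {x \<in> U. \<theta> \<le> \<bar>a x\<bar>})" .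
      have "real (2 * m * h) \<le> real (card ?E)" using D cE by (intro of_nat_mono) linarith
      then have "real h \<le> real (card ?E) * \<rho>" unfolding \<rho>_def using m by (simp add: field_simps)
      also have "\<dots> \<le> real (card ?E) * (1 - s)" using False by (intro mult_left_mono) auto
      finally have "h \<le> card {x \<in> U. \<theta> \<le> \<bar>a x\<bar>}" using 1 by linarith
      then have "pr U (\<lambda>\<xi>. \<bar>\<Sum>x\<in>U. \<xi> x * a x\<bar> < \<theta>) \<le> e"
        unfolding e_def by (rule littlewood_offord[OF U \<theta>])
      moreover have "0 \<le> s" unfolding s_def lt_def by (intro divide_nonneg_nonneg sum_nonneg) auto
      then have "0 \<le> c * s" using c1 by simp
      ultimately show ?thesis unfolding st s_def by linarith
    qed
  qed
  have main: "light U \<theta> l g \<le> c ^ l * up_chain H l (lt g) + real l * (2 * e)" if "l \<le> m" for l g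
    using that
  proof (induction l arbitrary: g)
    case 0
    then show ?case by (simp add: lt_def)
  next
    case (Suc l)
    have "light U \<theta> (Suc l) g \<le> avg U (\<lambda>\<xi>. c ^ l * up_chain H l (lt (step U \<xi> g)) + real l * (2 * e))"
      unfolding light.simps using Suc by (intro avg_mono) auto
    also have "\<dots> = c ^ l * up_chain H l (\<lambda>Z. pr U (\<lambda>\<xi>. \<bar>step U \<xi> g Z\<bar> < \<theta>)) + real l * (2 * e)"
      using U by (simp only: avg_add avg_const avg_cmult avg_up_chain lt_def)
    also have "\<dots> \<le> c ^ l * up_chain H l (\<lambda>Z. c * ((\<Sum>x\<in>exts H Z. lt g (insert x Z)) / real (card (exts H Z))) + e)
        + real l * (2 * e)"
      using c1 Suc.prems by (intro add_right_mono mult_left_mono up_chain_mono H(2) one) auto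
    also have "up_chain H l (\<lambda>Z. c * ((\<Sum>x\<in>exts H Z. lt g (insert x Z)) / real (card (exts H Z))) + e)
        = c * up_chain H (Suc l) (lt g) + e"
      unfolding up_chain.simps
    proof (rule up_chain_affine[OF H(2)])
      fix Z T assume "T \<in> H" "Z \<subseteq> T" "finite Z" "card Z < l"
      then have "D \<le> card (exts H Z)" using Suc.prems by (intro ext[of T Z]) auto
      then show "0 < card (exts H Z)" using D by linarith
    qed
    also have "c ^ l * (c * up_chain H (Suc l) (lt g) + e) + real l * (2 * e)
        \<le> c ^ Suc l * up_chain H (Suc l) (lt g) + real (Suc l) * (2 * e)"
      using mult_right_mono[OF cpow[of l] e] Suc.prems by (simp add: algebra_simps)
    finally show ?case .
  qed
  have "up_chain H m (lt f) \<le> up_chain H m (\<lambda>Z. 0 * 0 + 0)"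
  proof (rule up_chain_mono[OF H(2)])
    fix Z T assume T: "T \<in> H" "Z \<subseteq> T" "card Z = m"
    then have "Z = T" using HT[OF T(1)] by (intro card_subset_eq) auto
    then show "lt f Z \<le> 0 * 0 + 0" using HT(4)[OF T(1)] by (simp add: lt_def)
  qed
  also have "\<dots> = 0 * up_chain H m (\<lambda>_. 0) + 0"
  proof (rule up_chain_affine[OF H(2)])
    fix Z T assume "T \<in> H" "Z \<subseteq> T" "finite Z" "card Z < m"
    then have "D \<le> card (exts H Z)" by (rule ext)
    then show "0 < card (exts H Z)" using D by linarith
  qed
  finally have "up_chain H m (lt f) \<le> 0" by simp
  then have "c ^ m * up_chain H m (lt f) \<le> 0" using c1 by (intro mult_nonneg_nonpos) auto
  then show ?thesis using main[of m f] unfolding e_def by simp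
qed

definition shadow :: "'a set set \<Rightarrow> 'a set set" where
  "shadow H = {T - {i} |T i. T \<in> H \<and> i \<in> T}"

lemma finite_shadow:
  assumes "finite H" "\<And>T. T \<in> H \<Longrightarrow> finite T"
  shows "finite (shadow H)"
proof -
  have "shadow H = (\<Union>T\<in>H. (\<lambda>i. T - {i}) ` T)" unfolding shadow_def by blast
  then show ?thesis using assms by simp
qed

text \<open>Remove repeatedly the fewer than \<open>D\<close> sets above a shadow set of small degree. Each round also removes that
set from the shadow, and the rounds end only when \<open>H\<close> is exhausted.\<close>

lemma card_le_shadow:
  assumes "finite H" "\<And>T. T \<in> H \<Longrightarrow> finite T"
    and "\<And>H'. H' \<subseteq> H \<Longrightarrow> H' \<noteq> {} \<Longrightarrow> \<exists>T\<in>H'. \<exists>i\<in>T. degree H' (T - {i}) < D"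
  shows "card H \<le> D * card (shadow H)"
  using assms
proof (induction H rule: finite_psubset_induct)
  case (psubset H)
  show ?case
  proof (cases "H = {}")
    case False
    obtain T i where T: "T \<in> H" "i \<in> T" "degree H (T - {i}) < D"
      using psubset.prems(2)[OF order_refl False] by blast
    define S where "S = T - {i}"
    define R where "R = {x. x \<notin> S \<and> insert x S \<in> H}"
    define K where "K = (\<lambda>x. insert x S) ` R"
    have iS: "insert i S = T" unfolding S_def using T(2) by auto
    then have TK: "T \<in> K" unfolding K_def R_def using T(1) by (intro image_eqI[of _ _ i]) (auto simp: S_def)
    have "inj_on (\<lambda>x. insert x S) R" unfolding R_def by (auto simp: inj_on_def insert_ident)
    moreover have "K \<subseteq> H" unfolding K_def R_def by auto
    ultimately have "finite R" using psubset.hyps unfolding K_def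
      by (intro finite_imageD[of "\<lambda>x. insert x S" R]) (auto intro: finite_subset)
    then have "card K \<le> card R" unfolding K_def by (rule card_image_le)
    then have K: "card K \<le> D" using T(3) unfolding degree_def R_def S_def by linarith
    have sub: "H - K \<subset> H" using TK T(1) by blast
    have IH: "card (H - K) \<le> D * card (shadow (H - K))"
    proof (rule psubset.IH[OF sub])
      show "finite T" if "T \<in> H - K" for T using that psubset.prems(1) by simp
      fix H' assume H': "H' \<subseteq> H - K" "H' \<noteq> {}"
      then have "H' \<subseteq> H" by blast
      then show "\<exists>T\<in>H'. \<exists>i\<in>T. degree H' (T - {i}) < D" using H'(2) by (rule psubset.prems(2))
    qed
    have fs: "finite (shadow H)" by (intro finite_shadow psubset)
    have "S \<notin> shadow (H - K)"
    proof
      assume "S \<in> shadow (H - K)"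
      then obtain T' i' where T': "T' \<in> H" "T' \<notin> K" "i' \<in> T'" "S = T' - {i'}" unfolding shadow_def by auto
      then have "T' = insert i' S" "i' \<notin> S" by auto
      then have "T' \<in> K" unfolding K_def R_def using T'(1) by auto
      then show False using T' by simp
    qed
    moreover have S: "S \<in> shadow H" unfolding shadow_def S_def using T by auto
    moreover have "shadow (H - K) \<subseteq> shadow H" unfolding shadow_def by auto
    ultimately have "shadow (H - K) \<subseteq> shadow H - {S}" by blast
    then have "card (shadow (H - K)) \<le> card (shadow H - {S})" using fs by (intro card_mono) auto
    then have c: "card (shadow (H - K)) + 1 \<le> card (shadow H)"
      using card_Suc_Diff1[OF fs S] by linarith
    have "card H = card (H - K) + card K"
      using card_Diff_subset[OF finite_subset[OF \<open>K \<subseteq> H\<close> psubset.hyps] \<open>K \<subseteq> H\<close>]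
        card_mono[OF psubset.hyps \<open>K \<subseteq> H\<close>] by linarith
    also have "\<dots> \<le> D * (card (shadow (H - K)) + 1)" using IH K by (simp add: algebra_simps)
    also have "\<dots> \<le> D * card (shadow H)" using c by (intro mult_left_mono) auto
    finally show ?thesis .
  qed simp
qed

text \<open>Each set of the shadow becomes heavy with probability at least \<open>1/2\<close>, because of the sign of the removed
element. These events may be strongly dependent, so nothing better than a constant is claimed.\<close>

lemma shadow_often_heavy:
  assumes U: "finite U" and H: "H \<subseteq> heavies U \<theta> (Suc k) f"
  shows "1/3 \<le> pr U (\<lambda>\<xi>. real (card (shadow H)) / 4 \<le> real (card (heavies U \<theta> k (step U \<xi> f))))"
proof -
  define N where "N = real (card (shadow H))"
  define Q where "Q \<xi> = (\<Sum>S\<in>shadow H. of_bool (\<theta> \<le> \<bar>step U \<xi> f S\<bar>) :: real)" for \<xi>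
  have HT: "finite T" "T \<subseteq> U" "card T = Suc k" "\<theta> \<le> \<bar>f T\<bar>" if "T \<in> H" for T
    using H lev_memb[OF U, of T "Suc k"] that unfolding heavies_def by auto
  have fH: "finite H" using H finite_heavies[OF U] finite_subset by blast
  have fs: "finite (shadow H)" by (intro finite_shadow fH HT)
  have half: "1/2 \<le> pr U (\<lambda>\<xi>. \<theta> \<le> \<bar>step U \<xi> f S\<bar>)" if S: "S \<in> shadow H" for S
  proof -
    obtain T i where T: "T \<in> H" "i \<in> T" "S = T - {i}" using S unfolding shadow_def by auto
    have iU: "i \<in> U" "i \<notin> S" "insert i S = T" using T HT by auto
    define V where "V = U - {i}"
    have V: "finite V" "i \<notin> V" "insert i V = U" unfolding V_def using U iU by auto
    have US: "U - S = insert i (V - S)" "i \<notin> V - S" "finite (V - S)" using V iU by auto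
    have st: "step U (\<xi>(i := s)) f S = s * f T + (\<Sum>x\<in>V - S. \<xi> x * f (insert x S))" for \<xi> s
    proof -
      have "(\<Sum>x\<in>V - S. (\<xi>(i := s)) x * f (insert x S)) = (\<Sum>x\<in>V - S. \<xi> x * f (insert x S))"
        using US by (intro sum.cong) auto
      then show ?thesis unfolding step_def US(1) using US iU by simp
    qed
    have "1/2 \<le> avg V (\<lambda>\<xi>. (of_bool (\<theta> \<le> \<bar>step U (\<xi>(i := 1)) f S\<bar>) + of_bool (\<theta> \<le> \<bar>step U (\<xi>(i := -1)) f S\<bar>)) / 2)"
    proof (rule avg_ge_const[OF V(1)])
      fix \<xi>
      have "\<theta> \<le> \<bar>step U (\<xi>(i := 1)) f S\<bar> \<or> \<theta> \<le> \<bar>step U (\<xi>(i := -1)) f S\<bar>"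
        unfolding st using HT(4)[OF T(1)] by linarith
      then show "1/2 \<le> (of_bool (\<theta> \<le> \<bar>step U (\<xi>(i := 1)) f S\<bar>) + of_bool (\<theta> \<le> \<bar>step U (\<xi>(i := -1)) f S\<bar>)) / (2::real)"
        by auto
    qed
    then show ?thesis using avg_insert[OF V(1,2), of "\<lambda>\<xi>. of_bool (\<theta> \<le> \<bar>step U \<xi> f S\<bar>)"] V(3) by simp
  qed
  have QH: "Q \<xi> \<le> real (card (heavies U \<theta> k (step U \<xi> f)))" for \<xi>
  proof -
    have "Q \<xi> = real (card {S \<in> shadow H. \<theta> \<le> \<bar>step U \<xi> f S\<bar>})"
      unfolding Q_def using fs by (simp add: Int_def)
    also have "\<dots> \<le> real (card (heavies U \<theta> k (step U \<xi> f)))"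
    proof (intro of_nat_mono card_mono finite_heavies[OF U] subsetI)
      fix S assume "S \<in> {S \<in> shadow H. \<theta> \<le> \<bar>step U \<xi> f S\<bar>}"
      then obtain T i where T: "T \<in> H" "i \<in> T" "S = T - {i}" "\<theta> \<le> \<bar>step U \<xi> f S\<bar>"
        unfolding shadow_def by auto
      then show "S \<in> heavies U \<theta> k (step U \<xi> f)"
        using HT[OF T(1)] unfolding heavies_def lev_def by auto
    qed
    finally show ?thesis .
  qed
  show ?thesis
  proof (cases "N = 0")
    case True
    then have "pr U (\<lambda>\<xi>. real (card (shadow H)) / 4 \<le> real (card (heavies U \<theta> k (step U \<xi> f)))) = pr U (\<lambda>\<xi>. True)"
      unfolding N_def by simp
    then show ?thesis by (simp add: avg_const[OF U])
  next
    case False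
    then have N: "N > 0" unfolding N_def by simp
    have "N * (1/2) \<le> (\<Sum>S\<in>shadow H. pr U (\<lambda>\<xi>. \<theta> \<le> \<bar>step U \<xi> f S\<bar>))"
      unfolding N_def by (rule sum_bounded_below) (rule half)
    also have "\<dots> = avg U Q" unfolding Q_def by (simp only: avg_sum)
    also have "\<dots> \<le> avg U (\<lambda>\<xi>. N / 4 + 3/4 * N * of_bool (N / 4 \<le> Q \<xi>))"
    proof (rule avg_mono)
      fix \<xi>
      have "Q \<xi> \<le> N" unfolding Q_def N_def using sum_bounded_above[of "shadow H" "\<lambda>S. of_bool (\<theta> \<le> \<bar>step U \<xi> f S\<bar>)" "1::real"] by simp
      then show "Q \<xi> \<le> N / 4 + 3/4 * N * of_bool (N / 4 \<le> Q \<xi>)" by auto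
    qed
    also have "\<dots> = N / 4 + 3/4 * N * pr U (\<lambda>\<xi>. N / 4 \<le> Q \<xi>)"
      by (simp only: avg_add avg_const[OF U] avg_cmult)
    finally have "N * (1/3) \<le> N * pr U (\<lambda>\<xi>. N / 4 \<le> Q \<xi>)" by simp
    then have "1/3 \<le> pr U (\<lambda>\<xi>. N / 4 \<le> Q \<xi>)" using N by (simp only: mult_le_cancel_left_pos)
    also have "\<dots> \<le> pr U (\<lambda>\<xi>. real (card (shadow H)) / 4 \<le> real (card (heavies U \<theta> k (step U \<xi> f))))"
      unfolding N_def by (rule pr_mono) (use QH order_trans in blast)
    finally show ?thesis .
  qed
qed

section \<open>From one heavy set to the permanent\<close>

text \<open>The logarithm of \<open>Y\<close>, where \<open>Y ^ m = N * m!\<close> for the number \<open>N\<close> of heavy sets. For all \<open>m\<close>-subsets of a set of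
\<open>u\<close> columns \<open>Y\<close> is the geometric mean of \<open>u - m + 1, \<dots>, u\<close>; it does not depend much on \<open>m\<close>.\<close>

definition log_base :: "'a set \<Rightarrow> real \<Rightarrow> nat \<Rightarrow> ('a set \<Rightarrow> real) \<Rightarrow> real" where
  "log_base U \<theta> m f = ln (real (card (heavies U \<theta> m f)) * fact m) / real m"

definition hsum :: "nat \<Rightarrow> real" where
  "hsum m = (\<Sum>j\<in>{1..<m}. 1 / real j)"

lemma hsum_Suc: "1 \<le> m \<Longrightarrow> hsum (Suc m) = hsum m + 1 / real m"
  unfolding hsum_def by simp

lemma hsum_mono: "m \<le> m' \<Longrightarrow> hsum m \<le> hsum m'"
  unfolding hsum_def by (intro sum_mono2) auto

lemma log_base_le:
  assumes U: "finite U" and "1 \<le> m" "heavies U \<theta> m f \<noteq> {}"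
  shows "0 \<le> log_base U \<theta> m f" "log_base U \<theta> m f \<le> ln (real (card U))" "1 \<le> card U"
proof -
  let ?H = "heavies U \<theta> m f"
  have c: "1 \<le> card ?H" using assms finite_heavies[OF U] by (simp add: Suc_le_eq card_gt_0_iff)
  have f1: "1 * 1 \<le> real (card ?H) * fact m" using c by (intro mult_mono) auto
  show "0 \<le> log_base U \<theta> m f" unfolding log_base_def using f1 by simp
  obtain T where T: "T \<in> lev U m" using assms(3) unfolding heavies_def by auto
  have mU: "m \<le> card U" using lev_memb[OF U T] card_mono[OF U, of T] by auto
  then show n: "1 \<le> card U" using assms(2) by linarith
  have "card ?H \<le> card (lev U m)"
    unfolding heavies_def by (intro card_mono finite_lev[OF U]) auto
  also have "card (lev U m) = card U choose m"
    unfolding lev_def by (rule n_subsets[OF U])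
  finally have "card ?H * fact m \<le> (card U choose m) * fact m" by simp
  also have "\<dots> \<le> card U ^ m" using binomial_fact_pow by simp
  finally have "real (card ?H * fact m) \<le> real (card U ^ m)" by (simp only: of_nat_le_iff)
  then have "ln (real (card ?H) * fact m) \<le> ln (real (card U) ^ m)"
    using f1 n by (subst ln_le_cancel_iff) auto
  also have "\<dots> = real m * ln (real (card U))" using n by (simp add: ln_realpow)
  finally show "log_base U \<theta> m f \<le> ln (real (card U))"
    unfolding log_base_def using assms(2) by (simp add: divide_le_eq mult.commute)
qed

lemma log_base_ge:
  assumes U: "finite U" and k: "1 \<le> k" and N: "0 < N" "N \<le> real (card (heavies U \<theta> k f))"
  shows "heavies U \<theta> k f \<noteq> {}" "ln (N * fact k) / real k \<le> log_base U \<theta> k f"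
proof -
  show "heavies U \<theta> k f \<noteq> {}" using N by auto
  have "ln (N * fact k) \<le> ln (real (card (heavies U \<theta> k f)) * fact k)"
    using N by (subst ln_le_cancel_iff) auto
  then show "ln (N * fact k) / real k \<le> log_base U \<theta> k f"
    unfolding log_base_def by (intro divide_right_mono) auto
qed

definition steady :: "'a set \<Rightarrow> real \<Rightarrow> nat \<Rightarrow> ('a set \<Rightarrow> real) \<Rightarrow> ('a \<Rightarrow> real) \<Rightarrow> bool" where
  "steady U \<theta> k f \<xi> \<longleftrightarrow> heavies U \<theta> k (step U \<xi> f) \<noteq> {} \<and>
    log_base U \<theta> (Suc k) f - 4/5 / real k \<le> log_base U \<theta> k (step U \<xi> f)"

lemma not_steady_unlikely:
  assumes U: "finite U" and k: "1 \<le> k" and ne: "heavies U \<theta> (Suc k) f \<noteq> {}"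
  shows "pr U (\<lambda>\<xi>. \<not> steady U \<theta> k f \<xi>) \<le> 20 * exp (- (real (Suc k) / (7500 * (1 + ln (real (card U))))))"
proof -
  define N where "N = real (card (heavies U \<theta> (Suc k) f))"
  define L where "L = log_base U \<theta> (Suc k) f"
  define N' where "N' = exp (-4/5) * real (Suc k) * N * exp (- L)"
  have N: "N > 0" unfolding N_def using ne finite_heavies[OF U] by (simp add: card_gt_0_iff)
  then have N'0: "N' > 0" unfolding N'_def by simp
  have LN: "ln (N * fact (Suc k)) = real (Suc k) * L" unfolding L_def log_base_def N_def by simp
  have "N' * fact k = exp (-4/5) * (N * fact (Suc k)) * exp (- L)" unfolding N'_def by simp
  then have "ln (N' * fact k) = -4/5 + ln (N * fact (Suc k)) + (- L)"
    using N by (simp add: ln_mult del: fact_Suc)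
  also have "\<dots> = real k * L - 4/5" unfolding LN by (simp add: algebra_simps)
  finally have lnN': "ln (N' * fact k) / real k = L - 4/5 / real k" using k by (simp add: field_simps)
  have "pr U (\<lambda>\<xi>. \<not> steady U \<theta> k f \<xi>) \<le> pr U (\<lambda>\<xi>. real (card (heavies U \<theta> k (step U \<xi> f))) < N')"
  proof (rule pr_mono, rule ccontr)
    fix \<xi> assume ns: "\<not> steady U \<theta> k f \<xi>" and "\<not> real (card (heavies U \<theta> k (step U \<xi> f))) < N'"
    then have "N' \<le> real (card (heavies U \<theta> k (step U \<xi> f)))" by simp
    from log_base_ge[OF U k N'0 this] show False using ns unfolding lnN' L_def steady_def by simp
  qed
  also have "\<dots> \<le> 20 * exp (- (real (Suc k) / (7500 * (1 + ln (real (card U))))))"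
    unfolding N'_def N_def L_def log_base_def by (rule heavies_drop[OF U ne])
  finally show ?thesis .
qed

lemma exp_mix_bound:
  fixes a r :: real
  assumes "0 < a" "a \<le> 1" "a * r \<le> 1" "13 \<le> r" "1/3 \<le> p" "p \<le> 1"
  shows "p * exp (- (a * r)) + (1 - p) * exp (4/5 * a) \<le> exp (- (a * r / 12))"
proof -
  have r: "0 \<le> a * r" using assms by simp
  have "exp (- (a * r)) \<le> 1 / (1 + a * r)"
    using exp_ge_add_one_self[of "a * r"] r by (simp add: exp_minus divide_inverse le_imp_inverse_le)
  also have "\<dots> \<le> 1 - a * r / 2"
  proof -
    have "(a * r) * (a * r) \<le> (a * r) * 1" using r assms by (intro mult_left_mono) auto
    then have "1 \<le> (1 - a * r / 2) * (1 + a * r)" by (simp add: algebra_simps)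
    then show ?thesis using r by (simp add: divide_le_eq)
  qed
  finally have 1: "exp (- (a * r)) \<le> 1 - a * r / 2" .
  have "exp (4/5 * a) \<le> 1 + 4/5 * a + (4/5 * a)\<^sup>2" using assms by (intro exp_bound) auto
  also have "(4/5 * a)\<^sup>2 \<le> 4/5 * a"
    unfolding power2_eq_square using assms by (intro mult_left_le_one_le) auto
  finally have 2: "exp (4/5 * a) \<le> 1 + 8/5 * a" by simp
  have "- (a * r) \<le> 4/5 * a" using r assms(1) by linarith
  then have le: "exp (- (a * r)) \<le> exp (4/5 * a)" by (simp only: exp_le_cancel_iff)
  have "p * exp (- (a * r)) + (1 - p) * exp (4/5 * a) = exp (4/5 * a) - p * (exp (4/5 * a) - exp (- (a * r)))"
    by (simp add: algebra_simps)
  also have "\<dots> \<le> exp (4/5 * a) - 1/3 * (exp (4/5 * a) - exp (- (a * r)))"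
    using le assms by (intro diff_left_mono mult_right_mono) auto
  also have "\<dots> \<le> 1 + 16/15 * a - a * r / 6"
  proof -
    have "e - 1/3 * (e - x) \<le> 1 + 16/15 * a - z / 6" if "x \<le> 1 - z / 2" "e \<le> 1 + 8/5 * a" for e x z :: real
      using that by (simp add: field_simps)
    from this[OF 1 2] show ?thesis .
  qed
  also have "\<dots> \<le> 1 + - (a * r / 12)"
  proof -
    have "a * 13 \<le> a * r" using assms by (intro mult_left_mono) auto
    then show ?thesis using assms(1) by linarith
  qed
  also have "\<dots> \<le> exp (- (a * r / 12))" by (rule exp_ge_add_one_self)
  finally show ?thesis .
qed

text \<open>With \<open>a = 1 / k\<close>, the factor for \<open>1 / Y\<close> is \<open>exp (- (a * r))\<close> with probability at least \<open>1/3\<close> and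
at most \<open>exp (4/5 * a)\<close> otherwise. For \<open>r \<ge> 13\<close> the first outweighs the second on average.\<close>

lemma growth_step:
  fixes f :: "'a set \<Rightarrow> real"
  assumes U: "finite U" and k: "1 \<le> k" and ne: "heavies U \<theta> (Suc k) f \<noteq> {}"
    and D: "1 \<le> D"
    and nocore: "\<And>H'. H' \<subseteq> heavies U \<theta> (Suc k) f \<Longrightarrow> H' \<noteq> {} \<Longrightarrow> \<exists>T\<in>H'. \<exists>i\<in>T. degree H' (T - {i}) < D"
    and r: "13 \<le> r" "r \<le> real k" "ln (4 * real (Suc k) * real D) + r \<le> log_base U \<theta> (Suc k) f"
  shows "avg U (\<lambda>\<xi>. of_bool (steady U \<theta> k f \<xi>) * exp (- log_base U \<theta> k (step U \<xi> f)))
    \<le> exp (- log_base U \<theta> (Suc k) f - r / 12 / real k)"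
proof -
  define H where "H = heavies U \<theta> (Suc k) f"
  define N where "N = real (card H)"
  define L where "L = log_base U \<theta> (Suc k) f"
  define G where "G \<xi> \<longleftrightarrow> real (card (shadow H)) / 4 \<le> real (card (heavies U \<theta> k (step U \<xi> f)))" for \<xi>
  have fH: "finite H" unfolding H_def by (rule finite_heavies[OF U])
  have N: "N > 0" unfolding N_def using ne fH by (simp add: H_def card_gt_0_iff)
  have "card H \<le> D * card (shadow H)"
  proof (rule card_le_shadow[OF fH])
    show "finite T" if "T \<in> H" for T
      using that lev_memb[OF U, of T "Suc k"] unfolding H_def heavies_def by auto
  qed (use nocore in \<open>simp add: H_def\<close>)
  then have "N \<le> real (D * card (shadow H))" unfolding N_def by (simp only: of_nat_le_iff)
  then have sh: "N / (4 * real D) \<le> real (card (shadow H)) / 4" using D by (simp add: field_simps)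
  have LN: "ln (N * fact (Suc k)) = real (Suc k) * L" unfolding L_def log_base_def N_def H_def by simp
  have grow: "L + r / real k \<le> log_base U \<theta> k (step U \<xi> f)" if "G \<xi>" for \<xi>
  proof -
    have n: "0 < N / (4 * real D)" "N / (4 * real D) \<le> real (card (heavies U \<theta> k (step U \<xi> f)))"
      using N D sh that unfolding G_def by auto
    have cancel: "N / (4 * d) * F = (N * (s * F)) / (4 * s * d)" if "s \<noteq> 0" for s F d :: real
      using that by simp
    have "N / (4 * real D) * fact k = (N * fact (Suc k)) / (4 * real (Suc k) * real D)"
      unfolding fact_Suc by (rule cancel) simp
    then have "ln (N / (4 * real D) * fact k) = real (Suc k) * L - ln (4 * real (Suc k) * real D)"
      using N D LN by (simp add: ln_div del: fact_Suc)
    also have "\<dots> \<ge> real k * L + r" using r(3) unfolding L_def[symmetric] by (simp add: algebra_simps)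
    finally have "(real k * L + r) / real k \<le> ln (N / (4 * real D) * fact k) / real k"
      by (intro divide_right_mono) auto
    also have "\<dots> \<le> log_base U \<theta> k (step U \<xi> f)" by (rule log_base_ge(2)[OF U k n])
    finally show ?thesis using k by (simp add: add_divide_distrib)
  qed
  define a where "a = 1 / real k"
  have a: "0 < a" "a \<le> 1" "a * r \<le> 1" unfolding a_def using k r by (auto simp: field_simps)
  define p where "p = pr U G"
  have p: "1/3 \<le> p" "p \<le> 1"
    unfolding p_def G_def using shadow_often_heavy[OF U, of H \<theta> k f] pr_le_1[OF U] by (auto simp: H_def)
  have "avg U (\<lambda>\<xi>. of_bool (steady U \<theta> k f \<xi>) * exp (- log_base U \<theta> k (step U \<xi> f)))
      \<le> avg U (\<lambda>\<xi>. exp (- L) * (exp (4/5 * a) + of_bool (G \<xi>) * (exp (- (a * r)) - exp (4/5 * a))))"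
  proof (rule avg_mono)
    fix \<xi>
    show "of_bool (steady U \<theta> k f \<xi>) * exp (- log_base U \<theta> k (step U \<xi> f))
      \<le> exp (- L) * (exp (4/5 * a) + of_bool (G \<xi>) * (exp (- (a * r)) - exp (4/5 * a)))"
    proof (cases "G \<xi>")
      case True
      have "exp (- log_base U \<theta> k (step U \<xi> f)) \<le> exp (- L + - (a * r))"
        using grow[OF True] unfolding a_def by simp
      then show ?thesis using True unfolding exp_add by (auto simp: of_bool_def)
    next
      case False
      show ?thesis
      proof (cases "steady U \<theta> k f \<xi>")
        case True
        then have "exp (- log_base U \<theta> k (step U \<xi> f)) \<le> exp (- L + 4/5 * a)"
          unfolding a_def L_def steady_def by simp
        then show ?thesis using True False unfolding exp_add by simp
      qed (use False in simp)
    qed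
  qed
  also have "\<dots> = exp (- L) * (exp (4/5 * a) + p * (exp (- (a * r)) - exp (4/5 * a)))"
    unfolding p_def by (simp only: avg_cmult avg_add avg_const[OF U] avg_cmult_right)
  also have "\<dots> = exp (- L) * (p * exp (- (a * r)) + (1 - p) * exp (4/5 * a))"
    by (simp add: algebra_simps)
  also have "\<dots> \<le> exp (- L) * exp (- (a * r / 12))"
    by (intro mult_left_mono exp_mix_bound a r p) simp
  also have "\<dots> = exp (- L - r / 12 / real k)" unfolding exp_add[symmetric] a_def by simp
  finally show ?thesis unfolding L_def .
qed

text \<open>Induction with a potential that is \<open>card U / Y\<close> at the level \<open>m1\<close>, where it is at least \<open>1\<close>. In each step either a
family of large degrees is present, and then the assumption \<open>core\<close> ends the argument, or the mean
of the potential shrinks by \<open>growth_step\<close>. The lower bound for \<open>log_base\<close> guarantees enough room for the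
growth; it survives the rows because \<open>hsum\<close> adds up the possible losses.\<close>

lemma growth_phase:
  fixes U :: "'a set"
  assumes U: "finite U" and D: "1 \<le> D" and m1: "1 \<le> m1"
    and core: "\<And>m f H'. m \<le> M \<Longrightarrow> 1 \<le> m \<Longrightarrow> H' \<subseteq> heavies U \<theta> m f \<Longrightarrow> H' \<noteq> {} \<Longrightarrow>
      (\<And>T i. T \<in> H' \<Longrightarrow> i \<in> T \<Longrightarrow> D \<le> degree H' (T - {i})) \<Longrightarrow> light U \<theta> m f \<le> \<kappa>"
    and \<kappa>: "0 \<le> \<kappa>" and q: "20 * exp (- (real m1 / (7500 * (1 + ln (real (card U)))))) \<le> q"
    and r: "13 \<le> r" "r \<le> real m1" "ln (4 * real M * real D) + r \<le> y"
  shows "m1 + k \<le> M \<Longrightarrow> heavies U \<theta> (m1 + k) f \<noteq> {} \<Longrightarrow>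
    y + 4/5 * hsum (m1 + k) \<le> log_base U \<theta> (m1 + k) f \<Longrightarrow>
    light U \<theta> (m1 + k) f \<le> \<kappa> + real k * q +
      real (card U) * exp (- log_base U \<theta> (m1 + k) f - r / 12 * (hsum (m1 + k) - hsum m1))"
proof (induction k arbitrary: f)
  case 0
  have "log_base U \<theta> m1 f \<le> ln (real (card U))" "1 \<le> card U"
    using log_base_le[OF U m1, of \<theta> f] 0 by auto
  then have "exp (ln (real (card U))) * exp (- ln (real (card U))) \<le> real (card U) * exp (- log_base U \<theta> m1 f)"
    by (intro mult_mono) auto
  then have "1 \<le> real (card U) * exp (- log_base U \<theta> m1 f)" by (simp add: exp_add[symmetric])
  then show ?case using light_le_1[OF U, of \<theta> m1 f] \<kappa> by simp
next
  case (Suc k)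
  define m where "m = m1 + k"
  define n where "n = real (card U)"
  define L where "L = log_base U \<theta> (Suc m) f"
  define h where "h = hsum m - hsum m1"
  have m: "1 \<le> m" "m1 \<le> m" "Suc m \<le> M" using Suc.prems m1 unfolding m_def by auto
  have ne: "heavies U \<theta> (Suc m) f \<noteq> {}" and yL: "y + 4/5 * hsum (Suc m) \<le> L"
    using Suc.prems unfolding m_def L_def by auto
  have q0: "0 \<le> q" by (rule order_trans[OF _ q]) simp
  show ?case
  proof (cases "\<exists>H'\<subseteq>heavies U \<theta> (Suc m) f. H' \<noteq> {} \<and> (\<forall>T\<in>H'. \<forall>i\<in>T. D \<le> degree H' (T - {i}))")
    case True
    then obtain H' where H': "H' \<subseteq> heavies U \<theta> (Suc m) f" "H' \<noteq> {}"
      "\<And>T i. T \<in> H' \<Longrightarrow> i \<in> T \<Longrightarrow> D \<le> degree H' (T - {i})" by blast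
    have "light U \<theta> (Suc m) f \<le> \<kappa>" by (rule core[OF m(3) _ H']) simp_all
    moreover have "0 \<le> real (Suc k) * q" "0 \<le> n * exp (- L - r / 12 * (hsum (Suc m) - hsum m1))"
      using q0 unfolding n_def by auto
    ultimately have "light U \<theta> (Suc m) f \<le> \<kappa> + real (Suc k) * q + n * exp (- L - r / 12 * (hsum (Suc m) - hsum m1))"
      by linarith
    then show ?thesis unfolding m_def n_def L_def by (simp only: add_Suc_right)
  next
    case False
    then have nocore: "\<exists>T\<in>H'. \<exists>i\<in>T. degree H' (T - {i}) < D"
      if "H' \<subseteq> heavies U \<theta> (Suc m) f" "H' \<noteq> {}" for H'
      using that by (auto simp: not_le)
    have h0: "0 \<le> hsum (Suc m)" unfolding hsum_def by (intro sum_nonneg) auto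
    have "ln (4 * real (Suc m) * real D) \<le> ln (4 * real M * real D)"
      using m D by (subst ln_le_cancel_iff) auto
    then have r3: "ln (4 * real (Suc m) * real D) + r \<le> log_base U \<theta> (Suc m) f"
      using r(3) yL h0 unfolding L_def by linarith
    have r2: "r \<le> real m" using r(2) m by linarith
    note gs = growth_step[OF U m(1) ne D nocore r(1) r2 r3]
    have "light U \<theta> (Suc m) f \<le> avg U (\<lambda>\<xi>. of_bool (\<not> steady U \<theta> m f \<xi>) + ((\<kappa> + real k * q) +
        (n * exp (- (r / 12 * h))) * (of_bool (steady U \<theta> m f \<xi>) * exp (- log_base U \<theta> m (step U \<xi> f)))))"
      unfolding light.simps
    proof (rule avg_mono)
      fix \<xi>
      show "light U \<theta> m (step U \<xi> f) \<le> of_bool (\<not> steady U \<theta> m f \<xi>) + ((\<kappa> + real k * q) +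
        (n * exp (- (r / 12 * h))) * (of_bool (steady U \<theta> m f \<xi>) * exp (- log_base U \<theta> m (step U \<xi> f))))"
      proof (cases "steady U \<theta> m f \<xi>")
        case True
        have "log_base U \<theta> (Suc m) f - 4/5 / real m \<le> log_base U \<theta> m (step U \<xi> f)" using True unfolding steady_def by blast
        moreover have "4/5 * hsum (Suc m) = 4/5 * hsum m + 4/5 / real m"
          unfolding hsum_Suc[OF m(1)] by (simp add: distrib_left)
        ultimately have "y + 4/5 * hsum m \<le> log_base U \<theta> m (step U \<xi> f)"
          using yL unfolding L_def by linarith
        then have "light U \<theta> m (step U \<xi> f) \<le> \<kappa> + real k * q +
            n * exp (- log_base U \<theta> m (step U \<xi> f) - r / 12 * h)"
          unfolding m_def n_def h_def using True m by (intro Suc.IH) (auto simp: m_def steady_def)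
        also have "exp (- log_base U \<theta> m (step U \<xi> f) - r / 12 * h)
            = exp (- (r / 12 * h)) * exp (- log_base U \<theta> m (step U \<xi> f))"
          by (simp add: exp_add[symmetric])
        finally show ?thesis using True by simp
      next
        case False
        have "0 \<le> \<kappa> + real k * q" using \<kappa> q0 by simp
        then show ?thesis using False light_le_1[OF U, of \<theta> m "step U \<xi> f"] by simp
      qed
    qed
    also have "\<dots> = pr U (\<lambda>\<xi>. \<not> steady U \<theta> m f \<xi>) + ((\<kappa> + real k * q) + (n * exp (- (r / 12 * h))) *
        avg U (\<lambda>\<xi>. of_bool (steady U \<theta> m f \<xi>) * exp (- log_base U \<theta> m (step U \<xi> f))))"
      by (simp only: avg_add avg_const[OF U] avg_cmult)
    also have "\<dots> \<le> q + ((\<kappa> + real k * q) + (n * exp (- (r / 12 * h))) * exp (- L - r / 12 / real m))"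
    proof (intro add_mono mult_left_mono order_refl)
      have "pr U (\<lambda>\<xi>. \<not> steady U \<theta> m f \<xi>) \<le> 20 * exp (- (real (Suc m) / (7500 * (1 + ln (real (card U))))))"
        by (rule not_steady_unlikely[OF U m(1) ne])
      also have "\<dots> \<le> 20 * exp (- (real m1 / (7500 * (1 + ln (real (card U))))))"
        using log_base_le(3)[OF U _ ne] m by (intro mult_left_mono) (auto intro!: divide_right_mono)
      finally show "pr U (\<lambda>\<xi>. \<not> steady U \<theta> m f \<xi>) \<le> q" using q by linarith
    qed (use gs in \<open>auto simp: L_def n_def\<close>)
    also have "(n * exp (- (r / 12 * h))) * exp (- L - r / 12 / real m)
        = n * exp (- L - r / 12 * (hsum (Suc m) - hsum m1))"
    proof -
      have "- (r / 12 * h) + (- L - r / 12 / real m) = - L - r / 12 * (hsum (Suc m) - hsum m1)"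
      proof -
        have "hsum (Suc m) - hsum m1 = h + 1 / real m" unfolding hsum_Suc[OF m(1)] h_def by simp
        then show ?thesis by (simp add: distrib_left)
      qed
      then show ?thesis by (simp add: exp_add[symmetric])
    qed
    finally show ?thesis unfolding m_def n_def L_def by (simp add: algebra_simps)
  qed
qed

text \<open>In this range it is enough that no row fails: \<open>Y\<close> stays large, and nothing has to be gained.\<close>

lemma steady_phase:
  fixes U :: "'a set"
  assumes U: "finite U" and M: "1 \<le> M"
    and q: "20 * exp (- (real M / (7500 * (1 + ln (real (card U)))))) \<le> q" and \<kappa>: "0 \<le> \<kappa>"
    and start: "\<And>f. heavies U \<theta> M f \<noteq> {} \<Longrightarrow> y + 4/5 * hsum M \<le> log_base U \<theta> M f \<Longrightarrow> light U \<theta> M f \<le> \<kappa>"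
  shows "heavies U \<theta> (M + k) f \<noteq> {} \<Longrightarrow> y + 4/5 * hsum (M + k) \<le> log_base U \<theta> (M + k) f \<Longrightarrow>
    light U \<theta> (M + k) f \<le> \<kappa> + real k * q"
proof (induction k arbitrary: f)
  case 0
  then show ?case using start by simp
next
  case (Suc k)
  define m where "m = M + k"
  have m: "1 \<le> m" "M \<le> m" unfolding m_def using M by auto
  have ne: "heavies U \<theta> (Suc m) f \<noteq> {}" and yL: "y + 4/5 * hsum (Suc m) \<le> log_base U \<theta> (Suc m) f"
    using Suc.prems unfolding m_def by auto
  have q0: "0 \<le> q" by (rule order_trans[OF _ q]) simp
  have "light U \<theta> (Suc m) f \<le> avg U (\<lambda>\<xi>. of_bool (\<not> steady U \<theta> m f \<xi>) + (\<kappa> + real k * q))"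
    unfolding light.simps
  proof (rule avg_mono)
    fix \<xi>
    show "light U \<theta> m (step U \<xi> f) \<le> of_bool (\<not> steady U \<theta> m f \<xi>) + (\<kappa> + real k * q)"
    proof (cases "steady U \<theta> m f \<xi>")
      case True
      have "log_base U \<theta> (Suc m) f - 4/5 / real m \<le> log_base U \<theta> m (step U \<xi> f)" using True unfolding steady_def by blast
      moreover have "4/5 * hsum (Suc m) = 4/5 * hsum m + 4/5 / real m"
        unfolding hsum_Suc[OF m(1)] by (simp add: distrib_left)
      ultimately have "y + 4/5 * hsum m \<le> log_base U \<theta> m (step U \<xi> f)"
        using yL by linarith
      then show ?thesis using Suc.IH[of "step U \<xi> f"] True unfolding m_def steady_def by simp
    next
      case False
      have "0 \<le> \<kappa> + real k * q" using \<kappa> q0 by simp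
      then show ?thesis using False light_le_1[OF U, of \<theta> m "step U \<xi> f"] by simp
    qed
  qed
  also have "\<dots> = pr U (\<lambda>\<xi>. \<not> steady U \<theta> m f \<xi>) + (\<kappa> + real k * q)"
    by (simp only: avg_add avg_const[OF U])
  also have "pr U (\<lambda>\<xi>. \<not> steady U \<theta> m f \<xi>) \<le> 20 * exp (- (real (Suc m) / (7500 * (1 + ln (real (card U))))))"
    by (rule not_steady_unlikely[OF U m(1) ne])
  also have "\<dots> \<le> 20 * exp (- (real M / (7500 * (1 + ln (real (card U))))))"
    using log_base_le(3)[OF U _ ne] m by (intro mult_left_mono) (auto intro!: divide_right_mono)
  also have "\<dots> \<le> q" by (rule q)
  finally show ?case unfolding m_def by (simp add: algebra_simps)
qed

section \<open>The permanent as the last state\<close>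

primrec last_state :: "'a set \<Rightarrow> (nat \<Rightarrow> 'a \<Rightarrow> real) \<Rightarrow> nat \<Rightarrow> ('a set \<Rightarrow> real) \<Rightarrow> real" where
  "last_state U r 0 f = f {}"
| "last_state U r (Suc m) f = last_state U r m (step U (r (Suc m)) f)"

text \<open>A list that orders \<open>T\<close> assigns its \<open>j\<close>-th entry to the row \<open>m - j\<close>; so the sum is the permanent of the rows
\<open>1, \<dots>, m\<close> on the columns \<open>T\<close>, in the order in which the rows are revealed.\<close>

definition ordering_sum :: "(nat \<Rightarrow> 'a \<Rightarrow> real) \<Rightarrow> nat \<Rightarrow> 'a set \<Rightarrow> real" where
  "ordering_sum r m T = (\<Sum>xs\<in>permutations_of_set T. \<Prod>j<m. r (m - j) (xs ! j))"

lemma last_state_cong: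
  "(\<And>i. 1 \<le> i \<Longrightarrow> i \<le> m \<Longrightarrow> r i = r' i) \<Longrightarrow> last_state U r m f = last_state U r' m f"
proof (induction m arbitrary: f)
  case (Suc m)
  have "r (Suc m) = r' (Suc m)" by (rule Suc.prems) auto
  moreover have "last_state U r m g = last_state U r' m g" for g
    by (rule Suc.IH) (auto intro: Suc.prems)
  ultimately show ?case by simp
qed simp

lemma ordering_sum_Suc:
  assumes "finite T" "T \<noteq> {}"
  shows "ordering_sum r (Suc m) T = (\<Sum>x\<in>T. r (Suc m) x * ordering_sum r m (T - {x}))"
proof -
  have "ordering_sum r (Suc m) T
      = (\<Sum>x\<in>T. \<Sum>xs\<in>(#) x ` permutations_of_set (T - {x}). \<Prod>j<Suc m. r (Suc m - j) (xs ! j))"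
    unfolding ordering_sum_def permutations_of_set_nonempty[OF assms(2)]
    by (rule sum.UNION_disjoint) (use assms in auto)
  also have "\<dots> = (\<Sum>x\<in>T. \<Sum>xs\<in>permutations_of_set (T - {x}). \<Prod>j<Suc m. r (Suc m - j) ((x # xs) ! j))"
    by (rule sum.cong[OF refl], subst sum.reindex) (auto simp: o_def)
  also have "\<dots> = (\<Sum>x\<in>T. \<Sum>xs\<in>permutations_of_set (T - {x}). r (Suc m) x * (\<Prod>j<m. r (m - j) (xs ! j)))"
    by (simp only: prod.lessThan_Suc_shift) simp
  finally show ?thesis unfolding ordering_sum_def by (simp only: sum_distrib_left)
qed

lemma last_state_eq:
  assumes "finite U"
  shows "last_state U r m f = (\<Sum>T\<in>lev U m. f T * ordering_sum r m T)"
proof (induction m arbitrary: f)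
  case 0
  have "T = {}" if "T \<in> lev U 0" for T using lev_memb[OF assms that] by auto
  then have "lev U 0 = {{}}" by (auto simp: lev_def)
  then show ?case by (simp add: ordering_sum_def)
next
  case (Suc m)
  have "last_state U r (Suc m) f
      = (\<Sum>T'\<in>lev U m. \<Sum>x\<in>U - T'. f (insert x T') * (r (Suc m) x * ordering_sum r m (insert x T' - {x})))"
    by (simp add: Suc.IH step_def sum_distrib_left mult_ac)
  also have "\<dots> = (\<Sum>T\<in>lev U (Suc m). \<Sum>x\<in>T. f T * (r (Suc m) x * ordering_sum r m (T - {x})))"
    by (rule sum_lev_pairs[OF assms, symmetric])
  also have "\<dots> = (\<Sum>T\<in>lev U (Suc m). f T * ordering_sum r (Suc m) T)"
  proof (rule sum.cong[OF refl])
    fix T assume "T \<in> lev U (Suc m)"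
    then have "finite T" "card T = Suc m" using lev_memb[OF assms] by blast+
    then have "finite T" "T \<noteq> {}" by auto
    then show "(\<Sum>x\<in>T. f T * (r (Suc m) x * ordering_sum r m (T - {x}))) = f T * ordering_sum r (Suc m) T"
      by (simp add: ordering_sum_Suc sum_distrib_left)
  qed
  finally show ?case .
qed

lemma permanent_eq_ordering_sum:
  "permanent n A = ordering_sum (\<lambda>i x. A (i, x)) n {1..n}"
proof -
  define xs where "xs = map (\<lambda>j. n - j) [0..<n]"
  have len: "length xs = n" and nth: "\<And>j. j < n \<Longrightarrow> xs ! j = n - j" unfolding xs_def by auto
  have set: "set xs = {1..n}"
  proof (intro equalityI subsetI)
    fix i assume i: "i \<in> {1..n}"
    then have "n - (n - i) = i" by auto
    then show "i \<in> set xs" unfolding xs_def using i by (force intro!: image_eqI[of _ _ "n - i"])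
  qed (auto simp: xs_def)
  have dist: "distinct xs" unfolding xs_def by (auto simp: distinct_map inj_on_def)
  let ?P = "{\<sigma>. \<sigma> permutes {1..n}}"
  have inj: "inj_on (\<lambda>\<sigma>. map \<sigma> xs) ?P"
  proof (rule inj_onI)
    fix \<sigma> \<tau> assume *: "\<sigma> \<in> ?P" "\<tau> \<in> ?P" "map \<sigma> xs = map \<tau> xs"
    show "\<sigma> = \<tau>"
    proof
      fix i show "\<sigma> i = \<tau> i"
      proof (cases "i \<in> {1..n}")
        case True
        then show ?thesis using *(3) set by auto
      next
        case False
        then show ?thesis using * by (auto simp: permutes_def)
      qed
    qed
  qed
  have sub: "(\<lambda>\<sigma>. map \<sigma> xs) ` ?P \<subseteq> permutations_of_set {1..n}"
  proof (rule image_subsetI)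
    fix \<sigma> assume "\<sigma> \<in> ?P"
    then have p: "\<sigma> permutes {1..n}" by simp
    have "set (map \<sigma> xs) = {1..n}" using permutes_image[OF p] set by simp
    moreover have "distinct (map \<sigma> xs)"
      using dist permutes_inj_on[OF p] by (simp add: distinct_map)
    ultimately show "map \<sigma> xs \<in> permutations_of_set {1..n}" by (rule permutations_of_setI)
  qed
  have "card ((\<lambda>\<sigma>. map \<sigma> xs) ` ?P) = card (permutations_of_set {1..n})"
    using card_image[OF inj] card_permutations[of "{1..n}" n] by simp
  then have img: "(\<lambda>\<sigma>. map \<sigma> xs) ` ?P = permutations_of_set {1..n}"
    using sub by (intro card_subset_eq) auto
  have "permanent n A = (\<Sum>\<sigma>\<in>?P. \<Prod>j<n. A (n - j, (map \<sigma> xs) ! j))"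
    unfolding permanent_def
  proof (rule sum.cong[OF refl])
    fix \<sigma>
    show "(\<Prod>i = 1..n. A (i, \<sigma> i)) = (\<Prod>j<n. A (n - j, (map \<sigma> xs) ! j))"
      by (rule prod.reindex_bij_witness[where i = "\<lambda>j. n - j" and j = "\<lambda>i. n - i"]) (auto simp: nth len)
  qed
  also have "\<dots> = ordering_sum (\<lambda>i x. A (i, x)) n {1..n}"
    unfolding ordering_sum_def img[symmetric] sum.reindex[OF inj] o_def ..
  finally show ?thesis .
qed

text \<open>Before any row is revealed, the only relevant value is the empty permanent, which is \<open>1\<close>.\<close>

definition unit_state :: "'a set \<Rightarrow> 'a set \<Rightarrow> real" where
  "unit_state U T = of_bool (T = U)"

lemma permanent_eq_last_state:
  "permanent n A = last_state {1..n} (\<lambda>i x. A (i, x)) n (unit_state {1..n})"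
proof -
  have "T = {1..n}" if "T \<in> lev {1..n} n" for T
    using that card_subset_eq[of "{1..n}" T] by (simp add: lev_def)
  moreover have "{1..n} \<in> lev {1..n} n" by (simp add: lev_def)
  ultimately have l: "lev {1..n} n = {{1..n}}" by auto
  show ?thesis unfolding permanent_eq_ordering_sum last_state_eq[OF finite_atLeastAtMost] l
    by (simp add: unit_state_def)
qed

lemma avg_row:
  fixes G :: "('a \<Rightarrow> real) \<Rightarrow> real"
  assumes "finite U"
  shows "avg ({a} \<times> U) (\<lambda>\<alpha>. G (\<lambda>x. \<alpha> (a, x))) = avg U G"
proof -
  have "bij_betw (\<lambda>\<alpha> x. \<alpha> (a, x)) (signs ({a} \<times> U)) (signs U)"
    by (rule bij_betwI[where g = "\<lambda>\<xi> (b, x). if b = a then \<xi> x else 0"])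
      (auto simp: signs_def PiE_dflt_def fun_eq_iff)
  then have "(\<Sum>\<alpha>\<in>signs ({a} \<times> U). G (\<lambda>x. \<alpha> (a, x))) = (\<Sum>\<xi>\<in>signs U. G \<xi>)"
    by (rule sum.reindex_bij_betw)
  then show ?thesis unfolding avg_def using assms by (simp add: card_cartesian_product)
qed

lemma pr_last_state:
  assumes "finite U"
  shows "pr ({1..m} \<times> U) (\<lambda>A. \<bar>last_state U (\<lambda>i x. A (i, x)) m f\<bar> < \<theta>) = light U \<theta> m f"
proof (induction m arbitrary: f)
  case 0
  then show ?case by (simp add: avg_empty)
next
  case (Suc m)
  have V: "{1..Suc m} \<times> U = ({Suc m} \<times> U) \<union> ({1..m} \<times> U)" by auto
  have l: "last_state U (\<lambda>i x. merge_on ({Suc m} \<times> U) \<alpha> \<beta> (i, x)) (Suc m) f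
    = last_state U (\<lambda>i x. \<beta> (i, x)) m (step U (\<lambda>x. \<alpha> (Suc m, x)) f)" for \<alpha> \<beta>
  proof -
    have "step U (\<lambda>x. merge_on ({Suc m} \<times> U) \<alpha> \<beta> (Suc m, x)) f = step U (\<lambda>x. \<alpha> (Suc m, x)) f"
      unfolding step_def by (intro ext sum.cong) auto
    moreover have "last_state U (\<lambda>i x. merge_on ({Suc m} \<times> U) \<alpha> \<beta> (i, x)) m g
      = last_state U (\<lambda>i x. \<beta> (i, x)) m g" for g
      by (intro last_state_cong) auto
    ultimately show ?thesis by simp
  qed
  have "pr ({1..Suc m} \<times> U) (\<lambda>A. \<bar>last_state U (\<lambda>i x. A (i, x)) (Suc m) f\<bar> < \<theta>)
      = avg ({Suc m} \<times> U) (\<lambda>\<alpha>. light U \<theta> m (step U (\<lambda>x. \<alpha> (Suc m, x)) f))"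
    unfolding V by (subst avg_Un) (use assms in \<open>auto simp only: l Suc.IH finite_cartesian_product finite_insert finite.emptyI finite_atLeastAtMost\<close>, auto)
  also have "\<dots> = light U \<theta> (Suc m) f"
    unfolding light.simps by (rule avg_row[OF assms, of "Suc m" "\<lambda>\<xi>. light U \<theta> m (step U \<xi> f)"])
  finally show ?case .
qed

lemma prob_permanent_ge:
  "measure_pmf.prob (rademacher_matrix_pmf n) {A. \<theta> \<le> \<bar>permanent n A\<bar>}
    = 1 - light {1..n} \<theta> n (unit_state {1..n})"
proof -
  let ?V = "{1..n} \<times> {1..n}" and ?E = "{A. \<theta> \<le> \<bar>permanent n A\<bar>}"
  have fs: "finite (signs ?V)" "signs ?V \<noteq> {}"
    using finite_signs[of ?V] card_signs[of ?V] by auto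
  have "rademacher_matrix_pmf n = pmf_of_set (signs ?V)"
    unfolding rademacher_matrix_pmf_def rademacher_pmf_def signs_def by (rule Pi_pmf_of_set) auto
  then have "measure_pmf.prob (rademacher_matrix_pmf n) ?E = card (signs ?V \<inter> ?E) / card (signs ?V)"
    using fs by (simp add: measure_pmf_of_set)
  also have "\<dots> = pr ?V (\<lambda>A. A \<in> ?E)"
    unfolding avg_def using fs by (simp add: card_signs sum.inter_filter[symmetric] Int_def)
  also have "\<dots> = pr ?V (\<lambda>A. \<not> \<bar>permanent n A\<bar> < \<theta>)" by (simp add: not_less)
  also have "\<dots> = 1 - pr ?V (\<lambda>A. \<bar>permanent n A\<bar> < \<theta>)" by (rule pr_not) simp
  finally show ?thesis unfolding permanent_eq_last_state pr_last_state[OF finite_atLeastAtMost] .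
qed

section \<open>Choice of the parameters\<close>

lemma hsum_le: "1 \<le> m \<Longrightarrow> hsum (Suc m) \<le> 1 + ln (real m)"
proof (induction m rule: dec_induct)
  case base
  then show ?case by (simp add: hsum_def)
next
  case (step m)
  have "ln (real m / real (Suc m)) \<le> real m / real (Suc m) - 1"
    using step by (intro ln_le_minus_one) auto
  also have "\<dots> = - (1 / real (Suc m))" by (simp add: field_simps)
  finally have "1 / real (Suc m) \<le> ln (real (Suc m)) - ln (real m)"
    using step by (simp add: ln_div del: of_nat_Suc)
  then show ?case using hsum_Suc[of "Suc m"] step by simp
qed

lemma hsum_diff_ge:
  assumes "1 \<le> m" "m \<le> m'"
  shows "ln (real m') - ln (real m) \<le> hsum m' - hsum m"
  using assms(2)
proof (induction m' rule: dec_induct)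
  case (step k)
  note step = step assms(1)
  have "ln (real (Suc k) / real k) \<le> real (Suc k) / real k - 1"
    using step by (intro ln_le_minus_one) auto
  also have "\<dots> = 1 / real k" using step by (simp add: field_simps)
  finally have "ln (real (Suc k)) - ln (real k) \<le> 1 / real k"
    using step by (simp add: ln_div del: of_nat_Suc)
  then show ?case using hsum_Suc[of k] step by simp
qed simp

lemma ln_fact_ge: "1 \<le> u \<Longrightarrow> real u * ln (real u) - real u \<le> ln (fact u)"
proof (induction u rule: dec_induct)
  case (step u)
  have "ln (real (Suc u) / real u) \<le> real (Suc u) / real u - 1"
    using step by (intro ln_le_minus_one) auto
  also have "\<dots> = 1 / real u" using step by (simp add: field_simps)
  finally have "ln (real (Suc u)) - ln (real u) \<le> 1 / real u"
    using step by (simp add: ln_div del: of_nat_Suc)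
  then have "real u * (ln (real (Suc u)) - ln (real u)) \<le> real u * (1 / real u)"
    by (intro mult_left_mono) auto
  then have "real u * ln (real (Suc u)) \<le> real u * ln (real u) + 1"
    using step by (simp add: right_diff_distrib)
  moreover have "ln (fact (Suc u)) = ln (real (Suc u)) + ln (fact u)"
    by (simp add: ln_mult del: of_nat_Suc)
  moreover have "real (Suc u) * ln (real (Suc u)) = real u * ln (real (Suc u)) + ln (real (Suc u))"
    by (simp add: distrib_right)
  ultimately show ?case using step.IH by simp
qed simp

text \<open>The three terms come from \<open>light_le_core\<close>, from rows that are not steady, and from \<open>growth_phase\<close>.\<close>

definition end_error :: "real \<Rightarrow> real" where
  "end_error x = 16 * x powr (-1/400) + 40 * x * exp (- (x powr (1/1000) / (7500 * (1 + ln x))))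
     + x * exp (- ((ln x)\<^sup>2 / 120000))"

lemma ceiling_powr_bounds:
  assumes "1 \<le> x" "0 \<le> a"
  shows "x powr a \<le> real (nat \<lceil>x powr a\<rceil>)" "real (nat \<lceil>x powr a\<rceil>) \<le> 2 * x powr a"
    "1 \<le> nat \<lceil>x powr a\<rceil>"
proof -
  have 1: "1 \<le> x powr a" using assms by (rule ge_one_powr_ge_zero)
  then have "0 \<le> \<lceil>x powr a\<rceil>" by simp
  then have eq: "real (nat \<lceil>x powr a\<rceil>) = of_int \<lceil>x powr a\<rceil>" by simp
  show "x powr a \<le> real (nat \<lceil>x powr a\<rceil>)" unfolding eq by (rule le_of_int_ceiling)
  have "of_int \<lceil>x powr a\<rceil> \<le> x powr a + 1" by linarith
  then show "real (nat \<lceil>x powr a\<rceil>) \<le> 2 * x powr a" unfolding eq using 1 by linarith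
  show "1 \<le> nat \<lceil>x powr a\<rceil>" using 1 by linarith
qed

text \<open>The exponents fit together as follows. The entropy losses from level \<open>u \<approx> sqrt n\<close> on leave
\<open>Y \<ge> n powr (1/10)\<close> up to a constant, because a fraction \<open>1/5\<close> of \<open>ln u\<close> remains. This has to exceed
\<open>4 * M * D * exp r\<close> with \<open>M = n powr (1/100)\<close>, \<open>D = n powr (6/100)\<close> and \<open>exp r = n powr (2/100)\<close>. Also
\<open>D\<close> has to be larger than \<open>M ^ 5\<close> for \<open>light_le_core\<close>, where the number of rows is paid for by the fourth
root of \<open>D / M\<close>.\<close>

lemma one_heavy_suffices:
  assumes U: "finite U" and x: "x = real (card U)" and x1: "1 \<le> x"
    and u: "1 \<le> u" "u \<le> card U" "sqrt x / 2 \<le> real u"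
    and T: "T \<in> lev U u" "\<theta> \<le> \<bar>f T\<bar>" and \<theta>: "\<theta> > 0"
    and E1: "13 \<le> ln x / 50" and E2: "ln x / 50 \<le> x powr (1/1000)"
    and E3: "ln (4 * (2 * x powr (1/100)) * (2 * x powr (6/100))) + ln x / 50 \<le> 1/5 * ln (sqrt x / 2) - 9/5"
    and E4: "2 * x powr (1/1000) \<le> x powr (1/100)"
    and E5: "2 * x powr (1/100) \<le> sqrt x / 2"
    and E6: "ln x / 200 \<le> ln (x powr (1/100) / (2 * x powr (1/1000)))"
  shows "light U \<theta> u f \<le> end_error x"
proof -
  define m1 where "m1 = nat \<lceil>x powr (1/1000)\<rceil>"
  define M where "M = nat \<lceil>x powr (1/100)\<rceil>"
  define D where "D = nat \<lceil>x powr (6/100)\<rceil>"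
  \<comment> \<open>With at least \<open>D\<close> extensions and the fraction \<open>1 / (2 * M)\<close> of them heavy, \<open>h\<close> of them are heavy.\<close>
  define h where "h = D div (2 * M)"
  define r where "r = ln x / 50"
  define y where "y = 1/5 * ln (real u) - 9/5"
  define q where "q = 20 * exp (- (x powr (1/1000) / (7500 * (1 + ln x))))"
  define \<kappa> where "\<kappa> = 4 * real M * (real h + 1) powr (-1/4)"
  have lnx: "0 \<le> ln x" using x1 by simp
  have m1: "x powr (1/1000) \<le> real m1" "real m1 \<le> 2 * x powr (1/1000)" "1 \<le> m1"
    unfolding m1_def using ceiling_powr_bounds[OF x1, of "1/1000"] by auto
  have M: "x powr (1/100) \<le> real M" "real M \<le> 2 * x powr (1/100)" "1 \<le> M"
    unfolding M_def using ceiling_powr_bounds[OF x1, of "1/100"] by auto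
  have D: "x powr (6/100) \<le> real D" "real D \<le> 2 * x powr (6/100)" "1 \<le> D"
    unfolding D_def using ceiling_powr_bounds[OF x1, of "6/100"] by auto
  have "real m1 \<le> real M" using m1 M E4 by linarith
  then have m1M: "m1 \<le> M" by simp
  have "real M \<le> real u" using M E5 u by linarith
  then have Mu: "M \<le> u" by simp
  have \<kappa>0: "0 \<le> \<kappa>" unfolding \<kappa>_def by simp
  have q1: "20 * exp (- (real m1 / (7500 * (1 + ln (real (card U)))))) \<le> q"
    unfolding q_def x[symmetric] using m1 lnx by (auto intro!: divide_right_mono)
  have qM: "20 * exp (- (real M / (7500 * (1 + ln (real (card U)))))) \<le> q"
    unfolding q_def x[symmetric] using m1 m1M lnx by (auto intro!: divide_right_mono)
  have q0: "0 \<le> q" unfolding q_def by simp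
  have core: "light U \<theta> m g \<le> \<kappa>"
    if m: "m \<le> M" "1 \<le> m" and H': "H' \<subseteq> heavies U \<theta> m g" "H' \<noteq> {}"
      and dg: "\<And>T i. T \<in> H' \<Longrightarrow> i \<in> T \<Longrightarrow> D \<le> degree H' (T - {i})" for m g H'
  proof -
    have "2 * m * h \<le> 2 * M * h" using m by simp
    also have "\<dots> \<le> D" unfolding h_def by simp
    finally have "light U \<theta> m g \<le> 4 * real m * (real h + 1) powr (-1/4)"
      using light_le_core[OF U \<theta> H' m(2) dg D(3)] by blast
    also have "\<dots> \<le> \<kappa>" unfolding \<kappa>_def using m by (intro mult_right_mono) auto
    finally show ?thesis .
  qed
  have ry: "ln (4 * real M * real D) + r \<le> y"
  proof -
    have "4 * real M * real D \<le> 4 * (2 * x powr (1/100)) * (2 * x powr (6/100))"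
      using M D by (intro mult_mono) auto
    then have "ln (4 * real M * real D) \<le> ln (4 * (2 * x powr (1/100)) * (2 * x powr (6/100)))"
      using M D x1 by (subst ln_le_cancel_iff) auto
    moreover have "ln (sqrt x / 2) \<le> ln (real u)" using u x1 by (subst ln_le_cancel_iff) auto
    ultimately show ?thesis using E3 unfolding r_def y_def by linarith
  qed
  define \<kappa>' where "\<kappa>' = \<kappa> + real M * q + x * exp (- ((ln x)\<^sup>2 / 120000))"
  have \<kappa>'0: "0 \<le> \<kappa>'" unfolding \<kappa>'_def using \<kappa>0 q0 x1 by simp
  have mid: "light U \<theta> M g \<le> \<kappa>'"
    if g: "heavies U \<theta> M g \<noteq> {}" "y + 4/5 * hsum M \<le> log_base U \<theta> M g" for g
  proof -
    have "light U \<theta> (m1 + (M - m1)) g \<le> \<kappa> + real (M - m1) * q +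
      real (card U) * exp (- log_base U \<theta> (m1 + (M - m1)) g - r / 12 * (hsum (m1 + (M - m1)) - hsum m1))"
    proof (rule growth_phase[OF U D(3) m1(3) core \<kappa>0 q1])
      show "13 \<le> r" "r \<le> real m1" using E1 E2 m1 unfolding r_def by linarith+
    qed (use g ry m1M in auto)
    then have "light U \<theta> M g \<le> \<kappa> + real (M - m1) * q + x * exp (- log_base U \<theta> M g - r / 12 * (hsum M - hsum m1))"
      using m1M unfolding x by simp
    also have "\<dots> \<le> \<kappa>'" unfolding \<kappa>'_def
    proof (intro add_mono mult_mono order_refl)
      have "ln x / 200 \<le> ln (real M / real m1)"
      proof -
        have "x powr (1/100) / (2 * x powr (1/1000)) \<le> real M / real m1"
          using M m1 by (intro frac_le) auto
        then have "ln (x powr (1/100) / (2 * x powr (1/1000))) \<le> ln (real M / real m1)"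
          using M m1 x1 by (subst ln_le_cancel_iff) auto
        then show ?thesis using E6 by linarith
      qed
      also have "\<dots> = ln (real M) - ln (real m1)" using M m1 by (simp add: ln_div)
      also have "\<dots> \<le> hsum M - hsum m1" by (rule hsum_diff_ge[OF m1(3) m1M])
      finally have "r / 12 * (ln x / 200) \<le> r / 12 * (hsum M - hsum m1)"
        unfolding r_def using lnx by (intro mult_left_mono) auto
      moreover have "r / 12 * (ln x / 200) = (ln x)\<^sup>2 / 120000"
        unfolding r_def by (simp add: power2_eq_square)
      moreover have "0 \<le> log_base U \<theta> M g" by (rule log_base_le(1)[OF U M(3) g(1)])
      ultimately show "exp (- log_base U \<theta> M g - r / 12 * (hsum M - hsum m1)) \<le> exp (- ((ln x)\<^sup>2 / 120000))"
        by (subst exp_le_cancel_iff) linarith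
    qed (use q0 x1 in auto)
    finally show ?thesis .
  qed
  have Tu: "T \<in> heavies U \<theta> u f" using T unfolding heavies_def by simp
  then have ne: "heavies U \<theta> u f \<noteq> {}" by auto
  have "light U \<theta> (M + (u - M)) f \<le> \<kappa>' + real (u - M) * q"
  proof (rule steady_phase[OF U M(3) qM \<kappa>'0 mid])
    show "heavies U \<theta> (M + (u - M)) f \<noteq> {}" using ne Mu by simp
    have "1 * fact u \<le> real (card (heavies U \<theta> u f)) * fact u"
      using ne finite_heavies[OF U, of \<theta> u f] by (intro mult_right_mono) (auto simp: Suc_le_eq card_gt_0_iff)
    then have "ln (fact u) \<le> ln (real (card (heavies U \<theta> u f)) * fact u)"
      by (subst ln_le_cancel_iff) (use less_le_trans[OF fact_gt_zero] in auto)
    then have "(real u * ln (real u) - real u) / real u \<le> log_base U \<theta> u f"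
      unfolding log_base_def using ln_fact_ge[OF u(1)] by (intro divide_right_mono) auto
    then have "ln (real u) - 1 \<le> log_base U \<theta> u f" using u(1) by (simp add: diff_divide_distrib)
    moreover have "hsum u \<le> 1 + ln (real u)" using hsum_mono[of u "Suc u"] hsum_le[OF u(1)] by simp
    ultimately have "y + 4/5 * hsum u \<le> log_base U \<theta> u f" unfolding y_def by simp
    then show "y + 4/5 * hsum (M + (u - M)) \<le> log_base U \<theta> (M + (u - M)) f" using Mu by simp
  qed
  then have "light U \<theta> u f \<le> \<kappa>' + real (u - M) * q" using Mu by simp
  also have "\<dots> = \<kappa> + (real M + real (u - M)) * q + x * exp (- ((ln x)\<^sup>2 / 120000))"
    unfolding \<kappa>'_def by (simp add: algebra_simps)
  also have "\<dots> \<le> 16 * x powr (-1/400) + (2 * x) * q + x * exp (- ((ln x)\<^sup>2 / 120000))"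
  proof (intro add_mono mult_right_mono order_refl)
    have "real u \<le> x" unfolding x using u by simp
    then show "real M + real (u - M) \<le> 2 * x" using Mu x1 by simp
    have "D < 2 * M * (h + 1)" unfolding h_def using M(3) dividend_less_times_div[of "2 * M" D] by simp
    then have "real D \<le> real (2 * M * (h + 1))" by (simp only: of_nat_le_iff)
    then have "real D / (2 * real M) \<le> real h + 1" using M(3) by (simp add: field_simps)
    moreover have "x powr (6/100) / (2 * (2 * x powr (1/100))) \<le> real D / (2 * real M)"
      using M D by (intro frac_le) auto
    moreover have "x powr (6/100) / (2 * (2 * x powr (1/100))) = x powr (1/20) / 4"
      using x1 by (simp add: powr_diff[symmetric] field_simps)
    ultimately have "x powr (1/20) / 4 \<le> real h + 1" by linarith
    then have "(real h + 1) powr (-1/4) \<le> (x powr (1/20) / 4) powr (-1/4)"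
      using x1 by (intro powr_mono2') auto
    also have "\<dots> = x powr (-1/80) * 4 powr (1/4)"
      using x1 by (simp add: powr_divide powr_powr powr_minus_divide)
    also have "4 powr (1/4) \<le> (2::real)" using powr_mono[of "1/4" "1/2" "4::real"] by (simp add: powr_half_sqrt)
    finally have "(real h + 1) powr (-1/4) \<le> x powr (-1/80) * 2" by (simp add: mult_left_mono)
    then have "\<kappa> \<le> 4 * (2 * x powr (1/100)) * (x powr (-1/80) * 2)"
      unfolding \<kappa>_def using M by (intro mult_mono) auto
    also have "\<dots> = 16 * (x powr (1/100) * x powr (-1/80))" by simp
    also have "x powr (1/100) * x powr (-1/80) = x powr (-1/400)" by (simp add: powr_add[symmetric])
    finally show "\<kappa> \<le> 16 * x powr (-1/400)" .
  qed (use q0 in auto)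
  also have "\<dots> = end_error x" unfolding end_error_def q_def by simp
  finally show ?thesis .
qed

text \<open>The constant in the exponent has to absorb \<open>2 ^ n\<close>, the factors \<open>loss ^ 16\<close> of all rows, the factorial of \<open>u\<close>,
and a surplus of \<open>exp (- 16 * n)\<close>.\<close>

lemma exp_theta_bound:
  fixes n u :: nat
  assumes "u\<^sup>2 \<le> n" "u \<le> n"
  defines "C \<equiv> (17 + ln 2 + 16 * ln loss) / 2"
  defines "\<theta> \<equiv> exp (- C * real n) * sqrt (fact n)"
  shows "(\<theta>\<^sup>2 * 2 ^ n * loss ^ (16 * (n - u)) * fact u / fact n) powr (1/16) \<le> exp (- real n)"
proof -
  have l: "loss > 0" using loss_ge_1 by linarith
  have "\<theta>\<^sup>2 = exp (- (2 * C * real n)) * fact n"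
    unfolding \<theta>_def by (simp add: power_mult_distrib exp_double[symmetric] mult_ac)
  then have "\<theta>\<^sup>2 * 2 ^ n * loss ^ (16 * (n - u)) * fact u / fact n
      = exp (- (2 * C * real n)) * 2 ^ n * loss ^ (16 * (n - u)) * fact u" by simp
  also have "\<dots> \<le> exp (- (2 * C * real n)) * exp (ln 2 * real n) * exp (16 * ln loss * real n) * exp (real n)"
  proof (intro mult_mono order_refl)
    show "(2::real) ^ n \<le> exp (ln 2 * real n)" by (simp add: exp_of_nat2_mult)
    have "loss ^ (16 * (n - u)) \<le> loss ^ (16 * n)" using loss_ge_1 by (intro power_increasing) auto
    also have "loss ^ (16 * n) = exp (ln loss) ^ (16 * n)" using l by simp
    also have "\<dots> = exp (16 * ln loss * real n)" by (simp add: exp_of_nat_mult[symmetric] mult_ac)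
    finally show "loss ^ (16 * (n - u)) \<le> exp (16 * ln loss * real n)" .
    have "fact u \<le> real (u ^ u)" by (rule fact_le_power)
    also have "\<dots> = real u ^ u" by simp
    also have "real u \<le> exp (real u)" using exp_ge_add_one_self[of "real u"] by linarith
    then have "real u ^ u \<le> exp (real u) ^ u" by (intro power_mono) auto
    also have "\<dots> = exp (real (u\<^sup>2))" by (simp add: exp_of_nat_mult[symmetric] power2_eq_square)
    also have "\<dots> \<le> exp (real n)" using assms(1) by (simp only: exp_le_cancel_iff of_nat_le_iff)
    finally show "fact u \<le> exp (real n)" .
  qed (use l in auto)
  also have "\<dots> = exp (- (16 * real n))"
    unfolding exp_add[symmetric] C_def by (intro arg_cong[where f = exp]) (simp add: field_simps)
  finally have "(\<theta>\<^sup>2 * 2 ^ n * loss ^ (16 * (n - u)) * fact u / fact n) powr (1/16) \<le> exp (- (16 * real n)) powr (1/16)"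
    using l by (intro powr_mono2) auto
  also have "\<dots> = exp (- real n)" by (simp add: powr_def)
  finally show ?thesis .
qed

theorem theorem1p2:
  shows "\<exists>(C::real) (c::real) (n0::nat). C > 0 \<and> c > 0 \<and>
    (\<forall>n\<ge>n0. measure_pmf.prob (rademacher_matrix_pmf n)
        {A. \<bar>permanent n A\<bar> \<ge> exp (- C * real n) * sqrt (fact n)}
      \<ge> 1 - real n powr (- c))"
proof -
  define C where "C = (17 + ln 2 + 16 * ln loss) / 2"
  have "0 \<le> ln loss" using loss_ge_1 by simp
  then have C: "C > 0" unfolding C_def by (simp add: add_pos_nonneg)
  have "\<forall>\<^sub>F n::nat in at_top. 1 \<le> real n \<and> 13 \<le> ln (real n) / 50 \<and> ln (real n) / 50 \<le> real n powr (1/1000) \<and>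
     ln (4 * (2 * real n powr (1/100)) * (2 * real n powr (6/100))) + ln (real n) / 50 \<le> 1/5 * ln (sqrt (real n) / 2) - 9/5 \<and>
     2 * real n powr (1/1000) \<le> real n powr (1/100) \<and>
     2 * real n powr (1/100) \<le> sqrt (real n) / 2 \<and>
     ln (real n) / 200 \<le> ln (real n powr (1/100) / (2 * real n powr (1/1000))) \<and>
     end_error (real n) + real n * (2 * (9/10) powr (sqrt (real n) - 1)) + exp (- real n) \<le> real n powr (- (1/1000))"
    unfolding end_error_def by (intro eventually_conj; real_asymp)
  then obtain n0 where n0: "\<And>n. n \<ge> n0 \<Longrightarrow> 1 \<le> real n \<and> 13 \<le> ln (real n) / 50 \<and> ln (real n) / 50 \<le> real n powr (1/1000) \<and>
     ln (4 * (2 * real n powr (1/100)) * (2 * real n powr (6/100))) + ln (real n) / 50 \<le> 1/5 * ln (sqrt (real n) / 2) - 9/5 \<and>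
     2 * real n powr (1/1000) \<le> real n powr (1/100) \<and>
     2 * real n powr (1/100) \<le> sqrt (real n) / 2 \<and>
     ln (real n) / 200 \<le> ln (real n powr (1/100) / (2 * real n powr (1/1000))) \<and>
     end_error (real n) + real n * (2 * (9/10) powr (sqrt (real n) - 1)) + exp (- real n) \<le> real n powr (- (1/1000))"
    unfolding eventually_at_top_linorder by blast
  have "1 - real n powr (- (1/1000)) \<le> measure_pmf.prob (rademacher_matrix_pmf n)
        {A. \<bar>permanent n A\<bar> \<ge> exp (- C * real n) * sqrt (fact n)}" if n: "n \<ge> n0" for n
  proof -
    define U where "U = {1..n}"
    define \<theta> where "\<theta> = exp (- C * real n) * sqrt (fact n)"
    define u where "u = nat \<lfloor>sqrt (real n)\<rfloor>"
    note E = n0[OF n]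
    have fU: "finite U" and cU: "card U = n" unfolding U_def by auto
    have \<theta>: "\<theta> > 0" unfolding \<theta>_def by simp
    have n1: "1 \<le> real n" using E by blast
    have s1: "1 \<le> sqrt (real n)" using n1 by simp
    have uf: "real u = of_int \<lfloor>sqrt (real n)\<rfloor>" unfolding u_def using s1 by simp
    have ur: "real u \<le> sqrt (real n)" "sqrt (real n) - 1 \<le> real u" "1 \<le> u"
      unfolding uf using s1 by (linarith, linarith, simp add: u_def le_nat_iff)
    have "(real u)\<^sup>2 \<le> (sqrt (real n))\<^sup>2" using ur by (intro power_mono) auto
    then have "real (u\<^sup>2) \<le> real n" by simp
    then have u2: "u\<^sup>2 \<le> n" by (simp only: of_nat_le_iff)
    then have un: "u \<le> n" using self_le_power[OF ur(3), of 2] by linarith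
    have half: "sqrt (real n) / 2 \<le> real u"
    proof (cases "sqrt (real n) \<le> 2")
      case True
      have "1 \<le> real u" using ur(3) by simp
      then show ?thesis using True by linarith
    next
      case False
      then show ?thesis using ur(2) by linarith
    qed
    have "(sqrt (real n) / 2)\<^sup>2 \<le> (real u)\<^sup>2" using half by (intro power_mono) auto
    then have "real n \<le> real (4 * u\<^sup>2)" by (simp add: power_divide)
    then have n4: "card U \<le> 4 * u\<^sup>2" unfolding cU by (simp only: of_nat_le_iff)
    have heavy: "light U \<theta> u f \<le> end_error (real n)" if "T \<in> lev U u" "\<theta> \<le> \<bar>f T\<bar>" for f T
      by (rule one_heavy_suffices[where U = U]) (use that fU cU \<theta> ur un half E in auto)
    have ee: "0 \<le> end_error (real n)" unfolding end_error_def by simp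
    have "lev U n = {U}" unfolding lev_def using card_subset_eq[OF fU] cU by auto
    then have ssq: "ssq U n (unit_state U) = 1" unfolding ssq_def unit_state_def by simp
    have unu: "u + (n - u) = n" using un by simp
    have "light U \<theta> (u + (n - u)) (unit_state U) \<le> end_error (real n) + real (n - u) * (2 * (9/10) ^ u) +
      (\<theta>\<^sup>2 * 2 ^ card U * loss ^ (16 * (n - u)) * fact u / fact (u + (n - u)) / ssq U (u + (n - u)) (unit_state U)) powr (1/16)"
      by (rule magnitude_phase[OF fU ur(3) n4 \<theta> ee heavy]) (auto simp: unu ssq)
    then have "light U \<theta> n (unit_state U) \<le> end_error (real n) + real (n - u) * (2 * (9/10) ^ u) +
      (\<theta>\<^sup>2 * 2 ^ n * loss ^ (16 * (n - u)) * fact u / fact n) powr (1/16)"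
      unfolding unu ssq cU by simp
    also have "\<dots> \<le> end_error (real n) + real n * (2 * (9/10) powr (sqrt (real n) - 1)) + exp (- real n)"
    proof (intro add_mono mult_mono order_refl)
      have "(9/10 :: real) ^ u = (9/10) powr (real u)" by (simp add: powr_realpow)
      also have "\<dots> \<le> (9/10) powr (sqrt (real n) - 1)" using ur by (intro powr_mono') auto
      finally show "(9/10 :: real) ^ u \<le> (9/10) powr (sqrt (real n) - 1)" .
      show "(\<theta>\<^sup>2 * 2 ^ n * loss ^ (16 * (n - u)) * fact u / fact n) powr (1/16) \<le> exp (- real n)"
        unfolding \<theta>_def C_def by (rule exp_theta_bound[OF u2 un])
    qed auto
    also have "\<dots> \<le> real n powr (- (1/1000))" using E by blast
    finally have "light U \<theta> n (unit_state U) \<le> real n powr (- (1/1000))" .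
    then show ?thesis using prob_permanent_ge[of n \<theta>] unfolding U_def \<theta>_def by simp
  qed
  then show ?thesis using C by (intro exI[of _ C] exI[of _ "1/1000"] exI[of _ n0]) simp
qed

end
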